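(* Let $\Gamma$ be a torsion-free countable discrete group with positive first $L^2$-Betti number, $\beta_1^{(2)}(\Gamma)>0$. Assume that every nonzero element of the integral group ring $\mathbb{Z}\Gamma$ acts without kernel (i.e. injectively) on $\ell^2(\Gamma)$. Then $\Gamma$ satisfies the ISR property.
   Context: For a discrete group $\Gamma$, let $\lambda:\Gamma\to \mathcal{U}(\ell^2(\Gamma))$ be the left regular representation, $\lambda(s)\delta_t=\delta_{st}$, and let $L(\Gamma)=\overline{\mathrm{span}\{\lambda(s):s\in\Gamma\}}^{\,w.o.t.}\subseteq \mathbb{B}(\ell^2(\Gamma))$ be the group von Neumann algebra. For a subgroup $\Lambda\le\Gamma$, $L(\Lambda)$ is identified with the von Neumann subalgebra of $L(\Gamma)$ generated by $\{\lambda(s):s\in\Lambda\}$. Von Neumann subalgebras are unital (same unit). A von Neumann subalgebra $\mathcal{M}\subseteq L(\Gamma)$ is $\Gamma$-invariant if $\lambda(g)\mathcal{M}\lambda(g)^*=\mathcal{M}$ for all $g\in\Gamma$. A countable discrete group $\Gamma$ satisfies the invariant von Neumann subalgebras rigidity (ISR) property if every $\Gamma$-invariant von Neumann subalgebra of $L(\Gamma)$ is of the form $L(\Lambda)$ for some normal subgroup $\Lambda\lhd\Gamma$. The first $L^2$-Betti number $\beta_1^{(2)}(\Gamma)$ is the (Lück/von Neumann) dimension over $L(\Gamma)$ of $H^1(\Gamma,\ell^2(\Gamma))$ (equivalently of $H_1(\Gamma,\ell^2(\Gamma))$). The group ring $\mathbb{Z}\Gamma$ acts on $\ell^2(\Gamma)$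 by extending $\lambda$ linearly. *)

theory Defs
  imports
    "HOL-Analysis.Analysis"
    "HOL-Library.Function_Algebras"
    "HOL-Algebra.AbelCoset"
    "HOL-Algebra.Module"
begin

text \<open>Sums, differences and \<open>0\<close> of vectors, operators and cocycles below are the pointwise ones on
  function types.\<close>

section \<open>The Hilbert space of square-summable functions and its bounded operators\<close>

text \<open>A vector is represented by a function on the whole type vanishing off the group, and an
  operator by a function on all functions, with value \<open>0\<close> off the Hilbert space. These conventions
  make representatives unique, so that equality of sets of operators is the usual equality.\<close>

type_synonym 'g vec = "'g \<Rightarrow> complex"
type_synonym 'g oper = "'g vec \<Rightarrow> 'g vec"

definition ell2 :: "('g, 'm) monoid_scheme \<Rightarrow> 'g vec set" where
  "ell2 G = {f. (\<forall>x. x \<notin> carrier G \<longrightarrow> f x = 0) \<and>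
                (\<lambda>x. (cmod (f x))\<^sup>2) summable_on carrier G}"

definition ell2_inner :: "('g, 'm) monoid_scheme \<Rightarrow> 'g vec \<Rightarrow> 'g vec \<Rightarrow> complex" where
  "ell2_inner G f g = (\<Sum>\<^sub>\<infinity>x\<in>carrier G. f x * cnj (g x))"

definition ell2_norm :: "('g, 'm) monoid_scheme \<Rightarrow> 'g vec \<Rightarrow> real" where
  "ell2_norm G f = sqrt (\<Sum>\<^sub>\<infinity>x\<in>carrier G. (cmod (f x))\<^sup>2)"

definition delta :: "'g \<Rightarrow> 'g vec" where
  "delta t = (\<lambda>x. if x = t then 1 else 0)"

definition vscale :: "complex \<Rightarrow> 'g vec \<Rightarrow> 'g vec" where
  "vscale c f = (\<lambda>x. c * f x)"

definition oscale :: "complex \<Rightarrow> 'g oper \<Rightarrow> 'g oper" where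
  "oscale c T = (\<lambda>f. vscale c (T f))"

definition bounded_ops :: "('g, 'm) monoid_scheme \<Rightarrow> 'g oper set" where
  "bounded_ops G = {T.
     (\<forall>f. f \<notin> ell2 G \<longrightarrow> T f = 0) \<and>
     (\<forall>f\<in>ell2 G. T f \<in> ell2 G) \<and>
     (\<forall>f\<in>ell2 G. \<forall>g\<in>ell2 G. T (f + g) = T f + T g) \<and>
     (\<forall>c. \<forall>f\<in>ell2 G. T (vscale c f) = vscale c (T f)) \<and>
     (\<exists>C. \<forall>f\<in>ell2 G. ell2_norm G (T f) \<le> C * ell2_norm G f)}"

definition id_op :: "('g, 'm) monoid_scheme \<Rightarrow> 'g oper" where
  "id_op G = (\<lambda>f. if f \<in> ell2 G then f else 0)"

definition adj :: "('g, 'm) monoid_scheme \<Rightarrow> 'g oper \<Rightarrow> 'g oper" where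
  "adj G T = (THE S. S \<in> bounded_ops G \<and>
     (\<forall>f\<in>ell2 G. \<forall>g\<in>ell2 G. ell2_inner G (T f) g = ell2_inner G f (S g)))"

text \<open>The weak operator topology: the coarsest topology on the bounded operators for which all
  matrix coefficients are continuous.\<close>

definition wot :: "('g, 'm) monoid_scheme \<Rightarrow> 'g oper topology" where
  "wot G = topology_generated_by
     {{T \<in> bounded_ops G. ell2_inner G (T f) g \<in> U} | f g U.
        f \<in> ell2 G \<and> g \<in> ell2 G \<and> open U}"


section \<open>Group von Neumann algebras and the ISR property\<close>

definition lreg :: "('g, 'm) monoid_scheme \<Rightarrow> 'g \<Rightarrow> 'g oper" where
  "lreg G s = (\<lambda>f. if f \<in> ell2 G
     then (\<lambda>x. if x \<in> carrier G then f (inv\<^bsub>G\<^esub> s \<otimes>\<^bsub>G\<^esub> x) else 0) else 0)"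

definition lreg_span :: "('g, 'm) monoid_scheme \<Rightarrow> 'g oper set" where
  "lreg_span G = {\<Sum>s\<in>F. oscale (c s) (lreg G s) | F c. finite F \<and> F \<subseteq> carrier G}"

definition LG :: "('g, 'm) monoid_scheme \<Rightarrow> 'g oper set" where
  "LG G = wot G closure_of lreg_span G"

definition von_neumann_algebra :: "('g, 'm) monoid_scheme \<Rightarrow> 'g oper set \<Rightarrow> bool" where
  "von_neumann_algebra G M \<longleftrightarrow>
     closedin (wot G) M \<and> id_op G \<in> M \<and>
     (\<forall>S\<in>M. \<forall>T\<in>M. S + T \<in> M) \<and>
     (\<forall>c. \<forall>T\<in>M. oscale c T \<in> M) \<and>
     (\<forall>S\<in>M. \<forall>T\<in>M. S \<circ> T \<in> M) \<and>
     (\<forall>T\<in>M. adj G T \<in> M)"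

definition von_neumann_subalgebra :: "('g, 'm) monoid_scheme \<Rightarrow> 'g oper set \<Rightarrow> bool" where
  "von_neumann_subalgebra G M \<longleftrightarrow> von_neumann_algebra G M \<and> M \<subseteq> LG G"

text \<open>The algebra of a subgroup \<open>H\<close>, as the von Neumann subalgebra of \<open>LG G\<close> (thus acting on
  \<open>ell2 G\<close>) generated by \<open>H\<close>.\<close>

definition L_sub :: "('g, 'm) monoid_scheme \<Rightarrow> 'g set \<Rightarrow> 'g oper set" where
  "L_sub G H = \<Inter>{M. von_neumann_subalgebra G M \<and> lreg G ` H \<subseteq> M}"

definition group_invariant :: "('g, 'm) monoid_scheme \<Rightarrow> 'g oper set \<Rightarrow> bool" where
  "group_invariant G M \<longleftrightarrow>
     (\<forall>g\<in>carrier G. (\<lambda>T. lreg G g \<circ> T \<circ> adj G (lreg G g)) ` M = M)"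

definition ISR :: "('g, 'm) monoid_scheme \<Rightarrow> bool" where
  "ISR G \<longleftrightarrow> (\<forall>M. von_neumann_subalgebra G M \<and> group_invariant G M \<longrightarrow>
                (\<exists>H. H \<lhd> G \<and> M = L_sub G H))"


section \<open>Dimension of modules over the group von Neumann algebra\<close>

definition LG_ring :: "('g, 'm) monoid_scheme \<Rightarrow> 'g oper ring" where
  "LG_ring G = \<lparr>carrier = LG G, mult = (\<circ>), one = id_op G, zero = 0, add = (+)\<rparr>"

definition vn_trace :: "('g, 'm) monoid_scheme \<Rightarrow> 'g oper \<Rightarrow> complex" where
  "vn_trace G T = ell2_inner G (T (delta \<one>\<^bsub>G\<^esub>)) (delta \<one>\<^bsub>G\<^esub>)"

text \<open>Modules over \<open>LG_ring G\<close> are right modules, stored in the library's module record with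
  \<open>smult M T m\<close> standing for \<open>m \<cdot> T\<close>; the unused multiplicative fields are \<open>undefined\<close>.

  Columns of length \<open>n\<close> over \<open>LG G\<close> (padded with \<open>0\<close>) form a free right module, on which
  \<open>n \<times> n\<close> matrices act from the left. Every finitely generated projective right module is
  isomorphic to the image of an idempotent matrix.\<close>

definition columns :: "('g, 'm) monoid_scheme \<Rightarrow> nat \<Rightarrow> (nat \<Rightarrow> 'g oper) set" where
  "columns G n = {v. (\<forall>i<n. v i \<in> LG G) \<and> (\<forall>i\<ge>n. v i = 0)}"

definition mat_app :: "nat \<Rightarrow> (nat \<Rightarrow> nat \<Rightarrow> 'g oper) \<Rightarrow> (nat \<Rightarrow> 'g oper) \<Rightarrow> (nat \<Rightarrow> 'g oper)" where
  "mat_app n A v = (\<lambda>i. if i < n then (\<Sum>j<n. A i j \<circ> v j) else 0)"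

definition idem_mat :: "('g, 'm) monoid_scheme \<Rightarrow> nat \<Rightarrow> (nat \<Rightarrow> nat \<Rightarrow> 'g oper) \<Rightarrow> bool" where
  "idem_mat G n A \<longleftrightarrow>
     (\<forall>i<n. \<forall>j<n. A i j \<in> LG G) \<and>
     (\<forall>i<n. \<forall>k<n. (\<Sum>j<n. A i j \<circ> A j k) = A i k)"

definition mat_image :: "('g, 'm) monoid_scheme \<Rightarrow> nat \<Rightarrow> (nat \<Rightarrow> nat \<Rightarrow> 'g oper) \<Rightarrow>
    (nat \<Rightarrow> 'g oper) set" where
  "mat_image G n A = mat_app n A ` columns G n"

definition iso_onto_submodule :: "('g, 'm) monoid_scheme \<Rightarrow> nat \<Rightarrow> (nat \<Rightarrow> nat \<Rightarrow> 'g oper) \<Rightarrow>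
    ('g oper, 'v) module \<Rightarrow> 'v set \<Rightarrow> ((nat \<Rightarrow> 'g oper) \<Rightarrow> 'v) \<Rightarrow> bool" where
  "iso_onto_submodule G n A M P \<phi> \<longleftrightarrow>
     bij_betw \<phi> (mat_image G n A) P \<and>
     (\<forall>v\<in>mat_image G n A. \<forall>w\<in>mat_image G n A. \<phi> (v + w) = \<phi> v \<oplus>\<^bsub>M\<^esub> \<phi> w) \<and>
     (\<forall>v\<in>mat_image G n A. \<forall>T\<in>LG G. \<phi> (\<lambda>i. v i \<circ> T) = T \<odot>\<^bsub>M\<^esub> \<phi> v)"

text \<open>Lueck's dimension of an arbitrary module: the supremum of the dimensions of its finitely
  generated projective submodules \<open>P\<close>, where \<open>P\<close> has dimension \<open>tr A\<close> for any idempotent matrix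
  \<open>A\<close> with image isomorphic to \<open>P\<close>. (Such traces are nonnegative reals.)\<close>

definition luck_dim :: "('g, 'm) monoid_scheme \<Rightarrow> ('g oper, 'v) module \<Rightarrow> ereal" where
  "luck_dim G M = Sup {ereal (Re (\<Sum>i<n. vn_trace G (A i i))) | n A.
     idem_mat G n A \<and>
     (\<exists>P \<phi>. submodule P (LG_ring G) M \<and> iso_onto_submodule G n A M P \<phi>)}"


section \<open>First cohomology and the first L2-Betti number\<close>

text \<open>The right action of \<open>LG G\<close> on \<open>ell2 G\<close> is \<open>\<xi> \<cdot> T = J T\<^sup>* J \<xi>\<close> with \<open>J\<close> the canonical
  conjugation. It commutes with the left regular representation and extends
  \<open>delta t \<cdot> lreg G s = delta (t \<otimes> s)\<close>.\<close>

definition conj_J :: "('g, 'm) monoid_scheme \<Rightarrow> 'g vec \<Rightarrow> 'g vec" where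
  "conj_J G f = (\<lambda>x. if x \<in> carrier G then cnj (f (inv\<^bsub>G\<^esub> x)) else 0)"

definition right_act :: "('g, 'm) monoid_scheme \<Rightarrow> 'g oper \<Rightarrow> 'g vec \<Rightarrow> 'g vec" where
  "right_act G T f = conj_J G (adj G T (conj_J G f))"

definition cocycles :: "('g, 'm) monoid_scheme \<Rightarrow> ('g \<Rightarrow> 'g vec) set" where
  "cocycles G = {b.
     (\<forall>g. g \<notin> carrier G \<longrightarrow> b g = 0) \<and>
     (\<forall>g\<in>carrier G. b g \<in> ell2 G) \<and>
     (\<forall>g\<in>carrier G. \<forall>h\<in>carrier G. b (g \<otimes>\<^bsub>G\<^esub> h) = b g + lreg G g (b h))}"

definition inner_cocycles :: "('g, 'm) monoid_scheme \<Rightarrow> ('g \<Rightarrow> 'g vec) set" where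
  "inner_cocycles G =
     {(\<lambda>g. if g \<in> carrier G then lreg G g f - f else 0) | f. f \<in> ell2 G}"

definition Z1 :: "('g, 'm) monoid_scheme \<Rightarrow> ('g oper, 'g \<Rightarrow> 'g vec) module" where
  "Z1 G = \<lparr>carrier = cocycles G, mult = undefined, one = undefined, zero = 0, add = (+),
           smult = (\<lambda>T b g. right_act G T (b g))\<rparr>"

definition quot_module :: "('r, 'v) module \<Rightarrow> 'v set \<Rightarrow> ('r, 'v set) module" where
  "quot_module M N = \<lparr>carrier = a_rcosets\<^bsub>M\<^esub> N, mult = undefined, one = undefined,
           zero = N, add = (<+>\<^bsub>M\<^esub>),
           smult = (\<lambda>r X. \<Union>x\<in>X. N +>\<^bsub>M\<^esub> (r \<odot>\<^bsub>M\<^esub> x))\<rparr>"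

definition H1 :: "('g, 'm) monoid_scheme \<Rightarrow> ('g oper, ('g \<Rightarrow> 'g vec) set) module" where
  "H1 G = quot_module (Z1 G) (inner_cocycles G)"

definition L2_betti1 :: "('g, 'm) monoid_scheme \<Rightarrow> ereal" where
  "L2_betti1 G = luck_dim G (H1 G)"


section \<open>Torsion-freeness and the integral group ring\<close>

definition torsion_free :: "('g, 'm) monoid_scheme \<Rightarrow> bool" where
  "torsion_free G \<longleftrightarrow>
     (\<forall>x\<in>carrier G. \<forall>n::nat. n > 0 \<and> x [^]\<^bsub>G\<^esub> n = \<one>\<^bsub>G\<^esub> \<longrightarrow> x = \<one>\<^bsub>G\<^esub>)"

text \<open>Elements of the integral group ring, as finitely supported coefficient functions.\<close>

definition int_group_ring :: "('g, 'm) monoid_scheme \<Rightarrow> ('g \<Rightarrow> int) set" where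
  "int_group_ring G = {a. finite {s. a s \<noteq> 0} \<and> {s. a s \<noteq> 0} \<subseteq> carrier G}"

definition group_ring_act :: "('g, 'm) monoid_scheme \<Rightarrow> ('g \<Rightarrow> int) \<Rightarrow> 'g oper" where
  "group_ring_act G a = (\<Sum>s | a s \<noteq> 0. oscale (of_int (a s)) (lreg G s))"

end

theory Submission
  imports Defs
begin

text \<open>Let \<open>M\<close> be an invariant subalgebra with conditional expectation \<open>E\<close>, realised on vectors as the
  projection onto the closure of \<open>M \<delta>\<^sub>1\<close>. For \<open>g \<noteq> 1\<close> the vector \<open>E(g)\<close> is invariant under conjugation
  by \<open>g\<close>, \<open>g\<inverse> E(g)\<close> commutes with \<open>M\<close>, and \<open>E(h g h\<inverse>) = h E(g) h\<inverse>\<close>.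

  If the first \<open>L\<^sup>2\<close>-Betti number is positive, there is a cocycle \<open>b\<close> no multiple \<open>b \<cdot> T\<close> of which with
  \<open>T\<close> of dense range is inner. Since \<open>g - 1\<close> is injective, the Ore condition in the finite algebra
  \<open>LG\<close> provides such a \<open>T\<close> with \<open>b(g) \<cdot> T = (g - 1) \<xi>\<close>, so subtracting an inner cocycle from \<open>b \<cdot> T\<close>
  gives a nonzero cocycle \<open>c\<close> with \<open>c(g) = 0\<close>. The support of \<open>E(g)\<close> lies in the zero set of \<open>c\<close>, and if
  \<open>c(h) \<noteq> 0\<close>, the commutation of \<open>g\<inverse> E(g)\<close> with \<open>h E(g) h\<inverse>\<close> together with the absence of kernels in
  the integral group ring forces one of them to be scalar. Hence \<open>E(g)\<close> is \<open>g\<close> or \<open>0\<close>, and \<open>M\<close> is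
  generated by the \<open>g\<close> with \<open>E(g) = g\<close>.\<close>

section \<open>The Hilbert space\<close>

text \<open>Two obstacles shape the argument. In the ring of affiliated operators
  \<open>g - 1\<close> would simply be invertible; unbounded operators are avoided by clearing
  denominators on the right with a bounded \<open>T\<close> of dense range, and the finiteness of
  matrices over the group von Neumann algebra guarantees that such a \<open>T\<close> exists.
  Secondly, \<open>E(g)\<close> is available only as a square-summable vector, so commutation is
  stated through convolution, whose values are defined and continuous pointwise by Cauchy-Schwarz.

  The geometry behind the last step: the zero set \<open>Z\<close> of \<open>c\<close> is a
  subgroup, and \<open>c(h) \<noteq> 0\<close> makes \<open>Z\<close> and its conjugate by
  \<open>h\<close> nearly free from each other. They meet only in 1, since a common element fixes
  \<open>c(h)\<close>, and for nontrivial \<open>a\<close> in \<open>Z\<close> and \<open>b\<close>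
  in the conjugate the product \<open>a b\<close> is never of the form \<open>b' a'\<close>. The
  latter calls for group ring elements with four terms and not only for differences of two group
  elements. Torsion-freeness enters where square-summability yields a nontrivial power of
  \<open>g\<close> commuting with a given point of the support of \<open>E(g)\<close>.\<close>

lemma ell2_zero_off: "f \<in> ell2 G \<Longrightarrow> x \<notin> carrier G \<Longrightarrow> f x = 0"
  by (simp add: ell2_def)

lemma ell2_summable: "f \<in> ell2 G \<Longrightarrow> (\<lambda>x. (cmod (f x))\<^sup>2) summable_on carrier G"
  by (simp add: ell2_def)

lemma ell2_norm_nonneg: "0 \<le> ell2_norm G f"
  by (simp add: ell2_norm_def infsum_nonneg)

lemma ell2_norm_sq: "(ell2_norm G f)\<^sup>2 = (\<Sum>\<^sub>\<infinity>x\<in>carrier G. (cmod (f x))\<^sup>2)"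
  by (simp add: ell2_norm_def infsum_nonneg)

lemma ell2_finite_sum_le:
  assumes "f \<in> ell2 G" "finite F" "F \<subseteq> carrier G"
  shows "(\<Sum>x\<in>F. (cmod (f x))\<^sup>2) \<le> (ell2_norm G f)\<^sup>2"
  unfolding ell2_norm_sq by (rule finite_sum_le_infsum) (use assms in \<open>auto simp: ell2_def\<close>)

text \<open>Membership and norm bound both follow from one estimate on finite sums, which is what is
  available when limits, adjoints or components are formed.\<close>

lemma ell2_bound:
  assumes "\<And>x. x \<notin> carrier G \<Longrightarrow> f x = 0" "0 \<le> C"
    and "\<And>F. finite F \<Longrightarrow> F \<subseteq> carrier G \<Longrightarrow> (\<Sum>x\<in>F. (cmod (f x))\<^sup>2) \<le> C\<^sup>2"
  shows "f \<in> ell2 G" "ell2_norm G f \<le> C"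
proof -
  have s: "(\<lambda>x. (cmod (f x))\<^sup>2) summable_on carrier G"
    by (rule nonneg_bounded_partial_sums_imp_summable_on[where C="C\<^sup>2"])
       (use assms in \<open>auto simp: eventually_finite_subsets_at_top\<close>)
  then show "f \<in> ell2 G" using assms by (simp add: ell2_def)
  have "(\<Sum>\<^sub>\<infinity>x\<in>carrier G. (cmod (f x))\<^sup>2) \<le> C\<^sup>2"
    by (rule infsum_le_finite_sums[OF s]) (use assms in auto)
  then show "ell2_norm G f \<le> C"
    unfolding ell2_norm_def using assms(2) by (simp add: real_le_lsqrt infsum_nonneg)
qed

lemma ell2_point_le: "f \<in> ell2 G \<Longrightarrow> cmod (f x) \<le> ell2_norm G f"
proof (cases "x \<in> carrier G")
  case True
  assume "f \<in> ell2 G"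
  from ell2_finite_sum_le[OF this, of "{x}"] True show ?thesis
    by (simp add: ell2_norm_nonneg)
qed (auto simp: ell2_def ell2_norm_nonneg)

lemma ell2_zero [simp]: "0 \<in> ell2 G"
  by (simp add: ell2_def)

lemma ell2_zero' [simp]: "(\<lambda>x. 0) \<in> ell2 G"
  by (simp add: ell2_def)

lemma vscale_apply [simp]: "vscale c f x = c * f x"
  by (simp add: vscale_def)

lemma ell2_vscale [intro]: "f \<in> ell2 G \<Longrightarrow> vscale c f \<in> ell2 G"
  by (auto simp: ell2_def norm_mult power_mult_distrib intro: summable_on_cmult_right)

lemma ell2_add [intro]:
  assumes "f \<in> ell2 G" "g \<in> ell2 G" shows "f + g \<in> ell2 G"
proof -
  have le: "(cmod (f x + g x))\<^sup>2 \<le> 2 * (cmod (f x))\<^sup>2 + 2 * (cmod (g x))\<^sup>2" for x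
  proof -
    have "(cmod (f x + g x))\<^sup>2 \<le> (cmod (f x) + cmod (g x))\<^sup>2"
      by (simp add: norm_triangle_ineq power_mono)
    also have "\<dots> \<le> 2 * (cmod (f x))\<^sup>2 + 2 * (cmod (g x))\<^sup>2"
      using sum_squares_bound[of "cmod (f x)" "cmod (g x)"] by (simp add: power2_sum)
    finally show ?thesis .
  qed
  have "(\<lambda>x. 2 * (cmod (f x))\<^sup>2 + 2 * (cmod (g x))\<^sup>2) summable_on carrier G"
    using assms by (intro summable_on_add summable_on_cmult_right) (auto simp: ell2_def)
  then have "(\<lambda>x. (cmod (f x + g x))\<^sup>2) summable_on carrier G"
    by (rule summable_on_comparison_test) (use le in auto)
  then show ?thesis using assms by (auto simp: ell2_def)
qed

lemma ell2_diff [intro]: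
  assumes "f \<in> ell2 G" "g \<in> ell2 G" shows "f - g \<in> ell2 G"
proof -
  have "f - g = f + vscale (-1) g" by (auto simp: fun_eq_iff)
  then show ?thesis using assms by (metis ell2_add ell2_vscale)
qed

lemma ell2_sum [intro]: "(\<And>i. i \<in> I \<Longrightarrow> f i \<in> ell2 G) \<Longrightarrow> sum f I \<in> ell2 G"
  by (induction I rule: infinite_finite_induct) auto

lemma delta_ell2 [intro]: "t \<in> carrier G \<Longrightarrow> delta t \<in> ell2 G"
proof (rule ell2_bound(1)[where C=1])
  fix F :: "'a set" assume "finite F"
  then show "(\<Sum>x\<in>F. (cmod (delta t x))\<^sup>2) \<le> 1\<^sup>2"
    by (simp add: delta_def if_distrib[of cmod] if_distrib[of "\<lambda>x. x\<^sup>2"] cong: if_cong)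
qed (auto simp: delta_def)

lemma ell2_inner_summable:
  assumes "f \<in> ell2 G" "g \<in> ell2 G"
  shows "(\<lambda>x. f x * cnj (g x)) summable_on carrier G"
proof (rule abs_summable_summable, rule abs_summable_product)
  show "(\<lambda>x. norm (f x * f x)) summable_on carrier G"
       "(\<lambda>x. norm (cnj (g x) * cnj (g x))) summable_on carrier G"
    using assms by (auto simp: ell2_def norm_mult power2_eq_square)
qed

lemma ell2_inner_add_left:
  "f \<in> ell2 G \<Longrightarrow> g \<in> ell2 G \<Longrightarrow> h \<in> ell2 G \<Longrightarrow>
    ell2_inner G (f + g) h = ell2_inner G f h + ell2_inner G g h"
  by (simp add: ell2_inner_def distrib_right infsum_add ell2_inner_summable)

lemma ell2_inner_scale_left:
  "f \<in> ell2 G \<Longrightarrow> h \<in> ell2 G \<Longrightarrow> ell2_inner G (vscale c f) h = c * ell2_inner G f h"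
  by (simp add: ell2_inner_def mult.assoc infsum_cmult_right ell2_inner_summable)

lemma ell2_inner_cnj: "cnj (ell2_inner G f h) = ell2_inner G h f"
  by (simp add: ell2_inner_def mult.commute flip: infsum_cnj)

lemma ell2_inner_add_right:
  "f \<in> ell2 G \<Longrightarrow> g \<in> ell2 G \<Longrightarrow> h \<in> ell2 G \<Longrightarrow>
    ell2_inner G h (f + g) = ell2_inner G h f + ell2_inner G h g"
  by (metis complex_cnj_add ell2_inner_add_left ell2_inner_cnj)

lemma ell2_inner_scale_right:
  "f \<in> ell2 G \<Longrightarrow> h \<in> ell2 G \<Longrightarrow> ell2_inner G h (vscale c f) = cnj c * ell2_inner G h f"
  by (metis complex_cnj_mult ell2_inner_scale_left ell2_inner_cnj)

lemma ell2_inner_diff_left: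
  assumes "f \<in> ell2 G" "g \<in> ell2 G" "h \<in> ell2 G"
  shows "ell2_inner G (f - g) h = ell2_inner G f h - ell2_inner G g h"
  using ell2_inner_add_left[of "f - g" G g h] assms by (auto simp: ell2_diff)

lemma ell2_inner_diff_right:
  assumes "f \<in> ell2 G" "g \<in> ell2 G" "h \<in> ell2 G"
  shows "ell2_inner G h (f - g) = ell2_inner G h f - ell2_inner G h g"
  using ell2_inner_add_right[of "f - g" G g h] assms by (auto simp: ell2_diff)

lemma ell2_inner_zero [simp]: "ell2_inner G 0 h = 0" "ell2_inner G h 0 = 0"
  by (simp_all add: ell2_inner_def)

lemma ell2_inner_self: "f \<in> ell2 G \<Longrightarrow> ell2_inner G f f = of_real ((ell2_norm G f)\<^sup>2)"
proof -
  assume f: "f \<in> ell2 G"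
  have "ell2_inner G f f = (\<Sum>\<^sub>\<infinity>x\<in>carrier G. complex_of_real ((cmod (f x))\<^sup>2))"
    unfolding ell2_inner_def by (intro infsum_cong) (simp only: complex_norm_square)
  also have "\<dots> = of_real (\<Sum>\<^sub>\<infinity>x\<in>carrier G. (cmod (f x))\<^sup>2)"
    by (intro infsumI has_sum_of_real has_sum_infsum ell2_summable f)
  finally show ?thesis by (simp only: ell2_norm_sq)
qed

lemma ell2_norm_zero_iff: "f \<in> ell2 G \<Longrightarrow> ell2_norm G f = 0 \<longleftrightarrow> f = 0"
  using ell2_point_le[of f G] by (auto simp: fun_eq_iff ell2_norm_def)

lemma ell2_norm_vscale: "ell2_norm G (vscale c f) = cmod c * ell2_norm G f"
  by (simp add: ell2_norm_def norm_mult power_mult_distrib infsum_cmult_right' real_sqrt_mult)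

lemma ell2_norm_minus_commute: "ell2_norm G (f - g) = ell2_norm G (g - f)"
  by (simp add: ell2_norm_def norm_minus_commute)

lemma ell2_norm_sq_diff:
  assumes "f \<in> ell2 G" "g \<in> ell2 G"
  shows "(ell2_norm G (f - g))\<^sup>2 = (ell2_norm G f)\<^sup>2 - 2 * Re (ell2_inner G f g) + (ell2_norm G g)\<^sup>2"
proof -
  have "of_real ((ell2_norm G (f - g))\<^sup>2) = ell2_inner G f f - ell2_inner G f g - (cnj (ell2_inner G f g) - ell2_inner G g g)"
    unfolding ell2_inner_self[OF ell2_diff[OF assms], symmetric] ell2_inner_cnj
    using assms by (simp add: ell2_inner_diff_left ell2_inner_diff_right ell2_diff)
  from arg_cong[OF this, of Re] show ?thesis
    by (simp add: ell2_inner_self assms)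
qed

lemma ell2_norm_sq_add:
  assumes "f \<in> ell2 G" "g \<in> ell2 G"
  shows "(ell2_norm G (f + g))\<^sup>2 = (ell2_norm G f)\<^sup>2 + 2 * Re (ell2_inner G f g) + (ell2_norm G g)\<^sup>2"
proof -
  have eq: "f + g = f - vscale (-1) g" by (auto simp: fun_eq_iff)
  show ?thesis unfolding eq using assms
    by (subst ell2_norm_sq_diff) (auto simp: ell2_inner_scale_right ell2_norm_vscale)
qed

lemma ell2_cauchy_schwarz:
  assumes "f \<in> ell2 G" "g \<in> ell2 G"
  shows "cmod (ell2_inner G f g) \<le> ell2_norm G f * ell2_norm G g"
proof (cases "g = 0")
  case True then show ?thesis by (simp add: ell2_norm_nonneg)
next
  case False
  define n where "n = (ell2_norm G g)\<^sup>2"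
  have n: "n > 0" using False ell2_norm_zero_iff[OF assms(2)] by (simp add: n_def)
  define i where "i = ell2_inner G f g"
  \<comment> \<open>With this coefficient \<open>f - vscale c g\<close> is orthogonal to
    \<open>g\<close>, so that the nonnegativity of its squared norm is exactly the
    inequality.\<close>
  define c where "c = i / of_real n"
  have "0 \<le> (ell2_norm G (f - vscale c g))\<^sup>2" by simp
  also have "\<dots> = (ell2_norm G f)\<^sup>2 - 2 * Re (cnj c * i) + (cmod c)\<^sup>2 * n"
    using assms by (simp add: ell2_norm_sq_diff ell2_vscale ell2_inner_scale_right ell2_norm_vscale
        power_mult_distrib n_def i_def)
  also have "Re (cnj c * i) = (cmod i)\<^sup>2 / n"
    using n by (simp add: c_def cmod_power2) (simp add: power2_eq_square add_divide_distrib)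
  also have "(cmod c)\<^sup>2 * n = (cmod i)\<^sup>2 / n"
    using n by (simp add: c_def norm_divide power_divide power2_eq_square)
  finally have "(cmod i)\<^sup>2 \<le> (ell2_norm G f)\<^sup>2 * n"
    using n by (simp add: field_simps)
  then have "(cmod i)\<^sup>2 \<le> (ell2_norm G f * ell2_norm G g)\<^sup>2"
    by (simp add: n_def power_mult_distrib)
  then show ?thesis
    unfolding i_def using ell2_norm_nonneg power2_le_imp_le by (metis mult_nonneg_nonneg)
qed

lemma ell2_norm_triangle:
  assumes "f \<in> ell2 G" "g \<in> ell2 G"
  shows "ell2_norm G (f + g) \<le> ell2_norm G f + ell2_norm G g"
proof (rule power2_le_imp_le)
  have "Re (ell2_inner G f g) \<le> ell2_norm G f * ell2_norm G g"
    using ell2_cauchy_schwarz[OF assms] complex_Re_le_cmod order_trans by blast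
  then show "(ell2_norm G (f + g))\<^sup>2 \<le> (ell2_norm G f + ell2_norm G g)\<^sup>2"
    using assms by (simp add: ell2_norm_sq_add power2_sum)
qed (simp add: ell2_norm_nonneg)

lemma ell2_norm_triangle_diff:
  assumes "f \<in> ell2 G" "g \<in> ell2 G" "h \<in> ell2 G"
  shows "ell2_norm G (f - h) \<le> ell2_norm G (f - g) + ell2_norm G (g - h)"
  using ell2_norm_triangle[of "f - g" G "g - h"] assms by (auto simp: ell2_diff)

lemma ell2_inner_delta:
  assumes "f \<in> ell2 G" "t \<in> carrier G"
  shows "ell2_inner G f (delta t) = f t" "ell2_inner G (delta t) f = cnj (f t)"
proof -
  have "ell2_inner G f (delta t) = (\<Sum>\<^sub>\<infinity>x\<in>{t}. f x * cnj (delta t x))"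
    unfolding ell2_inner_def
    by (rule infsum_cong_neutral) (use assms in \<open>auto simp: delta_def\<close>)
  then show "ell2_inner G f (delta t) = f t" by (simp add: delta_def)
  then show "ell2_inner G (delta t) f = cnj (f t)" by (metis ell2_inner_cnj)
qed

lemma ell2_complete:
  assumes f: "\<And>n::nat. f n \<in> ell2 G"
    and cauchy: "\<And>e. e > 0 \<Longrightarrow> \<exists>N. \<forall>m\<ge>N. \<forall>n\<ge>N. ell2_norm G (f m - f n) < e"
  obtains l where "l \<in> ell2 G" "\<And>e. e > 0 \<Longrightarrow> \<exists>N. \<forall>n\<ge>N. ell2_norm G (f n - l) \<le> e"
proof -
  have "Cauchy (\<lambda>n. f n x)" for x
  proof (rule metric_CauchyI)
    fix e :: real assume "e > 0"
    with cauchy obtain N where N: "\<forall>m\<ge>N. \<forall>n\<ge>N. ell2_norm G (f m - f n) < e" by blast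
    have "dist (f m x) (f n x) < e" if "m \<ge> N" "n \<ge> N" for m n
    proof -
      have "dist (f m x) (f n x) = cmod ((f m - f n) x)" by (simp add: dist_norm)
      also have "\<dots> \<le> ell2_norm G (f m - f n)" by (rule ell2_point_le[of "f m - f n"]) (use f in auto)
      finally show ?thesis using N that by force
    qed
    then show "\<exists>N. \<forall>m\<ge>N. \<forall>n\<ge>N. dist (f m x) (f n x) < e" by blast
  qed
  then have "\<exists>y. (\<lambda>n. f n x) \<longlonglongrightarrow> y" for x
    by (simp add: Cauchy_convergent_iff convergent_def)
  then obtain l where l: "\<And>x. (\<lambda>n. f n x) \<longlonglongrightarrow> l x" by metis
  \<comment> \<open>The bound on \<open>f n - f m\<close> is used on finite partial sums, where
    \<open>m\<close> can tend to infinity termwise; all finite sets are combined only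
    afterwards.\<close>
  have key: "f n - l \<in> ell2 G \<and> ell2_norm G (f n - l) \<le> e"
    if N: "\<forall>m\<ge>N. \<forall>n\<ge>N. ell2_norm G (f m - f n) < e" and n: "n \<ge> N" and e: "e > 0" for n N e
  proof -
    have "(f n - l) x = 0" if "x \<notin> carrier G" for x
    proof -
      have "f n x = 0" for n using f[of n] that by (simp add: ell2_def)
      then show ?thesis using l[of x] by (simp add: LIMSEQ_const_iff)
    qed
    moreover have "(\<Sum>x\<in>F. (cmod ((f n - l) x))\<^sup>2) \<le> e\<^sup>2" if "finite F" "F \<subseteq> carrier G" for F
    proof (rule LIMSEQ_le_const2)
      show "(\<lambda>m. \<Sum>x\<in>F. (cmod ((f n - f m) x))\<^sup>2) \<longlonglongrightarrow> (\<Sum>x\<in>F. (cmod ((f n - l) x))\<^sup>2)"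
        by (auto intro!: tendsto_intros l)
      have "(\<Sum>x\<in>F. (cmod ((f n - f m) x))\<^sup>2) \<le> e\<^sup>2" if "m \<ge> N" for m
      proof -
        have "(\<Sum>x\<in>F. (cmod ((f n - f m) x))\<^sup>2) \<le> (ell2_norm G (f n - f m))\<^sup>2"
          by (rule ell2_finite_sum_le[of "f n - f m"]) (use f \<open>finite F\<close> \<open>F \<subseteq> carrier G\<close> in auto)
        also have "\<dots> \<le> e\<^sup>2"
          using N n that by (intro power_mono ell2_norm_nonneg) (simp add: less_imp_le)
        finally show ?thesis .
      qed
      then show "\<exists>N. \<forall>m\<ge>N. (\<Sum>x\<in>F. (cmod ((f n - f m) x))\<^sup>2) \<le> e\<^sup>2" by blast
    qed
    ultimately show ?thesis using ell2_bound[of G "f n - l" e] e by simp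
  qed
  obtain N where "\<forall>m\<ge>N. \<forall>n\<ge>N. ell2_norm G (f m - f n) < 1" using cauchy[of 1] by auto
  from key[OF this] have "f N - l \<in> ell2 G" by simp
  then have "f N - (f N - l) \<in> ell2 G" using f by blast
  then have "l \<in> ell2 G" by simp
  moreover have "\<exists>N. \<forall>n\<ge>N. ell2_norm G (f n - l) \<le> e" if e: "e > 0" for e
    using cauchy[OF e] key e by meson
  ultimately show thesis using that by blast
qed

section \<open>Norm closures and orthogonal projection onto closed subspaces\<close>

definition lin_subspace :: "('g, 'm) monoid_scheme \<Rightarrow> 'g vec set \<Rightarrow> bool" where
  "lin_subspace G S \<longleftrightarrow> S \<subseteq> ell2 G \<and> 0 \<in> S \<and> (\<forall>f\<in>S. \<forall>g\<in>S. f + g \<in> S) \<and> (\<forall>c. \<forall>f\<in>S. vscale c f \<in> S)"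

definition cl :: "('g, 'm) monoid_scheme \<Rightarrow> 'g vec set \<Rightarrow> 'g vec set" where
  "cl G S = {f \<in> ell2 G. \<forall>e>0. \<exists>s\<in>S. ell2_norm G (f - s) < e}"

definition closed_subspace :: "('g, 'm) monoid_scheme \<Rightarrow> 'g vec set \<Rightarrow> bool" where
  "closed_subspace G S \<longleftrightarrow> lin_subspace G S \<and> cl G S \<subseteq> S"

lemma lin_subspace_diff: "lin_subspace G S \<Longrightarrow> f \<in> S \<Longrightarrow> g \<in> S \<Longrightarrow> f - g \<in> S"
proof -
  assume S: "lin_subspace G S" "f \<in> S" "g \<in> S"
  have eq: "f - g = f + vscale (-1) g" by (auto simp: fun_eq_iff)
  show ?thesis unfolding eq using S by (simp add: lin_subspace_def)
qed

lemma cl_subset: "S \<subseteq> ell2 G \<Longrightarrow> S \<subseteq> cl G S"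
proof
  fix f assume "S \<subseteq> ell2 G" "f \<in> S"
  then show "f \<in> cl G S" by (auto simp: cl_def ell2_norm_def intro: bexI[of _ f])
qed

lemma clD: "f \<in> cl G S \<Longrightarrow> e > 0 \<Longrightarrow> \<exists>s\<in>S. ell2_norm G (f - s) < e"
  by (simp add: cl_def)

lemma cl_ell2: "f \<in> cl G S \<Longrightarrow> f \<in> ell2 G"
  by (simp add: cl_def)

lemma cl_cl:
  assumes "S \<subseteq> ell2 G" shows "cl G (cl G S) \<subseteq> cl G S"
proof
  fix f assume f: "f \<in> cl G (cl G S)"
  have "\<exists>s\<in>S. ell2_norm G (f - s) < e" if e: "e > 0" for e
  proof -
    obtain k where k: "k \<in> cl G S" "ell2_norm G (f - k) < e/2"
      using clD[OF f half_gt_zero[OF e]] by blast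
    obtain s where s: "s \<in> S" "ell2_norm G (k - s) < e/2"
      using clD[OF k(1) half_gt_zero[OF e]] by blast
    have "ell2_norm G (f - s) \<le> ell2_norm G (f - k) + ell2_norm G (k - s)"
      by (rule ell2_norm_triangle_diff) (use f k s assms cl_ell2 in blast)+
    then show ?thesis using k s by (intro bexI[of _ s]) auto
  qed
  then show "f \<in> cl G S" using f by (auto simp: cl_def)
qed

lemma closed_subspace_cl:
  assumes "lin_subspace G S" shows "closed_subspace G (cl G S)"
proof -
  have S: "S \<subseteq> ell2 G" "0 \<in> S" using assms by (auto simp: lin_subspace_def)
  have "f + g \<in> cl G S" if "f \<in> cl G S" "g \<in> cl G S" for f g
  proof -
    have "\<exists>s\<in>S. ell2_norm G (f + g - s) < e" if e: "e > 0" for e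
    proof -
      obtain s where s: "s \<in> S" "ell2_norm G (f - s) < e/2"
        using clD[OF \<open>f \<in> cl G S\<close> half_gt_zero[OF e]] by blast
      obtain t where t: "t \<in> S" "ell2_norm G (g - t) < e/2"
        using clD[OF \<open>g \<in> cl G S\<close> half_gt_zero[OF e]] by blast
      have "ell2_norm G (f + g - (s + t)) \<le> ell2_norm G (f - s) + ell2_norm G (g - t)"
        using ell2_norm_triangle[of "f - s" G "g - t"] \<open>f \<in> cl G S\<close> \<open>g \<in> cl G S\<close> s t S
        by (auto simp: cl_def algebra_simps ell2_diff)
      then show ?thesis using s t assms by (intro bexI[of _ "s+t"]) (auto simp: lin_subspace_def)
    qed
    then show ?thesis using that by (auto simp: cl_def)
  qed
  moreover have "vscale c f \<in> cl G S" if "f \<in> cl G S" for c f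
  proof -
    have "\<exists>s\<in>S. ell2_norm G (vscale c f - s) < e" if e: "e > 0" for e
    proof -
      have "e / (cmod c + 1) > 0" using e by (auto intro!: divide_pos_pos add_nonneg_pos)
      then obtain s where s: "s \<in> S" "ell2_norm G (f - s) < e / (cmod c + 1)"
        using clD[OF \<open>f \<in> cl G S\<close>] by blast
      have "vscale c f - vscale c s = vscale c (f - s)" by (auto simp: fun_eq_iff algebra_simps)
      then have "ell2_norm G (vscale c f - vscale c s) = cmod c * ell2_norm G (f - s)"
        by (simp add: ell2_norm_vscale)
      also have "\<dots> \<le> (cmod c + 1) * ell2_norm G (f - s)"
        by (simp add: mult_right_mono ell2_norm_nonneg)
      also have "\<dots> < e" using s(2) by (simp add: pos_less_divide_eq add_nonneg_pos mult.commute)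
      finally show ?thesis using s assms by (intro bexI[of _ "vscale c s"]) (auto simp: lin_subspace_def)
    qed
    then show ?thesis using that by (auto simp: cl_def)
  qed
  ultimately show ?thesis
    using cl_cl[OF S(1)] cl_subset[OF S(1)] S cl_ell2 unfolding closed_subspace_def lin_subspace_def by blast
qed

text \<open>A sequence minimising the distance is Cauchy by the parallelogram law; at the minimum, a
  nonzero inner product with some \<open>m\<close> in \<open>K\<close> would allow a shorter
  distance by moving along \<open>m\<close>.\<close>

lemma projection_exists:
  assumes K: "closed_subspace G K" and f: "f \<in> ell2 G"
  shows "\<exists>k\<in>K. \<forall>m\<in>K. ell2_inner G (f - k) m = 0"
proof -
  have KS: "lin_subspace G K" and Kc: "cl G K \<subseteq> K" using K by (auto simp: closed_subspace_def)
  have Ke: "K \<subseteq> ell2 G" "0 \<in> K" using KS by (auto simp: lin_subspace_def)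
  define D where "D = (INF k\<in>K. (ell2_norm G (f - k))\<^sup>2)"
  have bdd: "bdd_below ((\<lambda>k. (ell2_norm G (f - k))\<^sup>2) ` K)" by (rule bdd_belowI[of _ 0]) auto
  have Dle: "D \<le> (ell2_norm G (f - k))\<^sup>2" if "k \<in> K" for k
    unfolding D_def by (rule cINF_lower[OF bdd that])
  have "\<exists>k\<in>K. (ell2_norm G (f - k))\<^sup>2 < D + e" if e: "e > 0" for e
    using cINF_less_iff[OF _ bdd, of "D+e"] Ke e unfolding D_def by force
  then have "\<forall>n. \<exists>k\<in>K. (ell2_norm G (f - k))\<^sup>2 < D + inverse (real (Suc n))" by simp
  then obtain k where k: "\<And>n. k n \<in> K" "\<And>n. (ell2_norm G (f - k n))\<^sup>2 < D + inverse (real (Suc n))"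
    by metis
  have para: "(ell2_norm G (k m - k n))\<^sup>2 \<le> 2 * inverse (real (Suc m)) + 2 * inverse (real (Suc n))" for m n
  proof -
    let ?a = "f - k m" and ?b = "f - k n"
    have ab: "?a \<in> ell2 G" "?b \<in> ell2 G" using f k Ke by auto
    have eq: "k m - k n = ?b - ?a" by simp
    have 1: "(ell2_norm G (k m - k n))\<^sup>2 = 2 * (ell2_norm G ?a)\<^sup>2 + 2 * (ell2_norm G ?b)\<^sup>2 - (ell2_norm G (?b + ?a))\<^sup>2"
      unfolding eq ell2_norm_sq_diff[OF ab(2,1)] ell2_norm_sq_add[OF ab(2,1)] by simp
    \<comment> \<open>The midpoint of \<open>k m\<close> and \<open>k n\<close> lies in
      \<open>K\<close>, so its squared distance to \<open>f\<close> is at least \<open>D\<close>;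
      this bounds the subtracted term of the parallelogram law from below.\<close>
    have "?b + ?a = vscale 2 (f - vscale (1/2) (k m + k n))"
      by (auto simp: fun_eq_iff algebra_simps)
    then have "(ell2_norm G (?b + ?a))\<^sup>2 = 4 * (ell2_norm G (f - vscale (1/2) (k m + k n)))\<^sup>2"
      by (simp add: ell2_norm_vscale power_mult_distrib)
    moreover have "D \<le> (ell2_norm G (f - vscale (1/2) (k m + k n)))\<^sup>2"
      by (rule Dle) (use k KS in \<open>auto simp: lin_subspace_def\<close>)
    ultimately show ?thesis using 1 k(2)[of m] k(2)[of n] by linarith
  qed
  obtain l where l: "l \<in> ell2 G" "\<And>e. e > 0 \<Longrightarrow> \<exists>N. \<forall>n\<ge>N. ell2_norm G (k n - l) \<le> e"
  proof (rule ell2_complete[of k G])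
    fix e :: real assume e: "e > 0"
    then obtain N where N: "inverse (real (Suc N)) < e\<^sup>2 / 4"
      using reals_Archimedean[of "e\<^sup>2/4"] by auto
    have "ell2_norm G (k m - k n) < e" if "m \<ge> N" "n \<ge> N" for m n
    proof (rule power2_less_imp_less)
      have "inverse (real (Suc m)) \<le> inverse (real (Suc N))" "inverse (real (Suc n)) \<le> inverse (real (Suc N))"
        using that by (auto intro!: le_imp_inverse_le)
      then show "(ell2_norm G (k m - k n))\<^sup>2 < e\<^sup>2" using para[of m n] N by linarith
    qed (use e in auto)
    then show "\<exists>N. \<forall>m\<ge>N. \<forall>n\<ge>N. ell2_norm G (k m - k n) < e" by blast
  qed (use k Ke in auto)
  have "l \<in> cl G K"
  proof -
    have "\<exists>s\<in>K. ell2_norm G (l - s) < e" if e: "e > 0" for e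
    proof -
      obtain N where "ell2_norm G (k N - l) \<le> e/2" using l(2)[OF half_gt_zero[OF e]] by blast
      then show ?thesis using k(1)[of N] e by (intro bexI[of _ "k N"]) (auto simp: ell2_norm_minus_commute)
    qed
    then show ?thesis using l by (auto simp: cl_def)
  qed
  then have lK: "l \<in> K" using Kc by auto
  have lD: "(ell2_norm G (f - l))\<^sup>2 \<le> D"
  proof (rule field_le_epsilon)
    have "ell2_norm G (f - l) \<le> sqrt D"
    proof (rule field_le_epsilon)
      fix e :: real assume e: "e > 0"
      obtain N where N: "\<forall>n\<ge>N. ell2_norm G (k n - l) \<le> e/2" using l(2)[of "e/2"] e by auto
      have D0: "D \<ge> 0" unfolding D_def using Ke by (intro cINF_greatest) auto
      obtain M where M: "inverse (real (Suc M)) < (e/2)\<^sup>2"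
        using reals_Archimedean[of "(e/2)\<^sup>2"] e by auto
      define n where "n = max M N"
      have "inverse (real (Suc n)) \<le> inverse (real (Suc M))"
        by (auto intro!: le_imp_inverse_le simp: n_def)
      then have "(ell2_norm G (f - k n))\<^sup>2 < D + (e/2)\<^sup>2" using k(2)[of n] M by linarith
      also have "\<dots> \<le> (sqrt D + e/2)\<^sup>2" using D0 e by (simp add: power2_sum)
      finally have "ell2_norm G (f - k n) < sqrt D + e/2"
        by (rule power2_less_imp_less) (use D0 e in auto)
      moreover have "ell2_norm G (k n - l) \<le> e/2" using N by (simp add: n_def)
      moreover have "ell2_norm G (f - l) \<le> ell2_norm G (f - k n) + ell2_norm G (k n - l)"
        by (rule ell2_norm_triangle_diff) (use f k Ke l in auto)
      ultimately show "ell2_norm G (f - l) \<le> sqrt D + e" by simp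
    qed
    moreover have "D \<ge> 0" unfolding D_def using Ke by (intro cINF_greatest) auto
    ultimately have "(ell2_norm G (f - l))\<^sup>2 \<le> D"
      using power_mono[of "ell2_norm G (f - l)" "sqrt D" 2] ell2_norm_nonneg by auto
    then show "(ell2_norm G (f - l))\<^sup>2 \<le> D + e" if "e > 0" for e using that by linarith
  qed
  have "ell2_inner G (f - l) m = 0" if m: "m \<in> K" for m
  proof (rule ccontr)
    assume i0: "ell2_inner G (f - l) m \<noteq> 0"
    define i where "i = ell2_inner G (f - l) m"
    \<comment> \<open>The added 1 makes \<open>N\<close> positive without a case distinction. The
      step \<open>c\<close> is then shorter than the optimal one, but still lowers the squared
      distance by \<open>(cmod i)\<^sup>2 / N\<close>.\<close>
    define N where "N = (ell2_norm G m)\<^sup>2 + 1"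
    have N: "N > 0" by (simp add: N_def add_nonneg_pos)
    define c where "c = i / of_real N"
    have me: "m \<in> ell2 G" "f - l \<in> ell2 G" using m Ke f l by auto
    have "l + vscale c m \<in> K" using lK m KS by (auto simp: lin_subspace_def)
    from Dle[OF this] have "D \<le> (ell2_norm G ((f - l) - vscale c m))\<^sup>2"
      by (simp add: diff_diff_eq)
    also have "\<dots> = (ell2_norm G (f - l))\<^sup>2 - 2 * Re (cnj c * i) + (cmod c)\<^sup>2 * (ell2_norm G m)\<^sup>2"
      using me by (subst ell2_norm_sq_diff) (auto simp: ell2_inner_scale_right ell2_norm_vscale
        power_mult_distrib i_def)
    also have "Re (cnj c * i) = (cmod i)\<^sup>2 / N"
      using N by (simp add: c_def cmod_power2) (simp add: power2_eq_square add_divide_distrib)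
    also have "(cmod c)\<^sup>2 * (ell2_norm G m)\<^sup>2 \<le> (cmod c)\<^sup>2 * N" by (simp add: N_def algebra_simps)
    also have "(cmod c)\<^sup>2 * N = (cmod i)\<^sup>2 / N"
      using N by (simp add: c_def norm_divide power_divide power2_eq_square)
    finally have "(cmod i)\<^sup>2 / N \<le> 0" using lD by linarith
    moreover have "(cmod i)\<^sup>2 / N > 0" using N i0 by (simp add: i_def)
    ultimately show False by simp
  qed
  then show ?thesis using lK by blast
qed

section \<open>Bounded operators and the weak operator topology\<close>

lemma ell2_eqI: "f \<in> ell2 G \<Longrightarrow> g \<in> ell2 G \<Longrightarrow> (\<And>x. x \<in> carrier G \<Longrightarrow> f x = g x) \<Longrightarrow> f = g"
  by (rule ext) (metis ell2_zero_off)

lemma ell2_inner_eqI: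
  assumes "f \<in> ell2 G" "g \<in> ell2 G" "\<And>h. h \<in> ell2 G \<Longrightarrow> ell2_inner G f h = ell2_inner G g h"
  shows "f = g"
  using assms delta_ell2 ell2_inner_delta(1) by (metis ell2_eqI)

lemma ell2_inner_sum_left:
  "(\<And>i. i \<in> I \<Longrightarrow> f i \<in> ell2 G) \<Longrightarrow> h \<in> ell2 G \<Longrightarrow>
    ell2_inner G (sum f I) h = (\<Sum>i\<in>I. ell2_inner G (f i) h)"
  by (induction I rule: infinite_finite_induct) (auto simp: ell2_inner_add_left ell2_sum)

lemma finite_support_ell2:
  assumes "finite F" "F \<subseteq> carrier G"
  shows "(\<lambda>x. if x \<in> F then f x else 0) = (\<Sum>x\<in>F. vscale (f x) (delta x))"
    "(\<Sum>x\<in>F. vscale (f x) (delta x)) \<in> ell2 G"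
    "(ell2_norm G (\<Sum>x\<in>F. vscale (f x) (delta x)))\<^sup>2 = (\<Sum>x\<in>F. (cmod (f x))\<^sup>2)"
proof -
  show eq: "(\<lambda>x. if x \<in> F then f x else 0) = (\<Sum>x\<in>F. vscale (f x) (delta x))"
  proof
    fix y
    have "(\<Sum>x\<in>F. vscale (f x) (delta x)) y = (\<Sum>x\<in>F. vscale (f x) (delta x) y)"
      by (induction F rule: infinite_finite_induct) auto
    also have "\<dots> = (\<Sum>x\<in>F. if x = y then f x else 0)"
      by (intro sum.cong) (auto simp: delta_def)
    finally show "(if y \<in> F then f y else 0) = (\<Sum>x\<in>F. vscale (f x) (delta x)) y"
      using assms by simp
  qed
  show "(\<Sum>x\<in>F. vscale (f x) (delta x)) \<in> ell2 G" using assms by auto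
  have "(\<Sum>\<^sub>\<infinity>x\<in>carrier G. (cmod (if x \<in> F then f x else 0))\<^sup>2) = (\<Sum>\<^sub>\<infinity>x\<in>F. (cmod (f x))\<^sup>2)"
    by (rule infsum_cong_neutral) (use assms in auto)
  then show "(ell2_norm G (\<Sum>x\<in>F. vscale (f x) (delta x)))\<^sup>2 = (\<Sum>x\<in>F. (cmod (f x))\<^sup>2)"
    unfolding eq[symmetric] ell2_norm_sq using assms by simp
qed

text \<open>The approximant is the truncation of \<open>f\<close> itself, so its coefficients are
  known. Both the identification of \<open>LG G\<close> with a commutant and the final inclusion of
  \<open>M\<close> in a group algebra depend on this.\<close>

lemma ell2_finite_approx:
  assumes f: "f \<in> ell2 G" and e: "e > 0"
  obtains F where "finite F" "F \<subseteq> carrier G" "ell2_norm G (f - (\<Sum>x\<in>F. vscale (f x) (delta x))) < e"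
proof -
  let ?s = "\<lambda>x. (cmod (f x))\<^sup>2"
  have s: "?s summable_on carrier G" using f by (rule ell2_summable)
  have "\<exists>F. finite F \<and> F \<subseteq> carrier G \<and> dist (sum ?s F) (infsum ?s (carrier G)) < e\<^sup>2"
    using has_sum_infsum[OF s] e
    unfolding has_sum_def tendsto_iff eventually_finite_subsets_at_top
    by (metis order_refl zero_less_power)
  then obtain F where F: "finite F" "F \<subseteq> carrier G" "\<bar>sum ?s F - infsum ?s (carrier G)\<bar> < e\<^sup>2"
    by (auto simp: dist_real_def)
  have "(\<Sum>\<^sub>\<infinity>x\<in>carrier G. (cmod ((f - (\<Sum>x\<in>F. vscale (f x) (delta x))) x))\<^sup>2)
      = (\<Sum>\<^sub>\<infinity>x\<in>carrier G - F. (cmod (f x))\<^sup>2)"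
    unfolding finite_support_ell2(1)[OF F(1,2), symmetric]
    by (rule infsum_cong_neutral) auto
  also have "\<dots> = infsum ?s (carrier G) - sum ?s F"
    using infsum_Diff[OF s, of F] F by auto
  finally have "(ell2_norm G (f - (\<Sum>x\<in>F. vscale (f x) (delta x))))\<^sup>2 < e\<^sup>2"
    unfolding ell2_norm_sq using F(3) by linarith
  then have "ell2_norm G (f - (\<Sum>x\<in>F. vscale (f x) (delta x))) < e"
    using e by (simp add: power2_less_imp_less)
  then show thesis using that F by blast
qed

section \<open>Bounded operators, adjoints and projections as operators\<close>

lemma bounded_op_off: "T \<in> bounded_ops G \<Longrightarrow> f \<notin> ell2 G \<Longrightarrow> T f = 0"
  and bounded_op_ell2 [intro]: "T \<in> bounded_ops G \<Longrightarrow> f \<in> ell2 G \<Longrightarrow> T f \<in> ell2 G"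
  and bounded_op_add: "T \<in> bounded_ops G \<Longrightarrow> f \<in> ell2 G \<Longrightarrow> g \<in> ell2 G \<Longrightarrow> T (f + g) = T f + T g"
  and bounded_op_scale: "T \<in> bounded_ops G \<Longrightarrow> f \<in> ell2 G \<Longrightarrow> T (vscale c f) = vscale c (T f)"
  by (auto simp: bounded_ops_def)

lemma bounded_op_zero: "T \<in> bounded_ops G \<Longrightarrow> T 0 = 0"
proof -
  assume "T \<in> bounded_ops G"
  from bounded_op_scale[OF this, of 0 0] show ?thesis by (simp add: vscale_def zero_fun_def)
qed

lemma bounded_op_diff:
  assumes "T \<in> bounded_ops G" "f \<in> ell2 G" "g \<in> ell2 G" shows "T (f - g) = T f - T g"
  using bounded_op_add[OF assms(1), of "f - g" g] assms by (auto simp: ell2_diff)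

lemma bounded_op_sum:
  "T \<in> bounded_ops G \<Longrightarrow> (\<And>i. i \<in> I \<Longrightarrow> f i \<in> ell2 G) \<Longrightarrow> T (sum f I) = (\<Sum>i\<in>I. T (f i))"
  by (induction I rule: infinite_finite_induct) (auto simp: bounded_op_zero bounded_op_add ell2_sum)

lemma bounded_op_bound:
  assumes "T \<in> bounded_ops G"
  obtains C where "C > 0" "\<And>f. f \<in> ell2 G \<Longrightarrow> ell2_norm G (T f) \<le> C * ell2_norm G f"
proof -
  obtain C where C: "\<forall>f\<in>ell2 G. ell2_norm G (T f) \<le> C * ell2_norm G f"
    using assms by (auto simp: bounded_ops_def)
  have "ell2_norm G (T f) \<le> max C 1 * ell2_norm G f" if "f \<in> ell2 G" for f
    using C that mult_right_mono[of C "max C 1" "ell2_norm G f"] ell2_norm_nonneg[of G f] by force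
  then show thesis using that[of "max C 1"] by auto
qed

lemma bopI:
  assumes "\<And>f. f \<notin> ell2 G \<Longrightarrow> T f = 0" "\<And>f. f \<in> ell2 G \<Longrightarrow> T f \<in> ell2 G"
    "\<And>f g. f \<in> ell2 G \<Longrightarrow> g \<in> ell2 G \<Longrightarrow> T (f + g) = T f + T g"
    "\<And>c f. f \<in> ell2 G \<Longrightarrow> T (vscale c f) = vscale c (T f)"
    "\<And>f. f \<in> ell2 G \<Longrightarrow> ell2_norm G (T f) \<le> C * ell2_norm G f"
  shows "T \<in> bounded_ops G"
  unfolding bounded_ops_def
  by (intro CollectI conjI allI ballI impI exI[of _ C]) (rule assms; assumption)+

text \<open>The adjoint is written down by its matrix coefficients. Testing \<open>T\<close> on
  truncations of \<open>S g\<close> bounds the finite partial sums of \<open>S g\<close> by those of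
  a vector of norm \<open>C * ell2_norm G g\<close>; the adjoint identity is clear for finitely
  supported \<open>f\<close> and extends by approximation.\<close>

lemma adjoint_exists:
  assumes T: "T \<in> bounded_ops G"
  shows "\<exists>S \<in> bounded_ops G. \<forall>f\<in>ell2 G. \<forall>g\<in>ell2 G. ell2_inner G (T f) g = ell2_inner G f (S g)"
proof -
  obtain C where C: "C > 0" "\<And>f. f \<in> ell2 G \<Longrightarrow> ell2_norm G (T f) \<le> C * ell2_norm G f"
    using bounded_op_bound[OF T] by blast
  define S where "S g = (if g \<in> ell2 G then (\<lambda>x. if x \<in> carrier G then ell2_inner G g (T (delta x)) else 0) else 0)" for g
  have Td: "T (delta x) \<in> ell2 G" if "x \<in> carrier G" for x using T that by auto
  have fin: "ell2_inner G (T (\<Sum>x\<in>F. vscale (a x) (delta x))) g = (\<Sum>x\<in>F. a x * cnj (ell2_inner G g (T (delta x))))"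
    if "finite F" "F \<subseteq> carrier G" "g \<in> ell2 G" for F a g
    using that T by (subst bounded_op_sum[OF T])
      (auto simp: bounded_op_scale[OF T] ell2_inner_sum_left ell2_vscale Td ell2_inner_scale_left
        delta_ell2 subset_iff ell2_inner_cnj intro!: sum.cong)
  have S: "S g \<in> ell2 G \<and> ell2_norm G (S g) \<le> C * ell2_norm G g" if g: "g \<in> ell2 G" for g
  proof -
    have "(\<Sum>x\<in>F. (cmod (S g x))\<^sup>2) \<le> (C * ell2_norm G g)\<^sup>2" if F: "finite F" "F \<subseteq> carrier G" for F
    proof -
      define s where "s = sqrt (\<Sum>x\<in>F. (cmod (S g x))\<^sup>2)"
      have s: "s\<^sup>2 = (\<Sum>x\<in>F. (cmod (S g x))\<^sup>2)" "s \<ge> 0" by (auto simp: s_def sum_nonneg)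
      let ?h = "\<Sum>x\<in>F. vscale (S g x) (delta x)"
      have h: "?h \<in> ell2 G" "(ell2_norm G ?h)\<^sup>2 = s\<^sup>2"
        using finite_support_ell2[OF F] s by auto
      then have hn: "ell2_norm G ?h = s" using s ell2_norm_nonneg by (metis power2_eq_imp_eq)
      have "ell2_inner G (T ?h) g = (\<Sum>x\<in>F. S g x * cnj (S g x))"
        unfolding fin[OF F g] by (intro sum.cong) (use F g in \<open>auto simp: S_def\<close>)
      also have "\<dots> = of_real (s\<^sup>2)" by (simp add: s complex_norm_square del: of_real_power)
      finally have "s\<^sup>2 = cmod (ell2_inner G (T ?h) g)" by (simp add: norm_power)
      also have "\<dots> \<le> ell2_norm G (T ?h) * ell2_norm G g"
        by (rule ell2_cauchy_schwarz) (use T h g in auto)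
      also have "\<dots> \<le> (C * s) * ell2_norm G g"
        using C(2)[OF h(1)] hn by (simp add: mult_right_mono ell2_norm_nonneg)
      finally have "s * s \<le> s * (C * ell2_norm G g)" by (simp add: power2_eq_square algebra_simps)
      then have "s \<le> C * ell2_norm G g"
        using s C(1) ell2_norm_nonneg[of G g] by (cases "s = 0") auto
      then show ?thesis using s by (metis power_mono)
    qed
    then show ?thesis using ell2_bound[of G "S g" "C * ell2_norm G g"] C(1) ell2_norm_nonneg[of G g] g
      by (auto simp: S_def)
  qed
  have SB: "S \<in> bounded_ops G"
  proof (rule bopI[where C=C])
    fix f g assume "f \<in> ell2 G" "g \<in> ell2 G"
    then show "S (f + g) = S f + S g"
      by (auto simp: S_def fun_eq_iff ell2_inner_add_left Td ell2_add)
  next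
    fix c f assume "f \<in> ell2 G"
    then show "S (vscale c f) = vscale c (S f)"
      by (auto simp: S_def fun_eq_iff ell2_inner_scale_left Td ell2_vscale)
  qed (use S in \<open>auto simp: S_def\<close>)
  have "ell2_inner G (T f) g = ell2_inner G f (S g)" if f: "f \<in> ell2 G" and g: "g \<in> ell2 G" for f g
  proof -
    \<comment> \<open>\<open>M\<close> collects the factors that multiply the approximation error
      \<open>f - ?h\<close>; the added 1 makes it positive.\<close>
    define M where "M = C * ell2_norm G g + ell2_norm G (S g) + 1"
    have M: "M > 0" using C(1) by (simp add: M_def ell2_norm_nonneg add_nonneg_pos)
    have "cmod (ell2_inner G (T f) g - ell2_inner G f (S g)) \<le> e" if e: "e > 0" for e
    proof -
      obtain F where F: "finite F" "F \<subseteq> carrier G" "ell2_norm G (f - (\<Sum>x\<in>F. vscale (f x) (delta x))) < e / M"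
        using ell2_finite_approx[OF f, of "e/M"] e M by auto
      let ?h = "\<Sum>x\<in>F. vscale (f x) (delta x)"
      have h: "?h \<in> ell2 G" using finite_support_ell2[OF F(1,2)] by auto
      have "ell2_inner G ?h (S g) = (\<Sum>x\<in>F. f x * cnj (S g x))"
        using F g S[OF g] by (subst ell2_inner_sum_left)
          (auto simp: ell2_vscale delta_ell2 ell2_inner_scale_left ell2_inner_delta subset_iff intro!: sum.cong)
      also have "\<dots> = ell2_inner G (T ?h) g"
        unfolding fin[OF F(1,2) g] by (intro sum.cong) (use F g in \<open>auto simp: S_def\<close>)
      finally have eq: "ell2_inner G (T f) g - ell2_inner G f (S g)
         = ell2_inner G (T (f - ?h)) g - ell2_inner G (f - ?h) (S g)"
        using S[OF g] by (simp only: bounded_op_diff[OF T f h] ell2_inner_diff_left[OF bounded_op_ell2[OF T f] bounded_op_ell2[OF T h] g]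
          ell2_inner_diff_left[OF f h]) simp
      have "cmod (ell2_inner G (T f) g - ell2_inner G f (S g)) \<le> cmod (ell2_inner G (T (f - ?h)) g) + cmod (ell2_inner G (f - ?h) (S g))"
        unfolding eq by (rule norm_triangle_ineq4)
      also have "\<dots> \<le> ell2_norm G (T (f - ?h)) * ell2_norm G g + ell2_norm G (f - ?h) * ell2_norm G (S g)"
        by (rule add_mono[OF ell2_cauchy_schwarz[OF bounded_op_ell2[OF T ell2_diff[OF f h]] g]
          ell2_cauchy_schwarz[OF ell2_diff[OF f h] conjunct1[OF S[OF g]]]])
      also have "\<dots> \<le> C * ell2_norm G (f - ?h) * ell2_norm G g + ell2_norm G (f - ?h) * ell2_norm G (S g)"
        using mult_right_mono[OF C(2)[OF ell2_diff[OF f h]] ell2_norm_nonneg[of G g]] by simp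
      also have "\<dots> \<le> ell2_norm G (f - ?h) * M"
        by (simp add: M_def algebra_simps ell2_norm_nonneg)
      also have "\<dots> \<le> e" using F(3) M by (simp add: field_simps less_imp_le)
      finally show ?thesis .
    qed
    then have "cmod (ell2_inner G (T f) g - ell2_inner G f (S g)) \<le> 0"
      by (rule field_le_epsilon) simp
    then show ?thesis by simp
  qed
  then show ?thesis using SB by blast
qed

lemma adjoint_unique:
  assumes "S \<in> bounded_ops G" "S' \<in> bounded_ops G"
    "\<And>f g. f \<in> ell2 G \<Longrightarrow> g \<in> ell2 G \<Longrightarrow> ell2_inner G f (S g) = ell2_inner G f (S' g)"
  shows "S = S'"
proof
  fix g show "S g = S' g"
  proof (cases "g \<in> ell2 G")
    case True
    show ?thesis
    proof (rule ell2_inner_eqI[of _ G])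
      fix h assume "h \<in> ell2 G"
      from assms(3)[OF this True] show "ell2_inner G (S g) h = ell2_inner G (S' g) h"
        by (metis ell2_inner_cnj)
    qed (use assms True in auto)
  qed (use assms in \<open>auto simp: bounded_op_off\<close>)
qed

lemma adj_unique_ex:
  assumes T: "T \<in> bounded_ops G"
  shows "\<exists>!S. S \<in> bounded_ops G \<and> (\<forall>f\<in>ell2 G. \<forall>g\<in>ell2 G. ell2_inner G (T f) g = ell2_inner G f (S g))"
  using adjoint_exists[OF T] adjoint_unique[of _ G] by (metis (mono_tags, lifting))

lemma adj_bop [intro]: "T \<in> bounded_ops G \<Longrightarrow> adj G T \<in> bounded_ops G"
  and adj_inner: "T \<in> bounded_ops G \<Longrightarrow> f \<in> ell2 G \<Longrightarrow> g \<in> ell2 G \<Longrightarrow>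
    ell2_inner G (T f) g = ell2_inner G f (adj G T g)"
  using theI'[OF adj_unique_ex, of T G] unfolding adj_def by auto

lemma adj_inner': "T \<in> bounded_ops G \<Longrightarrow> f \<in> ell2 G \<Longrightarrow> g \<in> ell2 G \<Longrightarrow>
    ell2_inner G (adj G T f) g = ell2_inner G f (T g)"
  by (metis adj_inner ell2_inner_cnj)

lemma adj_eqI:
  assumes "T \<in> bounded_ops G" "S \<in> bounded_ops G"
    "\<And>f g. f \<in> ell2 G \<Longrightarrow> g \<in> ell2 G \<Longrightarrow> ell2_inner G (T f) g = ell2_inner G f (S g)"
  shows "adj G T = S"
  by (rule adjoint_unique[of _ G]) (use assms adj_inner[OF assms(1)] in auto)

lemma adj_adj: "T \<in> bounded_ops G \<Longrightarrow> adj G (adj G T) = T"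
  by (rule adj_eqI) (auto simp: adj_inner')

text \<open>Passing to adjoints replaces a density argument: the coordinate of
  \<open>adj G T g\<close> at \<open>x\<close> is already determined by
  \<open>T (delta x)\<close>.\<close>

lemma bounded_op_eqI:
  assumes T: "T \<in> bounded_ops G" and S: "S \<in> bounded_ops G"
    and eq: "\<And>x. x \<in> carrier G \<Longrightarrow> T (delta x) = S (delta x)"
  shows "T = S"
proof -
  have "adj G T g = adj G S g" if g: "g \<in> ell2 G" for g
  proof (rule ell2_eqI[of _ G])
    fix x assume x: "x \<in> carrier G"
    have "ell2_inner G (delta x) (adj G T g) = ell2_inner G (delta x) (adj G S g)"
      using adj_inner[OF T delta_ell2[OF x] g] adj_inner[OF S delta_ell2[OF x] g] eq[OF x] by simp
    then show "adj G T g x = adj G S g x" using T S g x by (simp add: ell2_inner_delta adj_bop bounded_op_ell2)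
  qed (use T S g in auto)
  then have "adj G T = adj G S" by (intro adjoint_unique[of _ G]) (use T S in auto)
  then show ?thesis using T S by (metis adj_adj)
qed

lemma bounded_op_eqI_inner:
  assumes T: "T \<in> bounded_ops G" and S: "S \<in> bounded_ops G"
    and eq: "\<And>x y. x \<in> carrier G \<Longrightarrow> y \<in> carrier G \<Longrightarrow>
      ell2_inner G (T (delta x)) (delta y) = ell2_inner G (S (delta x)) (delta y)"
  shows "T = S"
  by (rule bounded_op_eqI[OF T S], rule ell2_eqI[of _ G])
     (use T S eq in \<open>auto simp: ell2_inner_delta bounded_op_ell2 delta_ell2\<close>)

lemma id_op_bop [intro, simp]: "id_op G \<in> bounded_ops G"
  by (rule bopI[where C=1]) (auto simp: id_op_def)

lemma zero_bop [intro, simp]: "0 \<in> bounded_ops G"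
  by (rule bopI[where C=0]) (auto simp: ell2_norm_def fun_eq_iff)

lemma comp_bop [intro]:
  assumes "S \<in> bounded_ops G" "T \<in> bounded_ops G" shows "S \<circ> T \<in> bounded_ops G"
proof -
  obtain C where C: "C > 0" "\<And>f. f \<in> ell2 G \<Longrightarrow> ell2_norm G (S f) \<le> C * ell2_norm G f"
    using bounded_op_bound[OF assms(1)] by blast
  obtain D where D: "D > 0" "\<And>f. f \<in> ell2 G \<Longrightarrow> ell2_norm G (T f) \<le> D * ell2_norm G f"
    using bounded_op_bound[OF assms(2)] by blast
  have "ell2_norm G (S (T f)) \<le> (C * D) * ell2_norm G f" if "f \<in> ell2 G" for f
  proof -
    have "ell2_norm G (S (T f)) \<le> C * ell2_norm G (T f)" by (intro C(2)) (use assms that in auto)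
    also have "\<dots> \<le> C * (D * ell2_norm G f)" using C(1) D(2)[OF that] by simp
    finally show ?thesis by (simp add: mult.assoc)
  qed
  then show ?thesis using assms
    by (intro bopI[where C="C*D"], unfold o_apply)
       (simp_all only: bounded_op_off[of T, OF assms(2)] bounded_op_zero[OF assms(1)] bounded_op_add bounded_op_scale bounded_op_ell2 simp_thms)
qed

lemma add_bop [intro]:
  assumes "S \<in> bounded_ops G" "T \<in> bounded_ops G" shows "S + T \<in> bounded_ops G"
proof -
  obtain C where C: "C > 0" "\<And>f. f \<in> ell2 G \<Longrightarrow> ell2_norm G (S f) \<le> C * ell2_norm G f"
    using bounded_op_bound[OF assms(1)] by blast
  obtain D where D: "D > 0" "\<And>f. f \<in> ell2 G \<Longrightarrow> ell2_norm G (T f) \<le> D * ell2_norm G f"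
    using bounded_op_bound[OF assms(2)] by blast
  have "ell2_norm G (S f + T f) \<le> (C + D) * ell2_norm G f" if "f \<in> ell2 G" for f
    using ell2_norm_triangle[of "S f" G "T f"] C(2)[OF that] D(2)[OF that] assms that
    by (force simp: distrib_right)
  moreover have "vscale c (f + g) = vscale c f + vscale c g" for c f and g :: "'a vec"
    by (auto simp: fun_eq_iff algebra_simps)
  ultimately show ?thesis using assms
    by (intro bopI[where C="C+D"]) (auto simp: bounded_op_off bounded_op_add bounded_op_scale bounded_op_ell2 ell2_add)
qed

lemma oscale_bop [intro]:
  assumes "T \<in> bounded_ops G" shows "oscale c T \<in> bounded_ops G"
proof -
  obtain D where D: "D > 0" "\<And>f. f \<in> ell2 G \<Longrightarrow> ell2_norm G (T f) \<le> D * ell2_norm G f"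
    using bounded_op_bound[OF assms] by blast
  have "ell2_norm G (vscale c (T f)) \<le> (cmod c * D) * ell2_norm G f" if "f \<in> ell2 G" for f
    using D(2)[OF that] by (simp add: ell2_norm_vscale mult.assoc mult_left_mono)
  then show ?thesis using assms
    by (intro bopI[where C="cmod c * D"])
       (auto simp: bounded_op_off bounded_op_add bounded_op_scale bounded_op_ell2 oscale_def fun_eq_iff algebra_simps intro!: ell2_vscale)
qed

lemma oscale_apply: "oscale c T f = vscale c (T f)"
  by (simp add: oscale_def)

lemma diff_bop [intro]:
  assumes "S \<in> bounded_ops G" "T \<in> bounded_ops G" shows "S - T \<in> bounded_ops G"
proof -
  have "S - T = S + oscale (-1) T" by (auto simp: fun_eq_iff oscale_def)
  then show ?thesis using assms by (metis add_bop oscale_bop)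
qed

lemma sum_bop [intro]: "(\<And>i. i \<in> I \<Longrightarrow> T i \<in> bounded_ops G) \<Longrightarrow> sum T I \<in> bounded_ops G"
  by (induction I rule: infinite_finite_induct) auto

lemma adj_comp: "S \<in> bounded_ops G \<Longrightarrow> T \<in> bounded_ops G \<Longrightarrow> adj G (S \<circ> T) = adj G T \<circ> adj G S"
  by (rule adj_eqI) (auto simp: adj_inner bounded_op_ell2 adj_bop)

lemma adj_add: "S \<in> bounded_ops G \<Longrightarrow> T \<in> bounded_ops G \<Longrightarrow> adj G (S + T) = adj G S + adj G T"
  by (rule adj_eqI) (auto simp: adj_inner bounded_op_ell2 adj_bop ell2_inner_add_left ell2_inner_add_right)

lemma adj_diff: "S \<in> bounded_ops G \<Longrightarrow> T \<in> bounded_ops G \<Longrightarrow> adj G (S - T) = adj G S - adj G T"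
  by (rule adj_eqI) (auto simp: adj_inner bounded_op_ell2 adj_bop ell2_inner_diff_left ell2_inner_diff_right)

lemma adj_oscale: "T \<in> bounded_ops G \<Longrightarrow> adj G (oscale c T) = oscale (cnj c) (adj G T)"
  by (rule adj_eqI[OF oscale_bop oscale_bop])
     (auto simp: adj_inner bounded_op_ell2 adj_bop oscale_apply ell2_inner_scale_left ell2_inner_scale_right)

lemma adj_id: "adj G (id_op G) = id_op G"
  by (rule adj_eqI[OF id_op_bop id_op_bop]) (auto simp: id_op_def)

lemma bounded_op_cl_invariant:
  assumes T: "T \<in> bounded_ops G" and S: "S \<subseteq> ell2 G" "\<And>f. f \<in> S \<Longrightarrow> T f \<in> cl G S'" and S': "S' \<subseteq> ell2 G" and f: "f \<in> cl G S"
  shows "T f \<in> cl G S'"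
proof -
  obtain C where C: "C > 0" "\<And>f. f \<in> ell2 G \<Longrightarrow> ell2_norm G (T f) \<le> C * ell2_norm G f"
    using bounded_op_bound[OF T] by blast
  have "\<exists>s\<in>cl G S'. ell2_norm G (T f - s) < e" if e: "e > 0" for e
  proof -
    obtain s where s: "s \<in> S" "ell2_norm G (f - s) < e / C"
      using clD[OF f divide_pos_pos[OF e C(1)]] by blast
    have "ell2_norm G (T f - T s) = ell2_norm G (T (f - s))"
      using T S s f cl_ell2 by (metis bounded_op_diff subsetD)
    also have "\<dots> \<le> C * ell2_norm G (f - s)" using S s f cl_ell2 by (intro C(2)) blast
    also have "\<dots> < e" using s C(1) by (simp add: field_simps)
    finally show ?thesis using S s by blast
  qed
  then have "T f \<in> cl G (cl G S')" using T f cl_ell2 by (auto simp: cl_def)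
  then show ?thesis using cl_cl[OF S'] by auto
qed

lemma cl_full:
  assumes S: "lin_subspace G S" and orth: "\<And>f. f \<in> ell2 G \<Longrightarrow> (\<forall>s\<in>S. ell2_inner G f s = 0) \<Longrightarrow> f = 0"
  shows "cl G S = ell2 G"
proof -
  have "f \<in> cl G S" if f: "f \<in> ell2 G" for f
  proof -
    obtain k where k: "k \<in> cl G S" "\<forall>m\<in>cl G S. ell2_inner G (f - k) m = 0"
      using projection_exists[OF closed_subspace_cl[OF S] f] by blast
    have "S \<subseteq> cl G S" using S by (intro cl_subset) (auto simp: lin_subspace_def)
    then have "f - k = 0" using f k cl_ell2[OF k(1)] by (intro orth ell2_diff) auto
    then show ?thesis using k by simp
  qed
  then show ?thesis using cl_ell2 by blast
qed

definition proj :: "('g, 'm) monoid_scheme \<Rightarrow> 'g vec set \<Rightarrow> 'g oper" where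
  "proj G K f = (if f \<in> ell2 G then (SOME k. k \<in> K \<and> (\<forall>m\<in>K. ell2_inner G (f - k) m = 0)) else 0)"

lemma closed_subspace_ell2: "closed_subspace G K \<Longrightarrow> k \<in> K \<Longrightarrow> k \<in> ell2 G"
  by (auto simp: closed_subspace_def lin_subspace_def)

lemma proj_in: "closed_subspace G K \<Longrightarrow> f \<in> ell2 G \<Longrightarrow> proj G K f \<in> K"
  and proj_orth: "closed_subspace G K \<Longrightarrow> f \<in> ell2 G \<Longrightarrow> m \<in> K \<Longrightarrow> ell2_inner G (f - proj G K f) m = 0"
  using someI_ex[OF projection_exists[of G K f, unfolded Bex_def]] by (auto simp: proj_def)

lemma proj_eqI:
  assumes K: "closed_subspace G K" and f: "f \<in> ell2 G" and k: "k \<in> K" "\<And>m. m \<in> K \<Longrightarrow> ell2_inner G (f - k) m = 0"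
  shows "proj G K f = k"
proof -
  let ?p = "proj G K f"
  have e: "k \<in> ell2 G" "?p \<in> ell2 G" using K f k proj_in closed_subspace_ell2 by blast+
  have pk: "?p - k \<in> K" using K k proj_in[OF K f] lin_subspace_diff by (auto simp: closed_subspace_def)
  have "?p - k = (f - k) - (f - ?p)" by simp
  then have "ell2_inner G (?p - k) (?p - k) = ell2_inner G (f - k) (?p - k) - ell2_inner G (f - ?p) (?p - k)"
    using e f by (metis ell2_diff ell2_inner_diff_left)
  also have "\<dots> = 0" using k(2)[OF pk] proj_orth[OF K f pk] by simp
  finally have "ell2_norm G (?p - k) = 0" using e by (simp add: ell2_inner_self ell2_diff)
  then have "?p - k = 0" using ell2_norm_zero_iff e by blast
  then show ?thesis by simp
qed

lemma proj_id: "closed_subspace G K \<Longrightarrow> k \<in> K \<Longrightarrow> proj G K k = k"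
  by (rule proj_eqI) (auto simp: closed_subspace_ell2)

lemma proj_bop:
  assumes K: "closed_subspace G K" shows "proj G K \<in> bounded_ops G"
proof (rule bopI[where C=1])
  have pe: "proj G K f \<in> ell2 G" if "f \<in> ell2 G" for f
    using K that proj_in closed_subspace_ell2 by blast
  show "proj G K f \<in> ell2 G" if "f \<in> ell2 G" for f by (rule pe[OF that])
  fix f assume f: "f \<in> ell2 G"
  show "proj G K (vscale c f) = vscale c (proj G K f)" for c
  proof (rule proj_eqI[OF K ell2_vscale[OF f]])
    show "vscale c (proj G K f) \<in> K" using K proj_in[OF K f] by (auto simp: closed_subspace_def lin_subspace_def)
    fix m assume m: "m \<in> K"
    have "vscale c f - vscale c (proj G K f) = vscale c (f - proj G K f)"
      by (auto simp: fun_eq_iff algebra_simps)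
    then show "ell2_inner G (vscale c f - vscale c (proj G K f)) m = 0"
      using proj_orth[OF K f m] pe[OF f] f m K closed_subspace_ell2
      by (metis ell2_diff ell2_inner_scale_left mult_zero_right)
  qed
  show "proj G K (f + g) = proj G K f + proj G K g" if g: "g \<in> ell2 G" for g
  proof (rule proj_eqI[OF K ell2_add[OF f g]])
    show "proj G K f + proj G K g \<in> K"
      using K proj_in[OF K f] proj_in[OF K g] by (auto simp: closed_subspace_def lin_subspace_def)
    fix m assume m: "m \<in> K"
    have "f + g - (proj G K f + proj G K g) = (f - proj G K f) + (g - proj G K g)" by simp
    then show "ell2_inner G (f + g - (proj G K f + proj G K g)) m = 0"
      using proj_orth[OF K f m] proj_orth[OF K g m] pe[OF f] pe[OF g] f g closed_subspace_ell2[OF K m]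
      by (metis add.right_neutral ell2_diff ell2_inner_add_left)
  qed
  have "f = (f - proj G K f) + proj G K f" by simp
  then have "(ell2_norm G f)\<^sup>2 = (ell2_norm G (f - proj G K f))\<^sup>2 + 2 * Re (ell2_inner G (f - proj G K f) (proj G K f)) + (ell2_norm G (proj G K f))\<^sup>2"
    using pe[OF f] f by (metis ell2_diff ell2_norm_sq_add)
  then have "(ell2_norm G (proj G K f))\<^sup>2 \<le> (ell2_norm G f)\<^sup>2"
    using proj_orth[OF K f proj_in[OF K f]] by simp
  then show "ell2_norm G (proj G K f) \<le> 1 * ell2_norm G f"
    using ell2_norm_nonneg power2_le_imp_le by auto
qed (simp add: proj_def)

lemma proj_sym:
  assumes K: "closed_subspace G K" and f: "f \<in> ell2 G" and g: "g \<in> ell2 G"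
  shows "ell2_inner G (proj G K f) g = ell2_inner G f (proj G K g)"
proof -
  have e: "proj G K f \<in> ell2 G" "proj G K g \<in> ell2 G" using proj_bop[OF K] f g by auto
  have "ell2_inner G (g - proj G K g) (proj G K f) = 0" "ell2_inner G (f - proj G K f) (proj G K g) = 0"
    using K f g by (auto intro!: proj_orth proj_in)
  then show ?thesis using e f g
    by (metis (no_types, lifting) ell2_inner_cnj ell2_inner_diff_left eq_iff_diff_eq_0)
qed

text \<open>\<open>K\<close> is reducing for \<open>U\<close>: invariance under the adjoint
  \<open>U'\<close> is what keeps \<open>U (f - proj G K f)\<close> orthogonal to
  \<open>K\<close>.\<close>

lemma proj_commute:
  assumes K: "closed_subspace G K" and U: "U \<in> bounded_ops G" "U' \<in> bounded_ops G"
    and adj: "\<And>f g. f \<in> ell2 G \<Longrightarrow> g \<in> ell2 G \<Longrightarrow> ell2_inner G (U f) g = ell2_inner G f (U' g)"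
    and inv: "\<And>k. k \<in> K \<Longrightarrow> U k \<in> K" "\<And>k. k \<in> K \<Longrightarrow> U' k \<in> K" and f: "f \<in> ell2 G"
  shows "proj G K (U f) = U (proj G K f)"
proof (rule proj_eqI[OF K])
  have pe: "proj G K f \<in> ell2 G" using proj_bop[OF K] f by auto
  fix m assume m: "m \<in> K"
  have "ell2_inner G (U f - U (proj G K f)) m = ell2_inner G (f - proj G K f) (U' m)"
    using U f pe closed_subspace_ell2[OF K m] by (subst bounded_op_diff[OF U(1), symmetric]) (auto intro!: adj)
  then show "ell2_inner G (U f - U (proj G K f)) m = 0" using proj_orth[OF K f inv(2)[OF m]] by simp
qed (use U f proj_in[OF K f] inv in auto)

section \<open>The weak operator topology\<close>

lemma topspace_wot [simp]: "topspace (wot G) = bounded_ops G"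
proof -
  have "bounded_ops G \<subseteq> \<Union> {{T \<in> bounded_ops G. ell2_inner G (T f) g \<in> U} | f g U.
        f \<in> ell2 G \<and> g \<in> ell2 G \<and> open U}"
    by (rule Union_upper) (auto intro!: exI[of _ 0] exI[of _ UNIV])
  then show ?thesis unfolding wot_def topology_generated_by_topspace by blast
qed

lemma openin_wot_basic:
  "f \<in> ell2 G \<Longrightarrow> g \<in> ell2 G \<Longrightarrow> open U \<Longrightarrow> openin (wot G) {T \<in> bounded_ops G. ell2_inner G (T f) g \<in> U}"
  unfolding wot_def by (rule topology_generated_by_Basis) blast

text \<open>Induction over the generation of open sets: subbasic sets give one coefficient,
  intersections unite the finite sets of test pairs and take the smaller tolerance.\<close>

lemma wot_nbhd:
  assumes "openin (wot G) W" "T \<in> W"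
  shows "\<exists>P e. finite P \<and> P \<subseteq> ell2 G \<times> ell2 G \<and> e > 0 \<and>
    (\<forall>S\<in>bounded_ops G. (\<forall>(f,g)\<in>P. cmod (ell2_inner G (S f) g - ell2_inner G (T f) g) < e) \<longrightarrow> S \<in> W)"
proof -
  have "generate_topology_on {{T \<in> bounded_ops G. ell2_inner G (T f) g \<in> U} | f g U.
        f \<in> ell2 G \<and> g \<in> ell2 G \<and> open U} W"
    using assms(1) unfolding wot_def openin_topology_generated_by_iff .
  then show ?thesis using assms(2)
  proof (induction W rule: generate_topology_on.induct)
    case Empty then show ?case by simp
  next
    case (Int a b)
    obtain P e where P: "finite P" "P \<subseteq> ell2 G \<times> ell2 G" "e > 0"
      "\<And>S. S\<in>bounded_ops G \<Longrightarrow> \<forall>(f,g)\<in>P. cmod (ell2_inner G (S f) g - ell2_inner G (T f) g) < e \<Longrightarrow> S \<in> a"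
      using Int by (auto; blast)
    obtain Q d where Q: "finite Q" "Q \<subseteq> ell2 G \<times> ell2 G" "d > 0"
      "\<And>S. S\<in>bounded_ops G \<Longrightarrow> \<forall>(f,g)\<in>Q. cmod (ell2_inner G (S f) g - ell2_inner G (T f) g) < d \<Longrightarrow> S \<in> b"
      using Int by (auto; blast)
    show ?case
    proof (intro exI[of _ "P \<union> Q"] exI[of _ "min e d"] conjI ballI impI)
      fix S assume S: "S \<in> bounded_ops G"
        "\<forall>(f,g)\<in>P \<union> Q. cmod (ell2_inner G (S f) g - ell2_inner G (T f) g) < min e d"
      show "S \<in> a \<inter> b" using P(4)[OF S(1)] Q(4)[OF S(1)] S(2) by (auto split: prod.splits)
    qed (use P Q in auto)
  next
    case (UN K)
    then obtain k where "k \<in> K" "T \<in> k" by blast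
    from UN(2)[OF this] \<open>k \<in> K\<close> show ?case by (meson UnionI)
  next
    case (Basis s)
    then obtain f g U where s: "s = {T \<in> bounded_ops G. ell2_inner G (T f) g \<in> U}"
      and fg: "f \<in> ell2 G" "g \<in> ell2 G" "open U" by blast
    then obtain e where "e > 0" "\<forall>y. dist y (ell2_inner G (T f) g) < e \<longrightarrow> y \<in> U"
      using Basis(2) by (auto simp: open_dist)
    then show ?case using fg s
      by (intro exI[of _ "{(f,g)}"] exI[of _ e]) (auto simp: dist_norm)
  qed
qed

lemma wot_closure_iff:
  assumes "A \<subseteq> bounded_ops G"
  shows "T \<in> wot G closure_of A \<longleftrightarrow> T \<in> bounded_ops G \<and>
    (\<forall>P e. finite P \<longrightarrow> P \<subseteq> ell2 G \<times> ell2 G \<longrightarrow> e > 0 \<longrightarrow>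
      (\<exists>S\<in>A. \<forall>(f,g)\<in>P. cmod (ell2_inner G (S f) g - ell2_inner G (T f) g) < e))" (is "?L = ?R")
proof
  assume L: ?L
  then have T: "T \<in> bounded_ops G" by (auto simp: in_closure_of)
  have "\<exists>S\<in>A. \<forall>(f,g)\<in>P. cmod (ell2_inner G (S f) g - ell2_inner G (T f) g) < e"
    if P: "finite P" "P \<subseteq> ell2 G \<times> ell2 G" "e > 0" for P e
  proof -
    define W where "W = (\<Inter>(f,g)\<in>P. {S \<in> bounded_ops G. ell2_inner G (S f) g \<in> ball (ell2_inner G (T f) g) e}) \<inter> topspace (wot G)"
    have "openin (wot G) W" unfolding W_def
      by (rule openin_INT[OF P(1)]) (use P in \<open>auto intro!: openin_wot_basic split: prod.splits simp del: mem_ball\<close>)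
    moreover have "T \<in> W" using T P by (auto simp: W_def)
    ultimately obtain S where "S \<in> A" "S \<in> W" using L by (auto simp: in_closure_of)
    then show ?thesis by (intro bexI[of _ S]) (force simp: W_def dist_norm norm_minus_commute)+
  qed
  then show ?R using T by blast
next
  assume R: ?R
  have "\<exists>S. S \<in> A \<and> S \<in> W" if W: "T \<in> W" "openin (wot G) W" for W
  proof -
    obtain P e where P: "finite P" "P \<subseteq> ell2 G \<times> ell2 G" "e > 0"
      "\<forall>S\<in>bounded_ops G. (\<forall>(f,g)\<in>P. cmod (ell2_inner G (S f) g - ell2_inner G (T f) g) < e) \<longrightarrow> S \<in> W"
      using wot_nbhd[OF W(2,1)] by blast
    then obtain S where "S \<in> A" "\<forall>(f,g)\<in>P. cmod (ell2_inner G (S f) g - ell2_inner G (T f) g) < e"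
      using R by blast
    then show ?thesis using P(4) assms by blast
  qed
  then show ?L using R by (auto simp: in_closure_of)
qed

lemma wot_closure_bop: "wot G closure_of A \<subseteq> bounded_ops G"
  using closure_of_subset_topspace[of "wot G" A] by simp

text \<open>Once \<open>U\<close> is moved to the test vector by its adjoint, both sides are
  coefficients of \<open>T\<close>, at \<open>(U f, g)\<close> and at \<open>(f, adj G U g)\<close>,
  and one \<open>S\<close> approximates the two simultaneously.\<close>

lemma wot_commute:
  assumes A: "A \<subseteq> bounded_ops G" and U: "U \<in> bounded_ops G"
    and comm: "\<And>S f. S \<in> A \<Longrightarrow> f \<in> ell2 G \<Longrightarrow> S (U f) = U (S f)"
    and T: "T \<in> wot G closure_of A" and f: "f \<in> ell2 G"
  shows "T (U f) = U (T f)"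
proof -
  have TB: "T \<in> bounded_ops G" using T wot_closure_bop by blast
  have ap: "\<And>P e. finite P \<Longrightarrow> P \<subseteq> ell2 G \<times> ell2 G \<Longrightarrow> e > 0 \<Longrightarrow>
      \<exists>S\<in>A. \<forall>(f,g)\<in>P. cmod (ell2_inner G (S f) g - ell2_inner G (T f) g) < e"
    using T unfolding wot_closure_iff[OF A] by blast
  show ?thesis
  proof (rule ell2_inner_eqI[of _ G])
    fix g assume g: "g \<in> ell2 G"
    have "cmod (ell2_inner G (T (U f)) g - ell2_inner G (U (T f)) g) \<le> e" if e: "e > 0" for e
    proof -
      have Ug: "adj G U g \<in> ell2 G" "U f \<in> ell2 G" using U f g by auto
      obtain S where S: "S \<in> A" "cmod (ell2_inner G (S (U f)) g - ell2_inner G (T (U f)) g) < e/2"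
         "cmod (ell2_inner G (S f) (adj G U g) - ell2_inner G (T f) (adj G U g)) < e/2"
        using ap[of "{(U f, g), (f, adj G U g)}" "e/2"] Ug f g e by auto
      have SB: "S \<in> bounded_ops G" using S A by auto
      have "ell2_inner G (S f) (adj G U g) = ell2_inner G (S (U f)) g"
        using comm[OF S(1) f] adj_inner[OF U bounded_op_ell2[OF SB f] g] by simp
      moreover have "ell2_inner G (T f) (adj G U g) = ell2_inner G (U (T f)) g"
        using adj_inner[OF U bounded_op_ell2[OF TB f] g] by simp
      ultimately show ?thesis using S(2,3)
        norm_triangle_ineq4[of "ell2_inner G (S (U f)) g - ell2_inner G (U (T f)) g" "ell2_inner G (S (U f)) g - ell2_inner G (T (U f)) g"]
        by simp
    qed
    then have "cmod (ell2_inner G (T (U f)) g - ell2_inner G (U (T f)) g) \<le> 0"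
      by (rule field_le_epsilon) simp
    then show "ell2_inner G (T (U f)) g = ell2_inner G (U (T f)) g" by simp
  qed (use TB U f in auto)
qed

text \<open>Left translation, right translation and, up to complex conjugation,
  \<open>conj_J\<close> are all reindexings along bijections of the group.\<close>

lemma ell2_reindex:
  assumes b: "bij_betw p (carrier G) (carrier H)"
  shows "f \<in> ell2 H \<Longrightarrow> (\<lambda>x. if x \<in> carrier G then f (p x) else 0) \<in> ell2 G"
    and "ell2_inner G (\<lambda>x. if x \<in> carrier G then f (p x) else 0) (\<lambda>x. if x \<in> carrier G then g (p x) else 0)
       = ell2_inner H f g"
    and "ell2_norm G (\<lambda>x. if x \<in> carrier G then f (p x) else 0) = ell2_norm H f"
proof -
  show "(\<lambda>x. if x \<in> carrier G then f (p x) else 0) \<in> ell2 G" if "f \<in> ell2 H"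
    using that summable_on_reindex_bij_betw[OF b, of "\<lambda>x. (cmod (f x))\<^sup>2"]
    by (auto simp: ell2_def cong: summable_on_cong)
  show "ell2_inner G (\<lambda>x. if x \<in> carrier G then f (p x) else 0) (\<lambda>x. if x \<in> carrier G then g (p x) else 0)
       = ell2_inner H f g"
    unfolding ell2_inner_def using infsum_reindex_bij_betw[OF b, of "\<lambda>x. f x * cnj (g x)"]
    by (simp cong: infsum_cong)
  show "ell2_norm G (\<lambda>x. if x \<in> carrier G then f (p x) else 0) = ell2_norm H f"
    unfolding ell2_norm_def using infsum_reindex_bij_betw[OF b, of "\<lambda>x. (cmod (f x))\<^sup>2"]
    by (simp cong: infsum_cong)
qed

lemma reindex_bop:
  assumes b: "bij_betw p (carrier G) (carrier G)"
  shows "(\<lambda>f. if f \<in> ell2 G then (\<lambda>x. if x \<in> carrier G then f (p x) else 0) else 0) \<in> bounded_ops G"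
  by (rule bopI[where C=1]) (auto simp: ell2_reindex[OF b] ell2_add ell2_vscale fun_eq_iff)

section \<open>Commutants and amplifications\<close>

lemma bounded_op_apply_inI: "T \<in> bounded_ops G \<Longrightarrow> S \<in> bounded_ops G \<Longrightarrow> (\<And>f. f \<in> ell2 G \<Longrightarrow> T f = S f) \<Longrightarrow> T = S"
  by (rule ext) (metis bounded_op_off)

definition commutant :: "('g, 'm) monoid_scheme \<Rightarrow> 'g oper set \<Rightarrow> 'g oper set" where
  "commutant G A = {T \<in> bounded_ops G. \<forall>U\<in>A. T \<circ> U = U \<circ> T}"

lemma commutant_bop: "T \<in> commutant G A \<Longrightarrow> T \<in> bounded_ops G"
  by (simp add: commutant_def)

lemma commutantD: "T \<in> commutant G A \<Longrightarrow> U \<in> A \<Longrightarrow> T (U f) = U (T f)"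
  by (auto simp: commutant_def fun_eq_iff)

lemma commutantI:
  assumes "A \<subseteq> bounded_ops G" "T \<in> bounded_ops G"
    "\<And>U f. U \<in> A \<Longrightarrow> f \<in> ell2 G \<Longrightarrow> T (U f) = U (T f)"
  shows "T \<in> commutant G A"
  using assms unfolding commutant_def
  by (auto intro!: bounded_op_apply_inI[of _ G] comp_bop)

context
  fixes G :: "('g, 'm) monoid_scheme" and A :: "'g oper set"
  assumes A: "A \<subseteq> bounded_ops G"
begin

lemma commutant_id: "id_op G \<in> commutant G A"
  by (rule commutantI[OF A id_op_bop]) (use A in \<open>auto simp: id_op_def subset_iff\<close>)

lemma commutant_comp: "S \<in> commutant G A \<Longrightarrow> T \<in> commutant G A \<Longrightarrow> S \<circ> T \<in> commutant G A"
  by (rule commutantI[OF A]) (auto simp: commutantD commutant_bop)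

lemma commutant_add:
  assumes "S \<in> commutant G A" "T \<in> commutant G A" shows "S + T \<in> commutant G A"
proof (rule commutantI[OF A])
  fix U f assume "U \<in> A" "f \<in> ell2 G"
  then show "(S + T) (U f) = U ((S + T) f)"
    using assms A bounded_op_add[of U G "S f" "T f"] bounded_op_ell2 commutant_bop
    by (metis commutantD plus_fun_apply subsetD)
qed (use assms commutant_bop in blast)

lemma commutant_oscale:
  assumes "T \<in> commutant G A" shows "oscale c T \<in> commutant G A"
proof (rule commutantI[OF A])
  fix U f assume "U \<in> A" "f \<in> ell2 G"
  then show "oscale c T (U f) = U (oscale c T f)"
    using assms A bounded_op_scale[of U G "T f"] bounded_op_ell2 commutant_bop
    by (metis commutantD oscale_apply subsetD)
qed (use assms commutant_bop in blast)

lemma commutant_diff: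
  assumes "S \<in> commutant G A" "T \<in> commutant G A" shows "S - T \<in> commutant G A"
proof -
  have "S - T = S + oscale (-1) T" by (auto simp: fun_eq_iff oscale_def)
  then show ?thesis using assms by (metis commutant_add commutant_oscale)
qed

lemma commutant_zero: "0 \<in> commutant G A"
  by (rule commutantI[OF A]) (use A bounded_op_zero in auto)

lemma commutant_sum: "(\<And>i. i \<in> I \<Longrightarrow> T i \<in> commutant G A) \<Longrightarrow> sum T I \<in> commutant G A"
  by (induction I rule: infinite_finite_induct) (auto simp: commutant_zero commutant_add)

lemma commutant_adj:
  assumes adj: "\<And>U. U \<in> A \<Longrightarrow> adj G U \<in> A" and T: "T \<in> commutant G A" shows "adj G T \<in> commutant G A"
proof -
  have TB: "T \<in> bounded_ops G" using T commutant_bop by blast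
  have "adj G T \<circ> U = U \<circ> adj G T" if U: "U \<in> A" for U
  proof -
    have UB: "U \<in> bounded_ops G" using A U by blast
    have "T \<circ> adj G U = adj G U \<circ> T" using T adj[OF U] by (auto simp: commutant_def)
    from arg_cong[OF this, of "adj G"] show ?thesis
      using UB TB by (simp add: adj_comp adj_bop adj_adj)
  qed
  then show ?thesis using TB by (auto simp: commutant_def)
qed

end

lemma proj_commutant:
  assumes A: "A \<subseteq> bounded_ops G" "\<And>U. U \<in> A \<Longrightarrow> adj G U \<in> A" and K: "closed_subspace G K"
    and inv: "\<And>U k. U \<in> A \<Longrightarrow> k \<in> K \<Longrightarrow> U k \<in> K"
  shows "proj G K \<in> commutant G A"
proof (rule commutantI[OF A(1) proj_bop[OF K]])
  fix U f assume U: "U \<in> A" and f: "f \<in> ell2 G"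
  have UB: "U \<in> bounded_ops G" using U A by blast
  show "proj G K (U f) = U (proj G K f)"
    by (rule proj_commute[OF K UB adj_bop[OF UB] adj_inner[OF UB] inv[OF U] inv[OF A(2)[OF U]] f])
qed

text \<open>Only the carrier of this record matters: it indexes \<open>n\<close> orthogonal copies of the group.\<close>

definition amp :: "('g, 'm) monoid_scheme \<Rightarrow> nat \<Rightarrow> ('g \<times> nat) monoid" where
  "amp G n = \<lparr>carrier = carrier G \<times> {..<n}, mult = undefined, one = undefined\<rparr>"

definition component :: "nat \<Rightarrow> ('g \<times> nat) vec \<Rightarrow> 'g vec" where
  "component i F = (\<lambda>x. F (x, i))"

definition embed :: "nat \<Rightarrow> 'g vec \<Rightarrow> ('g \<times> nat) vec" where
  "embed i f = (\<lambda>(x, j). if j = i then f x else 0)"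

lemma carrier_amp [simp]: "carrier (amp G n) = carrier G \<times> {..<n}"
  by (simp add: amp_def)

lemma component_add: "component i (F + H) = component i F + component i H"
  and component_diff: "component i (F - H) = component i F - component i H"
  and component_vscale: "component i (vscale c F) = vscale c (component i F)"
  and component_zero: "component i 0 = 0"
  by (auto simp: component_def fun_eq_iff)

lemma component_sum: "component i (sum F I) = (\<Sum>j\<in>I. component i (F j))"
  by (induction I rule: infinite_finite_induct)
     (simp_all only: sum.infinite sum.empty sum.insert component_zero component_add not_False_eq_True)

lemma embed_add: "embed i (f + g) = embed i f + embed i g"
  and embed_diff: "embed i (f - g) = embed i f - embed i g"
  and embed_vscale: "embed i (vscale c f) = vscale c (embed i f)"
  and embed_zero: "embed i 0 = 0"
  and component_emb: "component i (embed j f) = (if i = j then f else 0)"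
  and delta_emb: "delta (x, i) = embed i (delta x)"
  by (auto simp: embed_def component_def fun_eq_iff delta_def)

lemma embed_ell2:
  assumes f: "f \<in> ell2 G" and i: "i < n" shows "embed i f \<in> ell2 (amp G n)"
  and embed_norm: "ell2_norm (amp G n) (embed i f) = ell2_norm G f"
  and inner_emb: "ell2_inner (amp G n) (embed i f) F = ell2_inner G f (component i F)"
proof -
  have inj: "inj_on (\<lambda>x. (x, i)) (carrier G)" by (auto simp: inj_on_def)
  have "(\<lambda>y. (cmod (embed i f y))\<^sup>2) summable_on (\<lambda>x. (x, i)) ` carrier G"
    unfolding summable_on_reindex[OF inj] using f by (simp add: ell2_def embed_def o_def)
  also have "?this \<longleftrightarrow> (\<lambda>y. (cmod (embed i f y))\<^sup>2) summable_on carrier (amp G n)"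
    by (rule summable_on_cong_neutral) (use i in \<open>auto simp: embed_def split: if_splits\<close>)
  finally show "embed i f \<in> ell2 (amp G n)"
    using f i by (auto simp: ell2_def) (auto simp: embed_def)
  have "(\<Sum>\<^sub>\<infinity>y\<in>carrier (amp G n). (cmod (embed i f y))\<^sup>2) = (\<Sum>\<^sub>\<infinity>y\<in>(\<lambda>x. (x, i)) ` carrier G. (cmod (embed i f y))\<^sup>2)"
    by (rule infsum_cong_neutral) (use i in \<open>auto simp: embed_def split: if_splits\<close>)
  also have "\<dots> = (\<Sum>\<^sub>\<infinity>x\<in>carrier G. (cmod (f x))\<^sup>2)"
    unfolding infsum_reindex[OF inj] by (simp add: embed_def o_def)
  finally show "ell2_norm (amp G n) (embed i f) = ell2_norm G f" by (simp add: ell2_norm_def)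
  have "ell2_inner (amp G n) (embed i f) F = (\<Sum>\<^sub>\<infinity>y\<in>(\<lambda>x. (x, i)) ` carrier G. embed i f y * cnj (F y))"
    unfolding ell2_inner_def
    by (rule infsum_cong_neutral) (use i in \<open>auto simp: embed_def split: if_splits\<close>)
  also have "\<dots> = ell2_inner G f (component i F)"
    unfolding infsum_reindex[OF inj] ell2_inner_def by (simp add: embed_def component_def o_def)
  finally show "ell2_inner (amp G n) (embed i f) F = ell2_inner G f (component i F)" .
qed

lemma component_ell2:
  assumes F: "F \<in> ell2 (amp G n)" shows "component i F \<in> ell2 G" "ell2_norm G (component i F) \<le> ell2_norm (amp G n) F"
proof -
  have b: "(\<Sum>x\<in>A. (cmod (component i F x))\<^sup>2) \<le> (ell2_norm (amp G n) F)\<^sup>2" if A: "finite A" "A \<subseteq> carrier G" for A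
  proof (cases "i < n")
    case True
    have "(\<Sum>x\<in>A. (cmod (component i F x))\<^sup>2) = (\<Sum>y\<in>(\<lambda>x. (x, i)) ` A. (cmod (F y))\<^sup>2)"
      by (subst sum.reindex) (auto simp: inj_on_def component_def)
    also have "\<dots> \<le> (ell2_norm (amp G n) F)\<^sup>2"
      by (rule ell2_finite_sum_le[OF F]) (use A True in auto)
    finally show ?thesis .
  next
    case False
    then have "component i F x = 0" for x using ell2_zero_off[OF F] by (auto simp: component_def)
    then show ?thesis by simp
  qed
  have "component i F x = 0" if "x \<notin> carrier G" for x using ell2_zero_off[OF F] that by (auto simp: component_def)
  from ell2_bound[OF this ell2_norm_nonneg b]
  show "component i F \<in> ell2 G" "ell2_norm G (component i F) \<le> ell2_norm (amp G n) F" by auto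
qed

lemma amp_decomp:
  assumes F: "F \<in> ell2 (amp G n)" shows "F = (\<Sum>i<n. embed i (component i F))"
proof -
  have "F (x, j) = (\<Sum>i<n. embed i (component i F) (x, j))" for x j
    using ell2_zero_off[OF F, of "(x,j)"] by (auto simp: embed_def component_def)
  moreover have "(\<Sum>i\<in>I. embed i (component i F)) y = (\<Sum>i\<in>I. embed i (component i F) y)" for I y
    by (induction I rule: infinite_finite_induct) auto
  ultimately show ?thesis by (auto simp: fun_eq_iff)
qed

lemma amp_eqI: "F \<in> ell2 (amp G n) \<Longrightarrow> H \<in> ell2 (amp G n) \<Longrightarrow> (\<And>i. i < n \<Longrightarrow> component i F = component i H) \<Longrightarrow> F = H"
  by (subst amp_decomp, assumption, subst (2) amp_decomp, assumption) simp

lemma amp_inner: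
  assumes "F \<in> ell2 (amp G n)" "H \<in> ell2 (amp G n)"
  shows "ell2_inner (amp G n) F H = (\<Sum>i<n. ell2_inner G (component i F) (component i H))"
proof -
  have "ell2_inner (amp G n) F H = ell2_inner (amp G n) (\<Sum>i<n. embed i (component i F)) H"
    using amp_decomp[OF assms(1)] by simp
  also have "\<dots> = (\<Sum>i<n. ell2_inner G (component i F) (component i H))"
    using assms component_ell2(1)[OF assms(1)]
    by (subst ell2_inner_sum_left) (auto intro!: embed_ell2 sum.cong inner_emb)
  finally show ?thesis .
qed

lemma inner_emb': "i < n \<Longrightarrow> f \<in> ell2 G \<Longrightarrow> ell2_inner (amp G n) F (embed i f) = ell2_inner G (component i F) f"
  by (metis ell2_inner_cnj inner_emb)

text \<open>The operator matrix whose only possibly nonzero entry is \<open>T\<close>, in row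
  \<open>i\<close> and column \<open>j\<close>.\<close>

definition entry_op :: "('g, 'm) monoid_scheme \<Rightarrow> nat \<Rightarrow> nat \<Rightarrow> nat \<Rightarrow> 'g oper \<Rightarrow> ('g \<times> nat) oper" where
  "entry_op G n i j T F = (if F \<in> ell2 (amp G n) then embed i (T (component j F)) else 0)"

lemma entry_op_bop:
  assumes T: "T \<in> bounded_ops G" and i: "i < n" shows "entry_op G n i j T \<in> bounded_ops (amp G n)"
proof -
  obtain C where C: "C > 0" "\<And>f. f \<in> ell2 G \<Longrightarrow> ell2_norm G (T f) \<le> C * ell2_norm G f"
    using bounded_op_bound[OF T] by blast
  note c = component_ell2[where G=G and n=n and i=j]
  show ?thesis
  proof (rule bopI[where C=C])
    fix F assume F: "F \<in> ell2 (amp G n)"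
    show "entry_op G n i j T F \<in> ell2 (amp G n)" using F c[OF F] T i by (auto simp: entry_op_def intro!: embed_ell2)
    show "entry_op G n i j T (vscale a F) = vscale a (entry_op G n i j T F)" for a
      using F by (simp only: entry_op_def ell2_vscale[OF F] if_True component_vscale bounded_op_scale[OF T c(1)[OF F]] embed_vscale)
    have "ell2_norm (amp G n) (entry_op G n i j T F) = ell2_norm G (T (component j F))"
      using F c[OF F] T i by (simp add: entry_op_def embed_norm bounded_op_ell2)
    also have "\<dots> \<le> C * ell2_norm G (component j F)" by (rule C(2)[OF c(1)[OF F]])
    also have "\<dots> \<le> C * ell2_norm (amp G n) F" using C(1) c(2)[OF F] by simp
    finally show "ell2_norm (amp G n) (entry_op G n i j T F) \<le> C * ell2_norm (amp G n) F" .
    fix H assume H: "H \<in> ell2 (amp G n)"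
    show "entry_op G n i j T (F + H) = entry_op G n i j T F + entry_op G n i j T H"
      using F H by (simp only: entry_op_def ell2_add[OF F H] if_True component_add bounded_op_add[OF T c(1)[OF F] c(1)[OF H]] embed_add)
  qed (simp add: entry_op_def)
qed

text \<open>The amplification of \<open>T\<close>, acting on each of the \<open>n\<close> copies
  separately.\<close>

definition diag :: "('g, 'm) monoid_scheme \<Rightarrow> nat \<Rightarrow> 'g oper \<Rightarrow> ('g \<times> nat) oper" where
  "diag G n T = (\<Sum>i<n. entry_op G n i i T)"

lemma sum_oper_apply: "(sum T I) f = (\<Sum>i\<in>I. (T i :: 'g oper) f)"
  by (induction I rule: infinite_finite_induct) auto

lemma diag_bop [intro]: "T \<in> bounded_ops G \<Longrightarrow> diag G n T \<in> bounded_ops (amp G n)"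
  unfolding diag_def by (rule sum_bop) (auto intro: entry_op_bop)

lemma diag_apply: "F \<in> ell2 (amp G n) \<Longrightarrow> diag G n T F = (\<Sum>i<n. embed i (T (component i F)))"
  by (simp add: diag_def sum_oper_apply entry_op_def)

lemma component_sum_emb: "component i (\<Sum>j<n. embed j (f j)) = (if i < n then f i else 0)"
proof -
  have "(\<Sum>j\<in>J. component i (embed j (f j))) = (if i \<in> J then f i else 0)" if "finite J" for J
    using that by (induction J) (auto simp: component_emb)
  then show ?thesis by (simp add: component_sum)
qed

lemma component_diag: "F \<in> ell2 (amp G n) \<Longrightarrow> i < n \<Longrightarrow> component i (diag G n T F) = T (component i F)"
  by (simp add: diag_apply component_sum_emb)

lemma diag_emb: "f \<in> ell2 G \<Longrightarrow> T \<in> bounded_ops G \<Longrightarrow> i < n \<Longrightarrow> diag G n T (embed i f) = embed i (T f)"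
  by (rule amp_eqI[of _ G n]) (auto simp: component_diag embed_ell2 component_emb bounded_op_zero bounded_op_ell2 diag_bop)

lemma diag_adj: "T \<in> bounded_ops G \<Longrightarrow> adj (amp G n) (diag G n T) = diag G n (adj G T)"
proof -
  assume T: "T \<in> bounded_ops G"
  show ?thesis
  proof (rule adj_eqI[OF diag_bop[OF T] diag_bop[OF adj_bop[OF T]]])
  fix F H assume FH: "F \<in> ell2 (amp G n)" "H \<in> ell2 (amp G n)"
  then show "ell2_inner (amp G n) (diag G n T F) H = ell2_inner (amp G n) F (diag G n (adj G T) H)"
    using T bounded_op_ell2[OF diag_bop[OF T] FH(1)] bounded_op_ell2[OF diag_bop[OF adj_bop[OF T]] FH(2)]
    by (subst (1 2) amp_inner) (simp_all add: component_diag adj_inner component_ell2)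
qed
qed

definition entry :: "('g, 'm) monoid_scheme \<Rightarrow> nat \<Rightarrow> nat \<Rightarrow> ('g \<times> nat) oper \<Rightarrow> 'g oper" where
  "entry G i j Q f = (if f \<in> ell2 G then component i (Q (embed j f)) else 0)"

lemma entry_bop:
  assumes Q: "Q \<in> bounded_ops (amp G n)" and j: "j < n" shows "entry G i j Q \<in> bounded_ops G"
proof -
  obtain C where C: "C > 0" "\<And>f. f \<in> ell2 (amp G n) \<Longrightarrow> ell2_norm (amp G n) (Q f) \<le> C * ell2_norm (amp G n) f"
    using bounded_op_bound[OF Q] by blast
  note e = embed_ell2(1)[OF _ j, of _ G]
  show ?thesis
  proof (rule bopI[where C=C])
    fix f assume f: "f \<in> ell2 G"
    have Qf: "Q (embed j f) \<in> ell2 (amp G n)" using e[OF f] Q by blast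
    show "entry G i j Q f \<in> ell2 G" using f component_ell2[OF Qf] by (simp add: entry_def)
    show "entry G i j Q (vscale a f) = vscale a (entry G i j Q f)" for a
      using f by (simp only: entry_def ell2_vscale[OF f] if_True embed_vscale bounded_op_scale[OF Q e[OF f]] component_vscale)
    have "ell2_norm G (entry G i j Q f) \<le> ell2_norm (amp G n) (Q (embed j f))"
      using f component_ell2[OF Qf] by (simp add: entry_def)
    also have "\<dots> \<le> C * ell2_norm G f" using C(2)[OF e[OF f]] by (simp add: embed_norm[OF f j])
    finally show "ell2_norm G (entry G i j Q f) \<le> C * ell2_norm G f" .
    fix g assume g: "g \<in> ell2 G"
    show "entry G i j Q (f + g) = entry G i j Q f + entry G i j Q g"
      using f g by (simp only: entry_def ell2_add[OF f g] if_True embed_add bounded_op_add[OF Q e[OF f] e[OF g]] component_add)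
  qed (simp add: entry_def)
qed

text \<open>Together with \<open>entry_op_commutant\<close> this describes the commutant of the
  amplified family as the matrices with entries in the commutant of \<open>A\<close>.\<close>

lemma entry_commutant:
  assumes A: "A \<subseteq> bounded_ops G" and Q: "Q \<in> commutant (amp G n) (diag G n ` A)" and ij: "i < n" "j < n"
  shows "entry G i j Q \<in> commutant G A"
proof (rule commutantI[OF A])
  have QB: "Q \<in> bounded_ops (amp G n)" using Q commutant_bop by blast
  show "entry G i j Q \<in> bounded_ops G" by (rule entry_bop[OF QB ij(2)])
  fix U f assume U: "U \<in> A" and f: "f \<in> ell2 G"
  have UB: "U \<in> bounded_ops G" using U A by blast
  have ef: "embed j f \<in> ell2 (amp G n)" using embed_ell2(1)[OF f ij(2)] .
  have "Q (diag G n U (embed j f)) = diag G n U (Q (embed j f))" using commutantD[OF Q] U by blast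
  then show "entry G i j Q (U f) = U (entry G i j Q f)"
    using f UB ij QB ef by (simp add: entry_def diag_emb bounded_op_ell2 component_diag)
qed

lemma entry_op_commutant:
  assumes A: "A \<subseteq> bounded_ops G" and T: "T \<in> commutant G A" and ij: "i < n" "j < n"
  shows "entry_op G n i j T \<in> commutant (amp G n) (diag G n ` A)"
proof (rule commutantI)
  have TB: "T \<in> bounded_ops G" using T commutant_bop by blast
  show "diag G n ` A \<subseteq> bounded_ops (amp G n)" using A by blast
  show "entry_op G n i j T \<in> bounded_ops (amp G n)" by (rule entry_op_bop[OF TB ij(1)])
  fix U F assume "U \<in> diag G n ` A" and F: "F \<in> ell2 (amp G n)"
  then obtain V where V: "V \<in> A" "U = diag G n V" by blast
  then have VB: "V \<in> bounded_ops G" using A by blast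
  have cF: "component j F \<in> ell2 G" using component_ell2[OF F] by blast
  have DF: "diag G n V F \<in> ell2 (amp G n)" using VB F by blast
  show "entry_op G n i j T (U F) = U (entry_op G n i j T F)"
    unfolding V(2) using F DF cF VB TB ij commutantD[OF T V(1)]
    by (simp add: entry_op_def component_diag diag_emb bounded_op_ell2)
qed

section \<open>The tracial vector and the bicommutant theorem\<close>

definition rreg :: "('g, 'm) monoid_scheme \<Rightarrow> 'g \<Rightarrow> 'g oper" where
  "rreg G t = (\<lambda>f. if f \<in> ell2 G then (\<lambda>x. if x \<in> carrier G then f (x \<otimes>\<^bsub>G\<^esub> t) else 0) else 0)"

text \<open>Membership in this commutant is an algebraic condition. It is shown in
  \<open>LG_eq\<close> to describe the weak closure \<open>LG G\<close>, and most arguments about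
  \<open>LG G\<close> are carried out here.\<close>

abbreviation rcomm :: "('g, 'm) monoid_scheme \<Rightarrow> 'g oper set" where
  "rcomm G \<equiv> commutant G (rreg G ` carrier G)"

text \<open>The vector of an operator under the tracial vector \<open>delta \<one>\<close>. On
  \<open>rcomm G\<close> its values are the Fourier coefficients of \<open>T\<close> and determine
  \<open>T\<close>.\<close>

abbreviation hat :: "('g, 'm) monoid_scheme \<Rightarrow> 'g oper \<Rightarrow> 'g vec" where
  "hat G T \<equiv> T (delta \<one>\<^bsub>G\<^esub>)"

lemma vscale_sum: "vscale c (sum f I) = (\<Sum>i\<in>I. vscale c (f i))"
proof
  have *: "sum h I x = (\<Sum>i\<in>I. h i x)" for h :: "'b \<Rightarrow> 'a vec" and x
    by (induction I rule: infinite_finite_induct) auto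
  show "vscale c (sum f I) x = (\<Sum>i\<in>I. vscale c (f i)) x" for x
    by (simp only: vscale_apply * sum_distrib_left)
qed

context group
begin

section \<open>Translations, the conjugation \<open>J\<close> and the tracial vector\<close>

lemma bij_left: "s \<in> carrier G \<Longrightarrow> bij_betw (\<lambda>x. inv s \<otimes> x) (carrier G) (carrier G)"
  by (rule bij_betw_byWitness[where f'="\<lambda>x. s \<otimes> x"]) (auto simp: m_assoc[symmetric])

lemma bij_right: "t \<in> carrier G \<Longrightarrow> bij_betw (\<lambda>x. x \<otimes> t) (carrier G) (carrier G)"
  by (rule bij_betw_byWitness[where f'="\<lambda>x. x \<otimes> inv t"]) (auto simp: m_assoc)

lemma bij_inv: "bij_betw (\<lambda>x. inv x) (carrier G) (carrier G)"
  by (rule bij_betw_byWitness[where f'="\<lambda>x. inv x"]) auto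

lemma lreg_bop [intro, simp]: "s \<in> carrier G \<Longrightarrow> lreg G s \<in> bounded_ops G"
  unfolding lreg_def by (rule reindex_bop[OF bij_left])

lemma rreg_bop [intro, simp]: "s \<in> carrier G \<Longrightarrow> rreg G s \<in> bounded_ops G"
  unfolding rreg_def by (rule reindex_bop[OF bij_right])

lemma lreg_apply: "f \<in> ell2 G \<Longrightarrow> x \<in> carrier G \<Longrightarrow> lreg G s f x = f (inv s \<otimes> x)"
  by (simp add: lreg_def)

lemma rreg_apply: "f \<in> ell2 G \<Longrightarrow> x \<in> carrier G \<Longrightarrow> rreg G s f x = f (x \<otimes> s)"
  by (simp add: rreg_def)

lemma lreg_ell2 [intro]: "s \<in> carrier G \<Longrightarrow> f \<in> ell2 G \<Longrightarrow> lreg G s f \<in> ell2 G"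
  by (rule bounded_op_ell2[OF lreg_bop])

lemma rreg_ell2 [intro]: "s \<in> carrier G \<Longrightarrow> f \<in> ell2 G \<Longrightarrow> rreg G s f \<in> ell2 G"
  by (rule bounded_op_ell2[OF rreg_bop])

lemma lreg_norm: "s \<in> carrier G \<Longrightarrow> f \<in> ell2 G \<Longrightarrow> ell2_norm G (lreg G s f) = ell2_norm G f"
  by (simp add: lreg_def ell2_reindex[OF bij_left])

lemma rreg_norm: "s \<in> carrier G \<Longrightarrow> f \<in> ell2 G \<Longrightarrow> ell2_norm G (rreg G s f) = ell2_norm G f"
  by (simp add: rreg_def ell2_reindex[OF bij_right])

lemma lreg_delta: "s \<in> carrier G \<Longrightarrow> t \<in> carrier G \<Longrightarrow> lreg G s (delta t) = delta (s \<otimes> t)"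
  by (rule ell2_eqI[of _ G])
     (auto simp: lreg_ell2 delta_ell2 lreg_apply, auto simp: delta_def m_assoc[symmetric] inv_solve_left')

lemma rreg_delta: "s \<in> carrier G \<Longrightarrow> t \<in> carrier G \<Longrightarrow> rreg G s (delta t) = delta (t \<otimes> inv s)"
  by (rule ell2_eqI[of _ G])
     (auto simp: rreg_ell2 delta_ell2 rreg_apply, auto simp: delta_def m_assoc inv_solve_right')

lemma lreg_lreg: "s \<in> carrier G \<Longrightarrow> t \<in> carrier G \<Longrightarrow> f \<in> ell2 G \<Longrightarrow> lreg G s (lreg G t f) = lreg G (s \<otimes> t) f"
  by (rule ell2_eqI[of _ G]) (auto simp: lreg_ell2 lreg_apply inv_mult_group m_assoc)

lemma lreg_comp: "s \<in> carrier G \<Longrightarrow> t \<in> carrier G \<Longrightarrow> lreg G s \<circ> lreg G t = lreg G (s \<otimes> t)"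
  by (rule bounded_op_apply_inI[of _ G]) (auto simp: lreg_lreg)

lemma lreg_one: "lreg G \<one> = id_op G"
  by (rule bounded_op_apply_inI[of _ G], auto) (rule ell2_eqI[of _ G], auto simp: lreg_ell2 lreg_apply id_op_def)

lemma lreg_one_apply: "f \<in> ell2 G \<Longrightarrow> lreg G \<one> f = f"
  by (simp add: lreg_one id_op_def)

lemma lreg_inv_lreg: "s \<in> carrier G \<Longrightarrow> f \<in> ell2 G \<Longrightarrow> lreg G (inv s) (lreg G s f) = f"
  "s \<in> carrier G \<Longrightarrow> f \<in> ell2 G \<Longrightarrow> lreg G s (lreg G (inv s) f) = f"
  by (simp_all add: lreg_lreg lreg_one_apply)

lemma rreg_inv_rreg: "s \<in> carrier G \<Longrightarrow> f \<in> ell2 G \<Longrightarrow> rreg G (inv s) (rreg G s f) = f"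
  "s \<in> carrier G \<Longrightarrow> f \<in> ell2 G \<Longrightarrow> rreg G s (rreg G (inv s) f) = f"
  by (rule ell2_eqI[of _ G]; auto simp: rreg_ell2 rreg_apply m_assoc)+

lemma lreg_inner: "s \<in> carrier G \<Longrightarrow> f \<in> ell2 G \<Longrightarrow> g \<in> ell2 G \<Longrightarrow>
    ell2_inner G (lreg G s f) (lreg G s g) = ell2_inner G f g"
  by (simp add: lreg_def ell2_reindex[OF bij_left])

lemma rreg_inner: "s \<in> carrier G \<Longrightarrow> f \<in> ell2 G \<Longrightarrow> g \<in> ell2 G \<Longrightarrow>
    ell2_inner G (rreg G s f) (rreg G s g) = ell2_inner G f g"
  by (simp add: rreg_def ell2_reindex[OF bij_right])

lemma adj_lreg: "s \<in> carrier G \<Longrightarrow> adj G (lreg G s) = lreg G (inv s)"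
  by (rule adj_eqI) (auto, metis inv_closed lreg_ell2 lreg_inner lreg_inv_lreg(2))

lemma adj_rreg: "s \<in> carrier G \<Longrightarrow> adj G (rreg G s) = rreg G (inv s)"
  by (rule adj_eqI) (auto, metis inv_closed rreg_ell2 rreg_inner rreg_inv_rreg(2))

lemma rreg_set_bop: "rreg G ` carrier G \<subseteq> bounded_ops G"
  by auto

lemma rreg_set_adj: "U \<in> rreg G ` carrier G \<Longrightarrow> adj G U \<in> rreg G ` carrier G"
  by (auto simp: adj_rreg)

lemma lreg_rreg: "s \<in> carrier G \<Longrightarrow> t \<in> carrier G \<Longrightarrow> f \<in> ell2 G \<Longrightarrow> lreg G s (rreg G t f) = rreg G t (lreg G s f)"
  by (rule ell2_eqI[of _ G]) (auto simp: lreg_ell2 rreg_ell2 lreg_apply rreg_apply m_assoc)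

lemma lreg_rcomm: "s \<in> carrier G \<Longrightarrow> lreg G s \<in> rcomm G"
  by (rule commutantI[OF rreg_set_bop]) (auto simp: lreg_rreg)

lemmas rcomm_comp = commutant_comp[OF rreg_set_bop]
  and rcomm_oscale = commutant_oscale[OF rreg_set_bop]
  and rcomm_diff = commutant_diff[OF rreg_set_bop]
  and rcomm_id = commutant_id[OF rreg_set_bop]
  and rcomm_sum = commutant_sum[OF rreg_set_bop]
  and rcomm_zero = commutant_zero[OF rreg_set_bop]
  and rcomm_adj = commutant_adj[OF rreg_set_bop rreg_set_adj]

text \<open>Every basis vector is a right translate of \<open>delta \<one>\<close>, and
  \<open>T\<close> commutes with right translations. So all columns of \<open>T\<close> are
  translates of one vector and have the same norm.\<close>

lemma rcomm_delta:
  assumes T: "T \<in> rcomm G" and s: "s \<in> carrier G"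
  shows "T (delta s) = rreg G (inv s) (hat G T)"
proof -
  have "T (rreg G (inv s) (delta \<one>)) = rreg G (inv s) (hat G T)"
    using T s by (intro commutantD) auto
  then show ?thesis using s by (simp add: rreg_delta)
qed

lemma hat_ell2: "T \<in> bounded_ops G \<Longrightarrow> hat G T \<in> ell2 G"
  by auto

lemma rcomm_delta_norm:
  assumes T: "T \<in> rcomm G" and s: "s \<in> carrier G"
  shows "ell2_norm G (T (delta s)) = ell2_norm G (hat G T)"
  using rcomm_delta[OF T s] s hat_ell2[OF commutant_bop[OF T]] by (simp add: rreg_norm)

lemma conj_J_ell2 [intro]: "f \<in> ell2 G \<Longrightarrow> conj_J G f \<in> ell2 G"
  and conj_J_norm: "ell2_norm G (conj_J G f) = ell2_norm G f"
proof -
  have *: "ell2_norm G (conj_J G f) = ell2_norm G (\<lambda>x. if x \<in> carrier G then f (inv x) else 0)"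
    unfolding ell2_norm_def by (simp add: conj_J_def cong: infsum_cong)
  then show "ell2_norm G (conj_J G f) = ell2_norm G f" by (simp add: ell2_reindex[OF bij_inv])
  assume "f \<in> ell2 G"
  from ell2_reindex(1)[OF bij_inv this] show "conj_J G f \<in> ell2 G"
    by (auto simp: ell2_def conj_J_def cong: summable_on_cong)
qed

lemma conj_J_conj_J: "f \<in> ell2 G \<Longrightarrow> conj_J G (conj_J G f) = f"
  by (rule ell2_eqI[of _ G]) (auto simp: conj_J_ell2, auto simp: conj_J_def)

lemma conj_J_add: "conj_J G (f + g) = conj_J G f + conj_J G g"
  and conj_J_vscale: "conj_J G (vscale c f) = vscale (cnj c) (conj_J G f)"
  by (auto simp: conj_J_def fun_eq_iff)

lemma conj_J_inner: "f \<in> ell2 G \<Longrightarrow> g \<in> ell2 G \<Longrightarrow> ell2_inner G (conj_J G f) (conj_J G g) = ell2_inner G g f"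
proof -
  have "ell2_inner G (conj_J G f) (conj_J G g) = (\<Sum>\<^sub>\<infinity>x\<in>carrier G. cnj (f (inv x)) * g (inv x))"
    unfolding ell2_inner_def by (simp add: conj_J_def cong: infsum_cong)
  also have "\<dots> = (\<Sum>\<^sub>\<infinity>x\<in>carrier G. cnj (f x) * g x)"
    by (rule infsum_reindex_bij_betw[OF bij_inv])
  finally show ?thesis by (simp add: ell2_inner_def mult.commute)
qed

text \<open>This is the source of the trace property: as \<open>J\<close> is isometric,
  \<open>T\<close> and its adjoint have the same norm at \<open>delta \<one>\<close>. The
  coefficient of the adjoint at \<open>x\<close> is the conjugate of the matrix entry of
  \<open>T\<close> from \<open>x\<close> to the identity, which right invariance moves to the first
  column at \<open>inv x\<close>.\<close>

lemma hat_adj: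
  assumes T: "T \<in> rcomm G" shows "hat G (adj G T) = conj_J G (hat G T)"
proof (rule ell2_eqI[of _ G])
  have TB: "T \<in> bounded_ops G" using T commutant_bop by blast
  show "hat G (adj G T) \<in> ell2 G" "conj_J G (hat G T) \<in> ell2 G" using TB by auto
  fix x assume x: "x \<in> carrier G"
  have "hat G (adj G T) x = ell2_inner G (hat G (adj G T)) (delta x)"
    using TB x by (subst ell2_inner_delta) auto
  also have "\<dots> = ell2_inner G (delta \<one>) (T (delta x))"
    using TB x by (subst adj_inner') auto
  also have "\<dots> = cnj (T (delta x) \<one>)" using TB x by (subst ell2_inner_delta) auto
  also have "\<dots> = conj_J G (hat G T) x"
    using x hat_ell2[OF TB] by (simp add: rcomm_delta[OF T x] rreg_apply conj_J_def)
  finally show "hat G (adj G T) x = conj_J G (hat G T) x" .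
qed

text \<open>Approximants \<open>S\<close> of \<open>T\<close> at \<open>\<delta>\<^sub>1\<close> need not be bounded in norm, but the trace controls
  \<open>(S - T)\<^sup>* \<delta>\<^sub>t\<close> as well. Hence \<open>T\<close> commutes with whatever commutes with \<open>A\<close>, and the argument
  of the bicommutant theorem applies.\<close>

lemma vn_density:
  assumes A: "A \<subseteq> rcomm G" "id_op G \<in> A" "\<And>S T. S \<in> A \<Longrightarrow> T \<in> A \<Longrightarrow> S + T \<in> A"
    "\<And>c T. T \<in> A \<Longrightarrow> oscale c T \<in> A" "\<And>S T. S \<in> A \<Longrightarrow> T \<in> A \<Longrightarrow> S \<circ> T \<in> A"
    "\<And>T. T \<in> A \<Longrightarrow> adj G T \<in> A"
    and T: "T \<in> rcomm G" "hat G T \<in> cl G ((\<lambda>S. hat G S) ` A)"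
  shows "T \<in> wot G closure_of A"
proof -
  have AB: "A \<subseteq> bounded_ops G" using A(1) commutant_bop by blast
  have TB: "T \<in> bounded_ops G" using T commutant_bop by blast
  have "\<exists>S\<in>A. \<forall>(f,g)\<in>P. cmod (ell2_inner G (S f) g - ell2_inner G (T f) g) < e"
    if P: "finite P" "P \<subseteq> ell2 G \<times> ell2 G" and e: "e > 0" for P e
  proof -
    obtain p n where p: "P = p ` {i::nat. i < n}"
      using finite_imp_nat_seg_image_inj_on[OF P(1)] by blast
    define f where "f i = fst (p i)" for i
    define g where "g i = snd (p i)" for i
    have fg: "f i \<in> ell2 G" "g i \<in> ell2 G" if "i < n" for i
      using P(2) p that unfolding f_def g_def by (force simp: mem_Times_iff)+
    define M where "M = (\<Sum>i<n. ell2_norm G (g i)) + 1"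
    have M: "M > 0" unfolding M_def by (intro add_nonneg_pos sum_nonneg ell2_norm_nonneg) simp
    have gM: "ell2_norm G (g i) < M" if "i < n" for i
      using member_le_sum[of i "{..<n}" "\<lambda>i. ell2_norm G (g i)"] that ell2_norm_nonneg
      by (fastforce simp: M_def)
    let ?H = "amp G n"
    \<comment> \<open>The finitely many test vectors are stacked into one vector of \<open>n\<close>
      copies of the Hilbert space, so that a single \<open>S\<close> in \<open>A\<close> serves all
      of them.\<close>
    define F where "F = (\<Sum>i<n. embed i (f i))"
    have F: "F \<in> ell2 ?H" unfolding F_def by (rule ell2_sum) (auto intro: embed_ell2 fg)
    have cF: "component i F = f i" if "i < n" for i using that by (simp add: F_def component_sum_emb)
    let ?D = "diag G n"
    define W0 where "W0 = (\<lambda>S. ?D S F) ` A"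
    have DB: "?D S \<in> bounded_ops ?H" if "S \<in> A" for S using that AB by blast
    have D_eq: "?D S K = ?D S' K" if "\<And>k. k \<in> ell2 G \<Longrightarrow> S k = S' k" "K \<in> ell2 ?H" for S S' K
      using that by (simp add: diag_apply component_ell2)
    have D_add: "?D (S + S') F = ?D S F + ?D S' F" for S S'
      using F by (simp add: diag_apply embed_add sum.distrib)
    have D_sc: "?D (oscale c S) F = vscale c (?D S F)" for c S
      using F by (simp add: diag_apply oscale_apply embed_vscale vscale_sum)
    have D_comp: "?D S (?D S' K) = ?D (S \<circ> S') K" if "K \<in> ell2 ?H" "S \<in> A" "S' \<in> A" for S S' K
    proof (rule amp_eqI[of _ G n])
      have B: "?D S' K \<in> ell2 ?H" "S \<circ> S' \<in> A" using that DB A by auto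
      then show "?D S (?D S' K) \<in> ell2 ?H" "?D (S \<circ> S') K \<in> ell2 ?H" using that DB by blast+
      show "component i (?D S (?D S' K)) = component i (?D (S \<circ> S') K)" if "i < n" for i
        using that B \<open>K \<in> ell2 ?H\<close> by (simp add: component_diag)
    qed
    have W0: "lin_subspace ?H W0"
      unfolding lin_subspace_def
    proof (intro conjI ballI allI)
      show "W0 \<subseteq> ell2 ?H" unfolding W0_def using DB F by blast
      have "oscale 0 (id_op G) \<in> A" using A by blast
      moreover have "?D (oscale 0 (id_op G)) F = 0" unfolding D_sc by (simp add: vscale_def zero_fun_def)
      ultimately show "0 \<in> W0" unfolding W0_def by force
      show "x + y \<in> W0" if "x \<in> W0" "y \<in> W0" for x y
        using that A(3) unfolding W0_def by (force simp flip: D_add)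
      show "vscale c x \<in> W0" if "x \<in> W0" for x c
        using that A(4) unfolding W0_def by (force simp flip: D_sc)
    qed
    \<comment> \<open>The cyclic subspace of \<open>F\<close> under the amplified algebra; its
      projection commutes with the amplified \<open>A\<close>, and the aim is to show that it
      commutes with the amplified \<open>T\<close>.\<close>
    define W where "W = cl ?H W0"
    have W: "closed_subspace ?H W" unfolding W_def by (rule closed_subspace_cl[OF W0])
    have W0e: "W0 \<subseteq> ell2 ?H" using W0 by (simp add: lin_subspace_def)
    have inv: "?D S k \<in> W" if S: "S \<in> A" and k: "k \<in> W" for S k
      unfolding W_def
    proof (rule bounded_op_cl_invariant[OF DB[OF S] W0e _ W0e])
      show "k \<in> cl ?H W0" using k by (simp add: W_def)
      fix y assume "y \<in> W0"
      then obtain S' where S': "S' \<in> A" "y = ?D S' F" by (auto simp: W0_def)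
      then have "?D S y \<in> W0" using D_comp[OF F S S'(1)] A(5)[OF S S'(1)] by (auto simp: W0_def)
      then show "?D S y \<in> cl ?H W0" using cl_subset[OF W0e] by blast
    qed
    let ?P = "proj ?H W"
    have PB: "?P \<in> bounded_ops ?H" by (rule proj_bop[OF W])
    have "?P \<in> commutant ?H (?D ` A)"
    proof (rule proj_commutant[OF _ _ W])
      show "?D ` A \<subseteq> bounded_ops ?H" using DB by blast
      show "adj ?H U \<in> ?D ` A" if "U \<in> ?D ` A" for U using that A(6) AB by (auto simp: diag_adj)
      show "U k \<in> W" if "U \<in> ?D ` A" "k \<in> W" for U k using that inv by blast
    qed
    then have PD: "?P (?D S K) = ?D S (?P K)" if "S \<in> A" for S K using commutantD that by blast
    have Pn: "ell2_norm ?H (?P K) \<le> ell2_norm ?H K" if K: "K \<in> ell2 ?H" for K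
    proof -
      have pe: "?P K \<in> ell2 ?H" using PB K by blast
      have "(ell2_norm ?H (?P K))\<^sup>2 = cmod (ell2_inner ?H (?P K) (?P K))"
        by (simp only: ell2_inner_self[OF pe] norm_of_real) simp
      also have "ell2_inner ?H (?P K) (?P K) = ell2_inner ?H (?P K) K"
        using proj_sym[OF W pe K] proj_id[OF W proj_in[OF W K]] proj_sym[OF W K pe] ell2_inner_cnj
        by metis
      also have "cmod \<dots> \<le> ell2_norm ?H (?P K) * ell2_norm ?H K" by (rule ell2_cauchy_schwarz[OF pe K])
      finally show ?thesis using ell2_norm_nonneg[of ?H "?P K"] ell2_norm_nonneg[of ?H K]
        by (cases "ell2_norm ?H (?P K) = 0") (auto simp: power2_eq_square)
    qed
    have TD: "?D T \<in> bounded_ops ?H" using TB by blast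
    \<comment> \<open>Only matrix coefficients between basis vectors need comparison. There the
      error \<open>V = T - S\<close> meets a basis vector directly on one side and through its
      adjoint on the other, and both contributions have size at most the norm of
      \<open>hat G V\<close>.\<close>
    have comm: "?P \<circ> ?D T = ?D T \<circ> ?P"
    proof (rule bounded_op_eqI_inner[of _ ?H])
      show "?P \<circ> ?D T \<in> bounded_ops ?H" "?D T \<circ> ?P \<in> bounded_ops ?H" using PB TD by blast+
      fix u v assume u: "u \<in> carrier ?H" and v: "v \<in> carrier ?H"
      obtain s i where si: "u = (s,i)" "s \<in> carrier G" "i < n" using u by auto
      obtain t j where tj: "v = (t,j)" "t \<in> carrier G" "j < n" using v by auto
      have du: "delta u \<in> ell2 ?H" "delta v \<in> ell2 ?H" using u v by (auto simp only: delta_ell2)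
      have nd: "ell2_norm ?H (delta w) = 1" if "w \<in> carrier ?H" for w
      proof -
        have "complex_of_real ((ell2_norm ?H (delta w))\<^sup>2) = 1"
          using ell2_inner_delta(1)[of "delta w" ?H w] ell2_inner_self[of "delta w" ?H] that
          by (simp only: delta_ell2) (simp add: delta_def)
        then have "(ell2_norm ?H (delta w))\<^sup>2 = 1" using of_real_eq_1_iff by blast
        then show ?thesis using ell2_norm_nonneg[of ?H "delta w"] by (simp add: power2_eq_1_iff)
      qed
      have "cmod (ell2_inner ?H ((?P \<circ> ?D T) (delta u)) (delta v) - ell2_inner ?H ((?D T \<circ> ?P) (delta u)) (delta v)) \<le> e"
        if e: "e > 0" for e
      proof -
        obtain S where S: "S \<in> A" "ell2_norm G (hat G T - hat G S) < e/2"
          using clD[OF T(2) half_gt_zero[OF e]] by blast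
        define V where "V = T - S"
        have V: "V \<in> rcomm G" unfolding V_def using T S A(1) by (auto intro: rcomm_diff)
        have VB: "V \<in> bounded_ops G" using V commutant_bop by blast
        have SB: "S \<in> bounded_ops G" using S AB by blast
        have hV: "ell2_norm G (hat G V) < e/2" using S(2) by (simp add: V_def)
        have DV: "?D T K = ?D S K + ?D V K" if "K \<in> ell2 ?H" for K
        proof -
          have "?D T K = ?D (S + V) K" by (rule D_eq) (use that in \<open>auto simp: V_def\<close>)
          then show ?thesis using that by (simp add: diag_apply embed_add sum.distrib)
        qed
        have Pu: "?P (delta u) \<in> ell2 ?H" using PB du by blast
        have Vu: "?D V (delta u) = embed i (V (delta s))" "?D S (delta u) \<in> ell2 ?H" "?D V (delta u) \<in> ell2 ?H"
            "?D V (?P (delta u)) \<in> ell2 ?H" "?D S (?P (delta u)) \<in> ell2 ?H" 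
          using si VB SB du Pu diag_emb[of "delta s" G V i n] by (auto simp: delta_emb)
        have 1: "cmod (ell2_inner ?H (?P (?D V (delta u))) (delta v)) \<le> e/2"
        proof -
          have "cmod (ell2_inner ?H (?P (?D V (delta u))) (delta v)) \<le> ell2_norm ?H (?P (?D V (delta u))) * 1"
            using ell2_cauchy_schwarz[of "?P (?D V (delta u))" ?H "delta v"] nd[OF v] PB Vu du by auto
          also have "\<dots> \<le> ell2_norm ?H (?D V (delta u))" using Pn[OF Vu(3)] by simp
          also have "\<dots> = ell2_norm G (V (delta s))" using Vu si VB by (simp add: embed_norm bounded_op_ell2 delta_ell2)
          finally show ?thesis using hV rcomm_delta_norm[OF V si(2)] by simp
        qed
        have 2: "cmod (ell2_inner ?H (?D V (?P (delta u))) (delta v)) \<le> e/2"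
        proof -
          have Vv: "?D (adj G V) (delta v) = embed j (adj G V (delta t))"
            using tj VB diag_emb[of "delta t" G "adj G V" j n] by (auto simp: delta_emb)
          have "ell2_inner ?H (?D V (?P (delta u))) (delta v) = ell2_inner ?H (?P (delta u)) (?D (adj G V) (delta v))"
            using adj_inner[OF diag_bop[OF VB] Pu du(2)] by (simp add: diag_adj[OF VB])
          also have "cmod \<dots> \<le> ell2_norm ?H (?P (delta u)) * ell2_norm ?H (?D (adj G V) (delta v))"
            by (rule ell2_cauchy_schwarz[OF Pu]) (use VB du in blast)
          also have "\<dots> \<le> 1 * ell2_norm G (adj G V (delta t))"
            using Pn[OF du(1)] nd[OF u] tj VB unfolding Vv
            by (intro mult_mono) (auto simp: embed_norm bounded_op_ell2 delta_ell2 adj_bop ell2_norm_nonneg)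
          also have "\<dots> = ell2_norm G (hat G V)"
            using rcomm_delta_norm[OF rcomm_adj[OF _ V] tj(2)] by (simp add: hat_adj[OF V] conj_J_norm)
          finally show ?thesis using hV by simp
        qed
        have "ell2_inner ?H ((?P \<circ> ?D T) (delta u)) (delta v) - ell2_inner ?H ((?D T \<circ> ?P) (delta u)) (delta v)
          = ell2_inner ?H (?P (?D V (delta u))) (delta v) - ell2_inner ?H (?D V (?P (delta u))) (delta v)"
          unfolding o_apply DV[OF du(1)] DV[OF Pu] bounded_op_add[OF PB Vu(2,3)] PD[OF S(1)]
            ell2_inner_add_left[OF Vu(5) bounded_op_ell2[OF PB Vu(3)] du(2)] ell2_inner_add_left[OF Vu(5,4) du(2)]
          by simp
        also have "cmod \<dots> \<le> e" using 1 2 norm_triangle_ineq4[of "ell2_inner ?H (?P (?D V (delta u))) (delta v)"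
            "ell2_inner ?H (?D V (?P (delta u))) (delta v)"] by linarith
        finally show ?thesis .
      qed
      then have "cmod (ell2_inner ?H ((?P \<circ> ?D T) (delta u)) (delta v) - ell2_inner ?H ((?D T \<circ> ?P) (delta u)) (delta v)) \<le> 0"
        by (rule field_le_epsilon) simp
      then show "ell2_inner ?H ((?P \<circ> ?D T) (delta u)) (delta v) = ell2_inner ?H ((?D T \<circ> ?P) (delta u)) (delta v)"
        by simp
    qed
    have FW: "F \<in> W"
    proof -
      have "?D (id_op G) F = F"
        by (rule amp_eqI[OF bounded_op_ell2[OF diag_bop[OF id_op_bop] F] F])
           (use F in \<open>simp add: component_diag component_ell2 id_op_def\<close>)
      then have "F \<in> W0" unfolding W0_def using A(2) by force
      then show ?thesis unfolding W_def using cl_subset[OF W0e] by blast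
    qed
    \<comment> \<open>\<open>F\<close> is fixed by the projection, so commutation makes
      \<open>?D T F\<close> fixed as well: it lies in the closure of the vectors
      \<open>?D S F\<close> with \<open>S\<close> in \<open>A\<close>.\<close>
    have "?D T F = ?P (?D T F)"
      using fun_cong[OF comm, of F] proj_id[OF W FW] by simp
    then have "?D T F \<in> W" using proj_in[OF W bounded_op_ell2[OF TD F]] by simp
    then obtain y where "y \<in> W0" "ell2_norm ?H (?D T F - y) < e / M"
      using clD[of "?D T F" ?H W0 "e/M"] e M unfolding W_def by auto
    then obtain S where S: "S \<in> A" "ell2_norm ?H (?D T F - ?D S F) < e / M" by (auto simp: W0_def)
    have SB: "S \<in> bounded_ops G" using S AB by blast
    have "cmod (ell2_inner G (S (f i)) (g i) - ell2_inner G (T (f i)) (g i)) < e" if i: "i < n" for i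
    proof -
      have Se: "S (f i) \<in> ell2 G" "T (f i) \<in> ell2 G" using SB TB fg[OF i] by auto
      have "T (f i) - S (f i) = component i (?D T F - ?D S F)"
        using i F by (simp add: component_diff component_diag cF)
      then have n: "ell2_norm G (T (f i) - S (f i)) \<le> ell2_norm ?H (?D T F - ?D S F)"
        using component_ell2(2)[of "?D T F - ?D S F" G n i] SB TD DB[OF S(1)] F by (metis bounded_op_ell2 ell2_diff)
      have "cmod (ell2_inner G (S (f i)) (g i) - ell2_inner G (T (f i)) (g i)) = cmod (ell2_inner G (S (f i) - T (f i)) (g i))"
        using Se fg[OF i] by (simp only: ell2_inner_diff_left)
      also have "\<dots> \<le> ell2_norm G (S (f i) - T (f i)) * ell2_norm G (g i)"
        by (rule ell2_cauchy_schwarz) (use Se fg[OF i] in blast)+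
      also have "\<dots> \<le> ell2_norm ?H (?D T F - ?D S F) * M"
        using n gM[OF i] ell2_norm_minus_commute[of G "S (f i)" "T (f i)"]
        by (intro mult_mono) (auto simp: ell2_norm_nonneg less_imp_le)
      also have "\<dots> < e" using S(2) M by (simp add: field_simps)
      finally show ?thesis .
    qed
    then show ?thesis using S(1) unfolding p
      by (intro bexI[of _ S]) (auto simp: f_def g_def split: prod.splits; metis fst_conv snd_conv)
  qed
  then show ?thesis unfolding wot_closure_iff[OF AB] using TB by blast
qed

end

lemma adj_sum:
  assumes "\<And>i. i \<in> I \<Longrightarrow> T i \<in> bounded_ops G"
  shows "adj G (sum T I) = (\<Sum>i\<in>I. adj G (T i))"
  using assms
proof (induction I rule: infinite_finite_induct)
  have "adj G 0 = 0" by (rule adj_eqI) auto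
  then show "adj G (sum T {}) = (\<Sum>i\<in>{}. adj G (T i))"
    and "\<And>A. infinite A \<Longrightarrow> adj G (sum T A) = (\<Sum>i\<in>A. adj G (T i))" by simp_all
  fix x F assume "finite F" "x \<notin> F"
    "(\<And>i. i \<in> F \<Longrightarrow> T i \<in> bounded_ops G) \<Longrightarrow> adj G (sum T F) = (\<Sum>i\<in>F. adj G (T i))"
    "\<And>i. i \<in> insert x F \<Longrightarrow> T i \<in> bounded_ops G"
  then show "adj G (sum T (insert x F)) = (\<Sum>i\<in>insert x F. adj G (T i))"
    using adj_add[of "T x" G "sum T F"] by (simp add: sum_bop)
qed

context group
begin

section \<open>The complex group algebra and its weak closure\<close>

lemma lreg_span_rcomm: "lreg_span G \<subseteq> rcomm G"
  by (auto simp: lreg_span_def subset_iff intro!: rcomm_sum rcomm_oscale lreg_rcomm)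

lemma lreg_span_bop: "lreg_span G \<subseteq> bounded_ops G"
  using lreg_span_rcomm commutant_bop by blast

lemma lreg_span_lreg: "s \<in> carrier G \<Longrightarrow> lreg G s \<in> lreg_span G"
  unfolding lreg_span_def
  by (rule CollectI, rule exI[of _ "{s}"], rule exI[of _ "\<lambda>_. 1"]) (auto simp: oscale_def fun_eq_iff)

lemma lreg_span_oscale: "T \<in> lreg_span G \<Longrightarrow> oscale c T \<in> lreg_span G"
proof -
  assume "T \<in> lreg_span G"
  then obtain F a where F: "T = (\<Sum>s\<in>F. oscale (a s) (lreg G s))" "finite F" "F \<subseteq> carrier G"
    by (auto simp: lreg_span_def)
  have "oscale c T = (\<Sum>s\<in>F. oscale (c * a s) (lreg G s))"
  proof
    show "oscale c T f = (\<Sum>s\<in>F. oscale (c * a s) (lreg G s)) f" for f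
      unfolding F(1) oscale_apply sum_oper_apply vscale_sum
      by (intro sum.cong) (auto simp: fun_eq_iff mult.assoc)
  qed
  then show ?thesis using F by (auto simp: lreg_span_def intro!: exI[of _ F] exI[of _ "\<lambda>s. c * a s"])
qed

lemma lreg_span_add:
  assumes "S \<in> lreg_span G" "T \<in> lreg_span G" shows "S + T \<in> lreg_span G"
proof -
  obtain F a where F: "S = (\<Sum>s\<in>F. oscale (a s) (lreg G s))" "finite F" "F \<subseteq> carrier G"
    using assms(1) by (auto simp: lreg_span_def)
  obtain E b where E: "T = (\<Sum>s\<in>E. oscale (b s) (lreg G s))" "finite E" "E \<subseteq> carrier G"
    using assms(2) by (auto simp: lreg_span_def)
  define a' where "a' s = (if s \<in> F then a s else 0)" for s
  define b' where "b' s = (if s \<in> E then b s else 0)" for s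
  have z: "oscale 0 X = (0 :: 'a oper)" for X by (auto simp: oscale_def fun_eq_iff)
  have "S = (\<Sum>s\<in>F \<union> E. oscale (a' s) (lreg G s))"
    unfolding F(1) using F E by (intro sum.mono_neutral_cong_left) (auto simp: a'_def z)
  moreover have "T = (\<Sum>s\<in>F \<union> E. oscale (b' s) (lreg G s))"
    unfolding E(1) using F E by (intro sum.mono_neutral_cong_left) (auto simp: b'_def z)
  ultimately have "S + T = (\<Sum>s\<in>F \<union> E. oscale (a' s) (lreg G s) + oscale (b' s) (lreg G s))"
    by (simp only: sum.distrib)
  also have "\<dots> = (\<Sum>s\<in>F \<union> E. oscale (a' s + b' s) (lreg G s))"
    by (intro sum.cong) (auto simp: oscale_def fun_eq_iff algebra_simps)
  finally show ?thesis using F E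
    by (auto simp: lreg_span_def intro!: exI[of _ "F \<union> E"] exI[of _ "\<lambda>s. a' s + b' s"])
qed

lemma lreg_span_sum: "finite I \<Longrightarrow> (\<And>i. i \<in> I \<Longrightarrow> T i \<in> lreg_span G) \<Longrightarrow> sum T I \<in> lreg_span G"
proof (induction I rule: finite_induct)
  case empty
  have "oscale 0 (lreg G \<one>) = 0" by (auto simp: oscale_def fun_eq_iff)
  then show ?case using lreg_span_oscale[OF lreg_span_lreg[OF one_closed], of 0] by (simp only: sum.empty)
next
  case (insert x F)
  then show ?case unfolding sum.insert[OF insert(1,2)] by (intro lreg_span_add) auto
qed

lemma lreg_span_comp:
  assumes "S \<in> lreg_span G" "T \<in> lreg_span G" shows "S \<circ> T \<in> lreg_span G"
proof -
  obtain F a where F: "S = (\<Sum>s\<in>F. oscale (a s) (lreg G s))" "finite F" "F \<subseteq> carrier G"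
    using assms(1) by (auto simp: lreg_span_def)
  obtain E b where E: "T = (\<Sum>s\<in>E. oscale (b s) (lreg G s))" "finite E" "E \<subseteq> carrier G"
    using assms(2) by (auto simp: lreg_span_def)
  have "S \<circ> T = (\<Sum>s\<in>F. \<Sum>t\<in>E. oscale (a s * b t) (lreg G (s \<otimes> t)))"
  proof (rule bounded_op_apply_inI[of _ G])
    show "S \<circ> T \<in> bounded_ops G" using assms lreg_span_bop by blast
    show "(\<Sum>s\<in>F. \<Sum>t\<in>E. oscale (a s * b t) (lreg G (s \<otimes> t))) \<in> bounded_ops G"
      using F E by (intro sum_bop oscale_bop lreg_bop) auto
    fix f assume f: "f \<in> ell2 G"
    have 1: "T f = (\<Sum>t\<in>E. vscale (b t) (lreg G t f))" by (simp add: E(1) sum_oper_apply oscale_apply)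
    have 2: "vscale (a s) (lreg G s (T f)) = (\<Sum>t\<in>E. vscale (a s * b t) (lreg G (s \<otimes> t) f))" if s: "s \<in> F" for s
    proof -
      have sc: "s \<in> carrier G" using s F by auto
      have "lreg G s (T f) = (\<Sum>t\<in>E. lreg G s (vscale (b t) (lreg G t f)))"
        unfolding 1 by (rule bounded_op_sum[OF lreg_bop[OF sc]]) (use E f in auto)
      also have "\<dots> = (\<Sum>t\<in>E. vscale (b t) (lreg G (s \<otimes> t) f))"
        by (intro sum.cong refl, subst bounded_op_scale[OF lreg_bop[OF sc]]) (use E f sc in \<open>auto simp: lreg_lreg\<close>)
      finally show ?thesis
        by (simp only: vscale_sum) (intro sum.cong, auto simp: fun_eq_iff mult.assoc)
    qed
    have "(S \<circ> T) f = (\<Sum>s\<in>F. vscale (a s) (lreg G s (T f)))" by (simp add: F(1) sum_oper_apply oscale_apply)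
    also have "\<dots> = (\<Sum>s\<in>F. \<Sum>t\<in>E. vscale (a s * b t) (lreg G (s \<otimes> t) f))"
      by (intro sum.cong refl 2)
    finally show "(S \<circ> T) f = (\<Sum>s\<in>F. \<Sum>t\<in>E. oscale (a s * b t) (lreg G (s \<otimes> t))) f"
      by (simp only: sum_oper_apply oscale_apply)
  qed
  also have "\<dots> \<in> lreg_span G"
    using F E by (intro lreg_span_sum lreg_span_oscale lreg_span_lreg) auto
  finally show ?thesis .
qed

lemma lreg_span_adj: "T \<in> lreg_span G \<Longrightarrow> adj G T \<in> lreg_span G"
proof -
  assume "T \<in> lreg_span G"
  then obtain F a where F: "T = (\<Sum>s\<in>F. oscale (a s) (lreg G s))" "finite F" "F \<subseteq> carrier G"
    by (auto simp: lreg_span_def)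
  have "adj G T = (\<Sum>s\<in>F. oscale (cnj (a s)) (lreg G (inv s)))"
    unfolding F(1) using F by (subst adj_sum) (auto simp: adj_oscale adj_lreg subset_iff intro!: sum.cong)
  also have "\<dots> \<in> lreg_span G"
    using F by (intro lreg_span_sum lreg_span_oscale lreg_span_lreg) auto
  finally show ?thesis .
qed

text \<open>Commutation with right translations survives weak limits. Conversely, truncating
  \<open>hat G T\<close> gives elements of the span close to \<open>T\<close> at
  \<open>delta \<one>\<close>, and \<open>vn_density\<close> turns closeness at this one vector into
  weak approximation.\<close>

lemma LG_eq: "LG G = rcomm G"
proof
  show "LG G \<subseteq> rcomm G"
  proof
    fix T assume T: "T \<in> LG G"
    show "T \<in> rcomm G"
    proof (rule commutantI[OF rreg_set_bop])
      show "T \<in> bounded_ops G" using T wot_closure_bop unfolding LG_def by blast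
      fix U f assume U: "U \<in> rreg G ` carrier G" and f: "f \<in> ell2 G"
      show "T (U f) = U (T f)"
        by (rule wot_commute[OF lreg_span_bop _ _ T[unfolded LG_def] f])
           (use U lreg_span_rcomm in \<open>auto intro: commutantD\<close>)
    qed
  qed
  show "rcomm G \<subseteq> LG G"
  proof
    fix T assume T: "T \<in> rcomm G"
    have TB: "T \<in> bounded_ops G" using T commutant_bop by blast
    have "hat G T \<in> cl G ((\<lambda>S. hat G S) ` lreg_span G)"
    proof -
      have "\<exists>s\<in>(\<lambda>S. hat G S) ` lreg_span G. ell2_norm G (hat G T - s) < e" if e: "e > 0" for e
      proof -
        obtain F where F: "finite F" "F \<subseteq> carrier G"
          "ell2_norm G (hat G T - (\<Sum>x\<in>F. vscale (hat G T x) (delta x))) < e"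
          using ell2_finite_approx[OF hat_ell2[OF TB] e] by blast
        let ?S = "\<Sum>x\<in>F. oscale (hat G T x) (lreg G x)"
        have S: "?S \<in> lreg_span G" using F
          by (intro lreg_span_sum lreg_span_oscale lreg_span_lreg) auto
        have eq: "hat G ?S = (\<Sum>x\<in>F. vscale (hat G T x) (delta x))"
          unfolding sum_oper_apply oscale_apply using F by (intro sum.cong) (auto simp: lreg_delta)
        show ?thesis using F(3) unfolding eq[symmetric] 
          by (rule bexI[where P="\<lambda>s. ell2_norm G (hat G T - s) < e"]) (rule imageI[OF S])
      qed
      then show ?thesis using hat_ell2[OF TB] by (auto simp: cl_def)
    qed
    moreover have "id_op G \<in> lreg_span G" using lreg_span_lreg[of \<one>] by (simp add: lreg_one)
    ultimately show "T \<in> LG G" unfolding LG_def using T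
      by (intro vn_density lreg_span_rcomm lreg_span_add lreg_span_oscale lreg_span_comp lreg_span_adj)
  qed
qed

text \<open>Membership of an operator becomes a question about one vector. This is how a translation
  \<open>lreg G g\<close> is placed in \<open>M\<close>, and how \<open>M\<close> is placed in every
  algebra containing the translations by its subgroup.\<close>

lemma vn_subalgebra_memI:
  assumes M: "von_neumann_subalgebra G M" and T: "T \<in> LG G" "hat G T \<in> cl G ((\<lambda>S. hat G S) ` M)"
  shows "T \<in> M"
proof -
  have "T \<in> wot G closure_of M"
    by (rule vn_density)
       (use M T in \<open>auto simp: von_neumann_subalgebra_def von_neumann_algebra_def LG_eq\<close>)
  then show ?thesis using M
    by (simp add: von_neumann_subalgebra_def von_neumann_algebra_def closure_of_closedin)
qed

end

section \<open>Finiteness\<close>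

lemma entry_adj:
  assumes Q: "Q \<in> bounded_ops (amp G n)" and ij: "i < n" "j < n"
  shows "entry G j i (adj (amp G n) Q) = adj G (entry G i j Q)"
proof (rule adj_eqI[symmetric])
  fix f g assume fg: "f \<in> ell2 G" "g \<in> ell2 G"
  have e: "embed j f \<in> ell2 (amp G n)" "embed i g \<in> ell2 (amp G n)" using embed_ell2(1) fg ij by blast+
  have "ell2_inner G (entry G i j Q f) g = ell2_inner (amp G n) (Q (embed j f)) (embed i g)"
    using fg ij by (simp add: entry_def inner_emb')
  also have "\<dots> = ell2_inner (amp G n) (embed j f) (adj (amp G n) Q (embed i g))" by (rule adj_inner[OF Q e])
  also have "\<dots> = ell2_inner G f (entry G j i (adj (amp G n) Q) g)" using fg ij by (simp add: entry_def inner_emb)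
  finally show "ell2_inner G (entry G i j Q f) g = ell2_inner G f (entry G j i (adj (amp G n) Q) g)" .
qed (use Q ij in \<open>auto intro!: entry_bop\<close>)

text \<open>Powers start from \<open>id_op G\<close> and not from the identity function, so that the
  zeroth power also vanishes off the Hilbert space and counts as a bounded operator.\<close>

primrec op_power :: "('g, 'm) monoid_scheme \<Rightarrow> 'g oper \<Rightarrow> nat \<Rightarrow> 'g oper" where
  "op_power G a 0 = id_op G"
| "op_power G a (Suc k) = a \<circ> op_power G a k"

lemma op_power_commutant: "A \<subseteq> bounded_ops G \<Longrightarrow> a \<in> commutant G A \<Longrightarrow> op_power G a k \<in> commutant G A"
  by (induction k) (simp_all add: commutant_id commutant_comp)

lemma op_power_bop: "a \<in> bounded_ops G \<Longrightarrow> op_power G a k \<in> bounded_ops G"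
  by (induction k) auto

lemma id_op_apply: "f \<in> ell2 G \<Longrightarrow> id_op G f = f"
  by (simp add: id_op_def)

lemma id_op_comp: "T \<in> bounded_ops G \<Longrightarrow> id_op G \<circ> T = T" "T \<in> bounded_ops G \<Longrightarrow> T \<circ> id_op G = T"
  by (rule bounded_op_apply_inI[of _ G]; simp add: comp_bop id_op_apply bounded_op_ell2)+

lemma op_power_add: "a \<in> bounded_ops G \<Longrightarrow> op_power G a (k + l) = op_power G a k \<circ> op_power G a l"
  by (induction k) (simp_all add: id_op_comp op_power_bop comp_assoc)

lemma op_power_Suc_right: "a \<in> bounded_ops G \<Longrightarrow> op_power G a (Suc k) = op_power G a k \<circ> a"
  using op_power_add[of a G k 1] by (simp add: id_op_comp)

lemma op_power_adj: "a \<in> bounded_ops G \<Longrightarrow> adj G a = a \<Longrightarrow> adj G (op_power G a k) = op_power G a k"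
proof (induction k)
  case (Suc k)
  then show ?case using op_power_Suc_right[of a G k] by (simp only: adj_comp op_power_bop op_power.simps)
qed (simp add: adj_id)

lemma adj_contraction:
  assumes T: "T \<in> bounded_ops G" and c: "\<And>f. f \<in> ell2 G \<Longrightarrow> ell2_norm G (T f) \<le> ell2_norm G f" and f: "f \<in> ell2 G"
  shows "ell2_norm G (adj G T f) \<le> ell2_norm G f"
proof -
  have e: "adj G T f \<in> ell2 G" using T f by blast
  have "of_real ((ell2_norm G (adj G T f))\<^sup>2) = ell2_inner G (T (adj G T f)) f"
    using adj_inner[OF T e f] ell2_inner_self[OF e] by simp
  then have "(ell2_norm G (adj G T f))\<^sup>2 = cmod (ell2_inner G (T (adj G T f)) f)"
    by (metis abs_power2 norm_of_real real_norm_def)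
  also have "\<dots> \<le> ell2_norm G (T (adj G T f)) * ell2_norm G f"
    by (rule ell2_cauchy_schwarz) (use T e f in auto)
  also have "\<dots> \<le> ell2_norm G (adj G T f) * ell2_norm G f"
    using c[OF e] by (simp add: mult_right_mono ell2_norm_nonneg)
  finally show ?thesis
    using ell2_norm_nonneg[of G "adj G T f"] ell2_norm_nonneg[of G f]
    by (cases "ell2_norm G (adj G T f) = 0") (auto simp: power2_eq_square)
qed

text \<open>Expanding the square yields minus twice the squared norm of \<open>T f\<close> plus that
  of \<open>adj G T (T f)\<close>; since the adjoint is a contraction too, the latter absorbs at
  most one of the two copies.\<close>

lemma defect_contraction:
  assumes T: "T \<in> bounded_ops G" and c: "\<And>f. f \<in> ell2 G \<Longrightarrow> ell2_norm G (T f) \<le> ell2_norm G f" and f: "f \<in> ell2 G"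
  shows "(ell2_norm G ((id_op G - (adj G T \<circ> T)) f))\<^sup>2 \<le> (ell2_norm G f)\<^sup>2 - (ell2_norm G (T f))\<^sup>2"
proof -
  have e: "T f \<in> ell2 G" "adj G T (T f) \<in> ell2 G" using T f by blast+
  have eq: "(id_op G - (adj G T \<circ> T)) f = f - adj G T (T f)" using f by (simp add: id_op_def)
  have "(ell2_norm G ((id_op G - (adj G T \<circ> T)) f))\<^sup>2
    = (ell2_norm G f)\<^sup>2 - 2 * Re (ell2_inner G f (adj G T (T f))) + (ell2_norm G (adj G T (T f)))\<^sup>2"
    unfolding eq by (rule ell2_norm_sq_diff[OF f e(2)])
  also have "ell2_inner G f (adj G T (T f)) = of_real ((ell2_norm G (T f))\<^sup>2)"
    using adj_inner[OF T f e(1)] ell2_inner_self[OF e(1)] by simp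
  also have "(ell2_norm G (adj G T (T f)))\<^sup>2 \<le> (ell2_norm G (T f))\<^sup>2"
    using adj_contraction[OF T c e(1)] by (simp add: power_mono ell2_norm_nonneg)
  finally show ?thesis by (simp only: Re_complex_of_real) linarith
qed

lemma lin_subspace_range:
  assumes T: "T \<in> bounded_ops G" shows "lin_subspace G (T ` ell2 G)"
  unfolding lin_subspace_def
proof (intro conjI ballI allI)
  show "T ` ell2 G \<subseteq> ell2 G" using T by blast
  show "0 \<in> T ` ell2 G" using bounded_op_zero[OF T] by (metis ell2_zero imageI)
  fix x assume "x \<in> T ` ell2 G"
  then obtain f where f: "f \<in> ell2 G" "x = T f" by blast
  show "vscale c x \<in> T ` ell2 G" for c
    unfolding f(2) bounded_op_scale[OF T f(1), symmetric] using f(1) by blast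
  fix y assume "y \<in> T ` ell2 G"
  then obtain g where g: "g \<in> ell2 G" "y = T g" by blast
  show "x + y \<in> T ` ell2 G"
    unfolding f(2) g(2) bounded_op_add[OF T f(1) g(1), symmetric] using f(1) g(1) by blast
qed

text \<open>Powers of the defect operator replace the functional calculus of \<open>T\<^sup>* T\<close>.\<close>

lemma defect_powers_tendsto:
  assumes T: "T \<in> bounded_ops G" and c: "\<And>f. f \<in> ell2 G \<Longrightarrow> ell2_norm G (T f) \<le> ell2_norm G f"
    and inj: "\<And>f. f \<in> ell2 G \<Longrightarrow> T f = 0 \<Longrightarrow> f = 0" and f: "f \<in> ell2 G"
  shows "(\<lambda>k. ell2_norm G (op_power G (id_op G - (adj G T \<circ> T)) k f)) \<longlonglongrightarrow> 0"
proof -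
  define a where "a = id_op G - (adj G T \<circ> T)"
  have aB: "a \<in> bounded_ops G" using T unfolding a_def by blast
  let ?p = "\<lambda>k f. op_power G a k f"
  have pe: "?p k g \<in> ell2 G" if "g \<in> ell2 G" for k g using op_power_bop[OF aB] that by blast
  have a: "(ell2_norm G (a g))\<^sup>2 \<le> (ell2_norm G g)\<^sup>2 - (ell2_norm G (T g))\<^sup>2" if "g \<in> ell2 G" for g
    unfolding a_def by (rule defect_contraction[OF T c that])
  have step: "(ell2_norm G (?p (Suc k) g))\<^sup>2 \<le> (ell2_norm G (?p k g))\<^sup>2 - (ell2_norm G (T (?p k g)))\<^sup>2"
    if "g \<in> ell2 G" for k g using a[OF pe[OF that]] by simp
  have contr: "ell2_norm G (?p k g) \<le> ell2_norm G g" if g: "g \<in> ell2 G" for k g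
  proof (induction k)
    case 0 then show ?case using g by (simp add: id_op_def)
  next
    case (Suc k)
    have "(ell2_norm G (?p (Suc k) g))\<^sup>2 \<le> (ell2_norm G (?p k g))\<^sup>2"
      using step[OF g, of k] zero_le_power2[of "ell2_norm G (T (?p k g))"] by linarith
    then have "ell2_norm G (?p (Suc k) g) \<le> ell2_norm G (?p k g)"
      by (rule power2_le_imp_le) (rule ell2_norm_nonneg)
    then show ?case using Suc by simp
  qed
  \<comment> \<open>The squared norms of the successive powers decrease, hence converge, and each
    decrement dominates the squared norm of \<open>T (?p k g)\<close>.\<close>
  have Tp: "(\<lambda>k. ell2_norm G (T (?p k g))) \<longlonglongrightarrow> 0" if g: "g \<in> ell2 G" for g
  proof -
    define u where "u k = (ell2_norm G (?p k g))\<^sup>2" for k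
    have "decseq u"
    proof (rule decseq_SucI)
      fix k show "u (Suc k) \<le> u k"
        using step[OF g, of k] zero_le_power2[of "ell2_norm G (T (?p k g))"] unfolding u_def by linarith
    qed
    moreover have "0 \<le> u k" for k by (simp add: u_def)
    ultimately obtain L where L: "u \<longlonglongrightarrow> L" using decseq_convergent[of u 0] by blast
    have "(\<lambda>k. u k - u (Suc k)) \<longlonglongrightarrow> L - L"
      by (intro tendsto_diff L LIMSEQ_Suc)
    then have d: "(\<lambda>k. u k - u (Suc k)) \<longlonglongrightarrow> 0" by simp
    have "(\<lambda>k. (ell2_norm G (T (?p k g)))\<^sup>2) \<longlonglongrightarrow> 0"
    proof (rule tendsto_sandwich[OF _ _ tendsto_const d])
      show "\<forall>\<^sub>F k in sequentially. (ell2_norm G (T (?p k g)))\<^sup>2 \<le> u k - u (Suc k)"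
      proof (rule always_eventually, rule allI)
        fix k show "(ell2_norm G (T (?p k g)))\<^sup>2 \<le> u k - u (Suc k)"
          using step[OF g, of k] by (simp add: u_def)
      qed
    qed simp
    from tendsto_real_sqrt[OF this] show ?thesis by (simp add: ell2_norm_nonneg)
  qed
  \<comment> \<open>The range of \<open>adj G T \<circ> T\<close> is dense because \<open>T\<close>
    is injective. On it the powers tend to 0: they commute with this product, and \<open>Tp\<close>
    applies to the preimage. Contractivity extends the convergence to the closure.\<close>
  define S where "S = (\<lambda>g. adj G T (T g)) ` ell2 G"
  have TT: "adj G T \<circ> T \<in> bounded_ops G" using T by blast
  have "lin_subspace G S" unfolding S_def using lin_subspace_range[OF TT] by (simp add: o_def)
  moreover have "g = 0" if g: "g \<in> ell2 G" "\<forall>s\<in>S. ell2_inner G g s = 0" for g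
  proof (rule inj[OF g(1)])
    have Tg: "T g \<in> ell2 G" using T g by blast
    have "ell2_inner G g (adj G T (T g)) = 0" using g by (auto simp: S_def)
    then have "ell2_norm G (T g) = 0" using adj_inner[OF T g(1) Tg] ell2_inner_self[OF Tg] by simp
    then show "T g = 0" using ell2_norm_zero_iff[OF Tg] by simp
  qed
  ultimately have cl: "cl G S = ell2 G" by (rule cl_full)
  have comm: "a \<circ> (adj G T \<circ> T) = (adj G T \<circ> T) \<circ> a"
  proof (rule bounded_op_apply_inI[of _ G])
    fix h assume h: "h \<in> ell2 G"
    have e: "(adj G T \<circ> T) h \<in> ell2 G" using TT h by (rule bounded_op_ell2)
    have aap: "a x = x - (adj G T \<circ> T) x" if "x \<in> ell2 G" for x
      unfolding a_def minus_apply id_op_apply[OF that] ..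
    show "(a \<circ> (adj G T \<circ> T)) h = ((adj G T \<circ> T) \<circ> a) h"
      unfolding o_apply[of a] o_apply[of "adj G T \<circ> T" a] aap[OF e] aap[OF h] bounded_op_diff[OF TT h e] ..
  qed (use aB TT in blast)+
  have commp: "?p k (adj G T (T h)) = adj G T (T (?p k h))" if h: "h \<in> ell2 G" for k h
  proof (induction k)
    case 0 then show ?case using TT h T by (simp add: id_op_def bounded_op_ell2 adj_bop)
  next
    case (Suc k)
    then show ?case using fun_cong[OF comm, of "?p k h"] by simp
  qed
  have "\<exists>N. \<forall>k\<ge>N. ell2_norm G (?p k f) < e" if e: "e > 0" for e
  proof -
    obtain s where s: "s \<in> S" "ell2_norm G (f - s) < e/2"
      using clD[of f G S, OF _ half_gt_zero[OF e]] cl f by auto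
    obtain h where h: "h \<in> ell2 G" "s = adj G T (T h)" using s by (auto simp: S_def)
    have se: "s \<in> ell2 G" using h T by blast
    obtain N where N: "\<And>k. k \<ge> N \<Longrightarrow> ell2_norm G (T (?p k h)) < e/2"
      using order_tendstoD(2)[OF Tp[OF h(1)] half_gt_zero[OF e]] unfolding eventually_sequentially by blast
    have "ell2_norm G (?p k f) < e" if k: "k \<ge> N" for k
    proof -
      have fs: "f - s \<in> ell2 G" using f se by blast
      have "?p k f = ?p k ((f - s) + s)" by simp
      also have "\<dots> = ?p k (f - s) + ?p k s" by (rule bounded_op_add[OF op_power_bop[OF aB] fs se])
      finally have "ell2_norm G (?p k f) \<le> ell2_norm G (?p k (f - s)) + ell2_norm G (?p k s)"
        using ell2_norm_triangle[OF pe[OF fs] pe[OF se]] by simp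
      also have "ell2_norm G (?p k (f - s)) \<le> ell2_norm G (f - s)" by (rule contr) (use f se in blast)
      also have "ell2_norm G (?p k s) \<le> ell2_norm G (T (?p k h))"
        unfolding h(2) commp[OF h(1)] using adj_contraction[OF T c] T pe[OF h(1)] by blast
      finally show ?thesis using s(2) N[OF k] by linarith
    qed
    then show ?thesis by blast
  qed
  then show ?thesis unfolding LIMSEQ_iff a_def by (simp add: ell2_norm_nonneg)
qed

section \<open>The trace on matrices over the group von Neumann algebra\<close>

context group
begin

text \<open>By \<open>acomm_entry\<close> and \<open>acomm_entry_op\<close> these are the
  \<open>n\<close> by \<open>n\<close> matrices over \<open>rcomm G\<close>, realised as
  operators.\<close>

abbreviation acomm :: "nat \<Rightarrow> ('a \<times> nat) oper set" where
  "acomm n \<equiv> commutant (amp G n) (diag G n ` rreg G ` carrier G)"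

lemma diag_rreg_bop: "diag G n ` rreg G ` carrier G \<subseteq> bounded_ops (amp G n)"
  by auto

lemma diag_rreg_adj: "U \<in> diag G n ` rreg G ` carrier G \<Longrightarrow> adj (amp G n) U \<in> diag G n ` rreg G ` carrier G"
  by (auto simp: diag_adj adj_rreg)

lemmas acomm_entry = entry_commutant[OF rreg_set_bop]
  and acomm_entry_op = entry_op_commutant[OF rreg_set_bop]
  and acomm_adj = commutant_adj[OF diag_rreg_bop diag_rreg_adj]
  and acomm_comp = commutant_comp[OF diag_rreg_bop]
  and acomm_diff = commutant_diff[OF diag_rreg_bop]
  and acomm_add = commutant_add[OF diag_rreg_bop]
  and acomm_id = commutant_id[OF diag_rreg_bop]
  and acomm_oscale = commutant_oscale[OF diag_rreg_bop]
  and acomm_op_power = op_power_commutant[OF diag_rreg_bop]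

definition amp_trace :: "nat \<Rightarrow> ('a \<times> nat) oper \<Rightarrow> complex" where
  "amp_trace n Q = (\<Sum>i<n. ell2_inner (amp G n) (Q (delta (\<one>, i))) (delta (\<one>, i)))"

lemma delta_amp: "i < n \<Longrightarrow> delta (\<one>, i) \<in> ell2 (amp G n)"
  by (rule delta_ell2) simp

text \<open>Written in entries, the trace of a product is a sum of inner products
  \<open>ell2_inner G x (conj_J G y)\<close>. As \<open>J\<close> is antiunitary and an involution,
  these are symmetric in \<open>x\<close> and \<open>y\<close>, which makes the trace
  commutative.\<close>

lemma amp_trace_comp:
  assumes A: "A \<in> acomm n" and B: "B \<in> acomm n"
  shows "amp_trace n (A \<circ> B) = (\<Sum>i<n. \<Sum>j<n. ell2_inner G (hat G (entry G j i B)) (conj_J G (hat G (entry G i j A))))"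
  unfolding amp_trace_def
proof (intro sum.cong refl)
  fix i assume "i \<in> {..<n}"
  then have i: "i < n" by simp
  let ?d = "delta (\<one>, i) :: ('a \<times> nat) vec"
  have AB: "A \<in> bounded_ops (amp G n)" "B \<in> bounded_ops (amp G n)" using A B commutant_bop by blast+
  have e: "B ?d \<in> ell2 (amp G n)" "adj (amp G n) A ?d \<in> ell2 (amp G n)"
    using AB delta_amp[OF i] by blast+
  have "ell2_inner (amp G n) ((A \<circ> B) ?d) ?d = ell2_inner (amp G n) (B ?d) (adj (amp G n) A ?d)"
    using adj_inner[OF AB(1) e(1) delta_amp[OF i]] by simp
  also have "\<dots> = (\<Sum>j<n. ell2_inner G (component j (B ?d)) (component j (adj (amp G n) A ?d)))"
    by (rule amp_inner[OF e])
  also have "\<dots> = (\<Sum>j<n. ell2_inner G (hat G (entry G j i B)) (conj_J G (hat G (entry G i j A))))"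
  proof (intro sum.cong refl)
    fix j assume "j \<in> {..<n}"
    then have j: "j < n" by simp
    have 1: "component j (B ?d) = hat G (entry G j i B)" by (simp add: entry_def delta_emb delta_ell2)
    have "component j (adj (amp G n) A ?d) = hat G (entry G j i (adj (amp G n) A))"
      by (simp add: entry_def delta_emb delta_ell2)
    also have "\<dots> = conj_J G (hat G (entry G i j A))"
      using hat_adj[OF acomm_entry[OF A i j]] by (simp add: entry_adj[OF AB(1) i j])
    finally show "ell2_inner G (component j (B ?d)) (component j (adj (amp G n) A ?d))
       = ell2_inner G (hat G (entry G j i B)) (conj_J G (hat G (entry G i j A)))" using 1 by simp
  qed
  finally show "ell2_inner (amp G n) ((A \<circ> B) ?d) ?d
    = (\<Sum>j<n. ell2_inner G (hat G (entry G j i B)) (conj_J G (hat G (entry G i j A))))" .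
qed

lemma amp_trace_commute:
  assumes A: "A \<in> acomm n" and B: "B \<in> acomm n"
  shows "amp_trace n (A \<circ> B) = amp_trace n (B \<circ> A)"
proof -
  have "ell2_inner G (hat G (entry G j i B)) (conj_J G (hat G (entry G i j A)))
      = ell2_inner G (hat G (entry G i j A)) (conj_J G (hat G (entry G j i B)))" if "i < n" "j < n" for i j
  proof -
    have "hat G (entry G j i B) \<in> ell2 G" "hat G (entry G i j A) \<in> ell2 G"
      using acomm_entry[OF A that] acomm_entry[OF B that(2,1)] commutant_bop hat_ell2 by blast+
    then show ?thesis using conj_J_inner conj_J_conj_J conj_J_ell2 by metis
  qed
  then show ?thesis unfolding amp_trace_comp[OF A B] amp_trace_comp[OF B A]
    by (subst sum.swap) (intro sum.cong refl, simp)
qed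

lemma amp_trace_diff:
  assumes "A \<in> bounded_ops (amp G n)" "B \<in> bounded_ops (amp G n)"
  shows "amp_trace n (A - B) = amp_trace n A - amp_trace n B"
  unfolding amp_trace_def sum_subtractf[symmetric]
proof (intro sum.cong refl)
  fix i assume "i \<in> {..<n}"
  then have d: "delta (\<one>, i) \<in> ell2 (amp G n)" using delta_amp by simp
  show "ell2_inner (amp G n) ((A - B) (delta (\<one>, i))) (delta (\<one>, i)) =
    ell2_inner (amp G n) (A (delta (\<one>, i))) (delta (\<one>, i)) - ell2_inner (amp G n) (B (delta (\<one>, i))) (delta (\<one>, i))"
    using ell2_inner_diff_left[OF bounded_op_ell2[OF assms(1) d] bounded_op_ell2[OF assms(2) d] d] by (simp only: minus_apply)
qed

text \<open>The even exponent lets self-adjointness split the power into two equal halves, so that a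
  trace controls norms of vectors.\<close>

lemma amp_trace_square:
  assumes a: "a \<in> bounded_ops (amp G n)" "adj (amp G n) a = a"
  shows "amp_trace n (op_power (amp G n) a (k + k)) = of_real (\<Sum>i<n. (ell2_norm (amp G n) (op_power (amp G n) a k (delta (\<one>, i))))\<^sup>2)"
  unfolding amp_trace_def of_real_sum
proof (intro sum.cong refl)
  fix i assume "i \<in> {..<n}"
  then have d: "delta (\<one>, i) \<in> ell2 (amp G n)" using delta_amp by simp
  have e: "op_power (amp G n) a k (delta (\<one>, i)) \<in> ell2 (amp G n)" using op_power_bop[OF a(1)] d by blast
  show "ell2_inner (amp G n) (op_power (amp G n) a (k + k) (delta (\<one>, i))) (delta (\<one>, i)) =
    of_real ((ell2_norm (amp G n) (op_power (amp G n) a k (delta (\<one>, i))))\<^sup>2)"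
    using adj_inner[OF op_power_bop[OF a(1)] e d, of k] op_power_adj[OF a] ell2_inner_self[OF e]
    by (simp add: op_power_add[OF a(1)])
qed

text \<open>The adjoint of \<open>T\<close> intertwines the powers of \<open>b\<close> with those of
  \<open>a\<close>. Splitting off one factor from the next power therefore subtracts the trace of
  \<open>T \<circ> X\<close> on one side and of \<open>X \<circ> T\<close> on the other, with the
  same \<open>X\<close>.\<close>

lemma amp_trace_defect:
  assumes T: "T \<in> acomm n"
  defines "a \<equiv> id_op (amp G n) - (adj (amp G n) T \<circ> T)" and "b \<equiv> id_op (amp G n) - (T \<circ> adj (amp G n) T)"
  shows "amp_trace n (op_power (amp G n) a k) = amp_trace n (op_power (amp G n) b k)"
proof -
  let ?H = "amp G n" and ?T' = "adj (amp G n) T"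
  have T': "?T' \<in> acomm n" using T by (rule acomm_adj[rotated])
  have TB: "T \<in> bounded_ops ?H" "?T' \<in> bounded_ops ?H" using T T' commutant_bop by blast+
  have a: "a \<in> acomm n" and b: "b \<in> acomm n" unfolding a_def b_def using T T'
    by (intro acomm_diff acomm_id acomm_comp; simp)+
  have aB: "a \<in> bounded_ops ?H" "b \<in> bounded_ops ?H" using a b commutant_bop by blast+
  have sub: "(id_op ?H - X) \<circ> Y = Y - (X \<circ> Y)" "Y \<circ> (id_op ?H - X) = Y - (Y \<circ> X)"
    if "X \<in> bounded_ops ?H" "Y \<in> bounded_ops ?H" for X Y
  proof -
    show "(id_op ?H - X) \<circ> Y = Y - (X \<circ> Y)"
      by (rule bounded_op_apply_inI[of _ ?H]) (use that in \<open>simp_all add: comp_bop diff_bop id_op_apply bounded_op_ell2\<close>)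
    show "Y \<circ> (id_op ?H - X) = Y - (Y \<circ> X)"
    proof (rule bounded_op_apply_inI[of _ ?H])
      fix f assume f: "f \<in> ell2 ?H"
      show "(Y \<circ> (id_op ?H - X)) f = (Y - (Y \<circ> X)) f"
        using bounded_op_diff[OF that(2) f bounded_op_ell2[OF that(1) f]] f by (simp add: id_op_def)
    qed (use that in blast)+
  qed
  have T'b: "?T' \<circ> b = a \<circ> ?T'"
    using sub(2)[of "T \<circ> ?T'" ?T'] sub(1)[of "?T' \<circ> T" ?T'] TB by (simp add: a_def b_def comp_bop comp_assoc)
  have int: "?T' \<circ> op_power ?H b k = op_power ?H a k \<circ> ?T'" for k
  proof (induction k)
    case 0 then show ?case using TB by (simp add: id_op_comp)
  next
    case (Suc k)
    have "?T' \<circ> op_power ?H b (Suc k) = (?T' \<circ> b) \<circ> op_power ?H b k" by (simp add: comp_assoc)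
    also have "\<dots> = a \<circ> (?T' \<circ> op_power ?H b k)" by (simp only: T'b comp_assoc)
    also have "\<dots> = op_power ?H a (Suc k) \<circ> ?T'" by (simp only: Suc comp_assoc op_power.simps)
    finally show ?case .
  qed
  show ?thesis
  proof (induction k)
    case (Suc k)
    have p: "op_power ?H a k \<in> acomm n" "op_power ?H b k \<in> acomm n" using a b acomm_op_power by blast+
    then have pB: "op_power ?H a k \<in> bounded_ops ?H" "op_power ?H b k \<in> bounded_ops ?H" using commutant_bop by blast+
    have "op_power ?H b (Suc k) = op_power ?H b k - (T \<circ> (op_power ?H a k \<circ> ?T'))"
      using sub(1)[of "T \<circ> ?T'" "op_power ?H b k"] TB pB by (simp add: b_def comp_bop comp_assoc int[unfolded b_def])
    moreover have "op_power ?H a (Suc k) = op_power ?H a k - ((op_power ?H a k \<circ> ?T') \<circ> T)"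
      unfolding op_power_Suc_right[OF aB(1)] using sub(2)[of "?T' \<circ> T" "op_power ?H a k"] TB pB
      by (simp add: a_def comp_bop comp_assoc)
    moreover have "amp_trace n (T \<circ> (op_power ?H a k \<circ> ?T')) = amp_trace n ((op_power ?H a k \<circ> ?T') \<circ> T)"
      by (rule amp_trace_commute[OF T acomm_comp[OF p(1) T']])
    ultimately show ?case
      by (simp only: Suc TB pB amp_trace_diff comp_bop)
  qed simp
qed

text \<open>Finiteness of the matrix algebras: the kernels of \<open>T\<close> and of its adjoint have the same trace.\<close>

lemma injective_adj:
  assumes T: "T \<in> acomm n" and inj: "\<And>F. F \<in> ell2 (amp G n) \<Longrightarrow> T F = 0 \<Longrightarrow> F = 0"
    and F: "F \<in> ell2 (amp G n)" "adj (amp G n) T F = 0"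
  shows "F = 0"
proof -
  let ?H = "amp G n"
  have TB: "T \<in> bounded_ops ?H" using T commutant_bop by blast
  obtain C where C: "C > 0" "\<And>f. f \<in> ell2 ?H \<Longrightarrow> ell2_norm ?H (T f) \<le> C * ell2_norm ?H f"
    using bounded_op_bound[OF TB] by blast
  \<comment> \<open>Dividing by a norm bound turns \<open>T\<close> into a contraction with the same
    kernel, and likewise for the adjoint; the results on defect powers assume a contraction.\<close>
  define S where "S = oscale (of_real (1 / C)) T"
  have S: "S \<in> acomm n" unfolding S_def by (rule acomm_oscale[OF T])
  have SB: "S \<in> bounded_ops ?H" using S commutant_bop by blast
  have Sc: "ell2_norm ?H (S f) \<le> ell2_norm ?H f" if "f \<in> ell2 ?H" for f
    using C(2)[OF that] C(1) by (simp add: S_def oscale_apply ell2_norm_vscale field_simps norm_divide)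
  have Si: "f = 0" if f: "f \<in> ell2 ?H" "S f = 0" for f
  proof (rule inj[OF f(1)])
    have "vscale (of_real C) (S f) = T f" using C(1) by (auto simp: S_def oscale_apply fun_eq_iff)
    then show "T f = 0" using f(2) by (simp add: vscale_def fun_eq_iff)
  qed
  have adjS: "adj ?H S = oscale (of_real (1/C)) (adj ?H T)" unfolding S_def by (simp add: adj_oscale[OF TB])
  define a where "a = id_op ?H - (adj ?H S \<circ> S)"
  define b where "b = id_op ?H - (S \<circ> adj ?H S)"
  have aB: "a \<in> bounded_ops ?H" "b \<in> bounded_ops ?H" unfolding a_def b_def using SB by blast+
  have asym: "adj ?H a = a" "adj ?H b = b"
    unfolding a_def b_def using SB by (simp_all add: adj_diff adj_comp adj_adj adj_id adj_bop comp_bop)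
  \<comment> \<open>Injectivity of \<open>S\<close> makes the powers of \<open>a\<close> vanish in
    the limit on basis vectors; the equality of traces transfers this to the powers of
    \<open>b\<close>, where injectivity of the adjoint is still to be proved.\<close>
  have "(\<lambda>k. \<Sum>i<n. (ell2_norm ?H (op_power ?H a k (delta (\<one>, i))))\<^sup>2) \<longlonglongrightarrow> (\<Sum>i<n. 0\<^sup>2)"
    unfolding a_def
    by (intro tendsto_sum tendsto_power defect_powers_tendsto[OF SB Sc Si]) (auto simp: delta_amp)
  also have "(\<lambda>k. \<Sum>i<n. (ell2_norm ?H (op_power ?H a k (delta (\<one>, i))))\<^sup>2) = (\<lambda>k. \<Sum>i<n. (ell2_norm ?H (op_power ?H b k (delta (\<one>, i))))\<^sup>2)"
  proof
    fix k
    have "complex_of_real (\<Sum>i<n. (ell2_norm ?H (op_power ?H a k (delta (\<one>, i))))\<^sup>2) = of_real (\<Sum>i<n. (ell2_norm ?H (op_power ?H b k (delta (\<one>, i))))\<^sup>2)"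
      unfolding amp_trace_square[OF aB(1) asym(1), symmetric] amp_trace_square[OF aB(2) asym(2), symmetric]
      unfolding a_def b_def by (rule amp_trace_defect[OF S])
    then show "(\<Sum>i<n. (ell2_norm ?H (op_power ?H a k (delta (\<one>, i))))\<^sup>2) = (\<Sum>i<n. (ell2_norm ?H (op_power ?H b k (delta (\<one>, i))))\<^sup>2)"
      by (simp only: of_real_eq_iff)
  qed
  finally have lim: "(\<lambda>k. \<Sum>i<n. (ell2_norm ?H (op_power ?H b k (delta (\<one>, i))))\<^sup>2) \<longlonglongrightarrow> 0" by simp
  \<comment> \<open>A vector in the kernel of the adjoint is fixed by every power of
    \<open>b\<close>. Its coordinate is then an inner product with
    \<open>op_power ?H b k (delta (\<one>, i))\<close>, which tends to 0.\<close>
  have key: "E (\<one>, i) = 0" if E: "E \<in> ell2 ?H" "adj ?H S E = 0" and i: "i < n" for E i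
  proof -
    have d: "delta (\<one>, i) \<in> ell2 ?H" using delta_amp[OF i] .
    have bE: "b E = E" using E bounded_op_zero[OF SB] by (simp add: b_def id_op_def)
    have pE: "op_power ?H b k E = E" for k by (induction k) (use E bE in \<open>auto simp: id_op_def\<close>)
    have "(cmod (E (\<one>, i)))\<^sup>2 \<le> (ell2_norm ?H E)\<^sup>2 * (\<Sum>i<n. (ell2_norm ?H (op_power ?H b k (delta (\<one>, i))))\<^sup>2)" for k
    proof -
      have e: "op_power ?H b k (delta (\<one>, i)) \<in> ell2 ?H" using op_power_bop[OF aB(2)] d by blast
      have "E (\<one>, i) = ell2_inner ?H (op_power ?H b k E) (delta (\<one>, i))"
        unfolding pE using ell2_inner_delta(1)[OF E(1)] i by simp
      also have "\<dots> = ell2_inner ?H E (op_power ?H b k (delta (\<one>, i)))"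
        using adj_inner[OF op_power_bop[OF aB(2)] E(1) d] op_power_adj[OF aB(2) asym(2)] by simp
      finally have "cmod (E (\<one>, i)) \<le> ell2_norm ?H E * ell2_norm ?H (op_power ?H b k (delta (\<one>, i)))"
        using ell2_cauchy_schwarz[OF E(1) e] by simp
      then have "(cmod (E (\<one>, i)))\<^sup>2 \<le> (ell2_norm ?H E)\<^sup>2 * (ell2_norm ?H (op_power ?H b k (delta (\<one>, i))))\<^sup>2"
        by (metis norm_ge_zero power_mono power_mult_distrib)
      also have "\<dots> \<le> (ell2_norm ?H E)\<^sup>2 * (\<Sum>i<n. (ell2_norm ?H (op_power ?H b k (delta (\<one>, i))))\<^sup>2)"
        by (intro mult_left_mono member_le_sum) (use i in auto)
      finally show ?thesis .
    qed
    moreover have "(\<lambda>k. (ell2_norm ?H E)\<^sup>2 * (\<Sum>i<n. (ell2_norm ?H (op_power ?H b k (delta (\<one>, i))))\<^sup>2)) \<longlonglongrightarrow> (ell2_norm ?H E)\<^sup>2 * 0"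
      by (intro tendsto_mult tendsto_const lim)
    ultimately have "(cmod (E (\<one>, i)))\<^sup>2 \<le> (ell2_norm ?H E)\<^sup>2 * 0" by (intro LIMSEQ_le_const) auto
    then show ?thesis by simp
  qed
  have S'F: "adj ?H S F = 0" unfolding adjS oscale_apply F(2) by (auto simp: fun_eq_iff)
  show ?thesis
  proof (rule ell2_eqI[of _ ?H])
    fix x assume "x \<in> carrier ?H"
    then obtain s i where x: "x = (s, i)" "s \<in> carrier G" "i < n" by auto
    \<comment> \<open>\<open>key\<close> reads coordinates only at the identity. Right translation
      by \<open>s\<close> commutes with \<open>adj ?H S\<close> and moves the coordinate at
      \<open>s\<close> there.\<close>
    let ?D = "diag G n (rreg G s)"
    have D: "?D \<in> diag G n ` rreg G ` carrier G" using x by blast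
    have DB: "?D \<in> bounded_ops ?H" using x by blast
    have "adj ?H S (?D F) = ?D (adj ?H S F)" by (rule commutantD[OF acomm_adj[OF _ S] D])
    also have "\<dots> = 0" unfolding S'F by (rule bounded_op_zero[OF DB])
    finally have "?D F (\<one>, i) = 0" using key[OF bounded_op_ell2[OF DB F(1)] _ x(3)] by blast
    moreover have "?D F (\<one>, i) = component i (?D F) \<one>" by (simp add: component_def)
    moreover have "\<dots> = rreg G s (component i F) \<one>" using component_diag[OF F(1) x(3)] by simp
    moreover have "\<dots> = F x" using x component_ell2(1)[OF F(1)] by (simp add: rreg_apply) (simp add: component_def)
    ultimately show "F x = 0 x" by simp
  qed (use F in auto)
qed

end

section \<open>Convolution and the Ore condition\<close>

lemma vscale_zero: "vscale c 0 = 0" "vscale 0 f = 0"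
  by (simp_all add: fun_eq_iff)

lemma kernel_closed_subspace:
  assumes R: "R \<in> bounded_ops G" shows "closed_subspace G {f \<in> ell2 G. R f = 0}"
  unfolding closed_subspace_def
proof
  let ?K = "{f \<in> ell2 G. R f = 0}"
  show "lin_subspace G ?K" using R unfolding lin_subspace_def
    by (auto simp: bounded_op_zero bounded_op_add bounded_op_scale vscale_zero)
  show "cl G ?K \<subseteq> ?K"
  proof
    fix f assume f: "f \<in> cl G ?K"
    have "R f \<in> cl G {0}"
    proof (rule bounded_op_cl_invariant[OF R _ _ _ f])
      show "R k \<in> cl G {0}" if "k \<in> ?K" for k using that cl_subset[of "{0}" G] by auto
    qed auto
    then have "R f \<in> ell2 G" "\<And>e. e > 0 \<Longrightarrow> ell2_norm G (R f) < e" by (auto simp: cl_def)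
    then have "ell2_norm G (R f) = 0" using ell2_norm_nonneg[of G "R f"] by (metis less_irrefl order_le_less)
    then have "R f = 0" using ell2_norm_zero_iff[OF \<open>R f \<in> ell2 G\<close>] by simp
    then show "f \<in> ?K" using f cl_ell2 by blast
  qed
qed

context group
begin

text \<open>A closed invariant subspace of pairs is parametrised by bounded operators:
  \<open>T\<close> and \<open>Y\<close> form the first column of the projection onto
  \<open>W\<close>. The last conclusion shows that \<open>T\<close> is injective as soon as the
  first components of \<open>W\<close> are dense.\<close>

lemma acomm_projection:
  assumes W: "closed_subspace (amp G 2) W" and inv: "\<And>t F. t \<in> carrier G \<Longrightarrow> F \<in> W \<Longrightarrow> diag G 2 (rreg G t) F \<in> W"
  obtains T Y where "T \<in> rcomm G" "Y \<in> rcomm G" "adj G T = T"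
    "\<And>x. x \<in> ell2 G \<Longrightarrow> embed 0 (T x) + embed 1 (Y x) \<in> W"
    "\<And>x F. x \<in> ell2 G \<Longrightarrow> T x = 0 \<Longrightarrow> F \<in> W \<Longrightarrow> ell2_inner G x (component 0 F) = 0"
proof -
  let ?H = "amp G 2"
  define Q where "Q = proj ?H W"
  have Q: "Q \<in> acomm 2" unfolding Q_def
    by (rule proj_commutant[OF diag_rreg_bop diag_rreg_adj W]) (use inv in auto)
  have QB: "Q \<in> bounded_ops ?H" using Q commutant_bop by blast
  have Qs: "adj ?H Q = Q" by (rule adj_eqI[OF QB QB]) (simp add: Q_def proj_sym[OF W])
  define T where "T = entry G 0 0 Q"
  define Y where "Y = entry G 1 0 Q"
  have 1: "T \<in> rcomm G" "Y \<in> rcomm G" unfolding T_def Y_def by (rule acomm_entry[OF Q]; simp)+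
  have 2: "adj G T = T" unfolding T_def using entry_adj[OF QB, of 0 0] Qs by simp
  have e: "embed 0 x \<in> ell2 ?H" if "x \<in> ell2 G" for x by (rule embed_ell2(1)[OF that]) simp
  have Qe: "Q (embed 0 x) = embed 0 (T x) + embed 1 (Y x)" if x: "x \<in> ell2 G" for x
    using amp_decomp[OF bounded_op_ell2[OF QB e[OF x]]] x
    by (simp only: T_def Y_def entry_def if_True) (simp add: numeral_2_eq_2)
  have 3: "embed 0 (T x) + embed 1 (Y x) \<in> W" if x: "x \<in> ell2 G" for x
    unfolding Qe[OF x, symmetric] Q_def by (rule proj_in[OF W e[OF x]])
  have 4: "ell2_inner G x (component 0 F) = 0" if x: "x \<in> ell2 G" "T x = 0" and F: "F \<in> W" for x F
  proof -
    have Qx: "Q (embed 0 x) \<in> ell2 ?H" using QB e[OF x(1)] by blast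
    have QQ: "Q (Q (embed 0 x)) = Q (embed 0 x)" unfolding Q_def by (rule proj_id[OF W proj_in[OF W e[OF x(1)]]])
    \<comment> \<open>Being a corner of a projection, \<open>T\<close> is positive: the squared norm
      of \<open>Q (embed 0 x)\<close> equals the inner product of \<open>T x\<close> with
      \<open>x\<close>.\<close>
    have "ell2_inner ?H (Q (embed 0 x)) (Q (embed 0 x)) = ell2_inner ?H (Q (embed 0 x)) (embed 0 x)"
      using adj_inner[OF QB Qx e[OF x(1)]] by (simp add: Qs QQ)
    also have "\<dots> = ell2_inner G (T x) x" using x(1) by (simp add: inner_emb' T_def entry_def)
    finally have "ell2_norm ?H (Q (embed 0 x)) = 0" using x(2) ell2_inner_self[OF Qx] by simp
    then have Q0: "Q (embed 0 x) = 0" using ell2_norm_zero_iff[OF Qx] by simp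
    have Fe: "F \<in> ell2 ?H" using closed_subspace_ell2[OF W F] .
    have "ell2_inner G x (component 0 F) = ell2_inner ?H (embed 0 x) F" using x(1) by (simp add: inner_emb)
    also have "\<dots> = ell2_inner ?H (embed 0 x) (Q F)" unfolding Q_def proj_id[OF W F] ..
    also have "\<dots> = ell2_inner ?H (Q (embed 0 x)) F" using adj_inner[OF QB e[OF x(1)] Fe] Qs by simp
    finally show ?thesis by (simp add: Q0)
  qed
  show thesis by (rule that[OF 1 2 3 4])
qed

text \<open>Convolution in the form of an inner product. It is meaningful for any two
  square-summable functions and bounded pointwise by Cauchy-Schwarz, while the result need not be
  square-summable; \<open>conv_sum\<close> recovers the usual series.\<close>

definition conv :: "'a vec \<Rightarrow> 'a vec \<Rightarrow> 'a vec" where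
  "conv f g = (\<lambda>u. if u \<in> carrier G then ell2_inner G f (lreg G u (conj_J G g)) else 0)"

lemma conv_sum: "f \<in> ell2 G \<Longrightarrow> g \<in> ell2 G \<Longrightarrow> u \<in> carrier G \<Longrightarrow>
    conv f g u = (\<Sum>\<^sub>\<infinity>v\<in>carrier G. f v * g (inv v \<otimes> u))"
  unfolding conv_def ell2_inner_def
  by (auto intro!: infsum_cong simp: lreg_apply conj_J_ell2) (simp add: conj_J_def inv_mult_group)

lemma conv_bound: "f \<in> ell2 G \<Longrightarrow> g \<in> ell2 G \<Longrightarrow> cmod (conv f g u) \<le> ell2_norm G f * ell2_norm G g"
  using ell2_cauchy_schwarz[of f G "lreg G u (conj_J G g)"] ell2_norm_nonneg[of G]
  by (auto simp: conv_def lreg_norm conj_J_norm conj_J_ell2 lreg_ell2 mult_nonneg_nonneg)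

lemma conv_add_right: "f \<in> ell2 G \<Longrightarrow> g \<in> ell2 G \<Longrightarrow> h \<in> ell2 G \<Longrightarrow> conv f (g + h) = conv f g + conv f h"
  by (rule ext) (auto simp: conv_def conj_J_add bounded_op_add[OF lreg_bop] conj_J_ell2
      ell2_inner_add_right[OF lreg_ell2 lreg_ell2])

lemma conv_vscale_right: "f \<in> ell2 G \<Longrightarrow> g \<in> ell2 G \<Longrightarrow> conv f (vscale c g) = vscale c (conv f g)"
  by (rule ext) (auto simp: conv_def conj_J_vscale bounded_op_scale[OF lreg_bop] conj_J_ell2
      ell2_inner_scale_right[OF lreg_ell2])

lemma conv_add_left: "f \<in> ell2 G \<Longrightarrow> g \<in> ell2 G \<Longrightarrow> h \<in> ell2 G \<Longrightarrow> conv (f + g) h = conv f h + conv g h"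
  by (rule ext) (auto simp: conv_def ell2_inner_add_left[OF _ _ lreg_ell2] conj_J_ell2)

lemma conv_diff_right: 
  assumes "f \<in> ell2 G" "g \<in> ell2 G" "h \<in> ell2 G" shows "conv f (g - h) = conv f g - conv f h"
  using conv_add_right[of f "g - h" h] assms by (simp add: ell2_diff algebra_simps)

lemma conv_diff_left: 
  assumes "f \<in> ell2 G" "g \<in> ell2 G" "h \<in> ell2 G" shows "conv (f - g) h = conv f h - conv g h"
  using conv_add_left[of "f - g" g h] assms by (simp add: ell2_diff algebra_simps)

lemma conj_J_rreg: "t \<in> carrier G \<Longrightarrow> f \<in> ell2 G \<Longrightarrow> conj_J G (rreg G t f) = lreg G t (conj_J G f)"
  by (rule ell2_eqI[of _ G])
     (auto simp: conj_J_ell2 lreg_ell2 rreg_ell2 lreg_apply,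
      auto simp: conj_J_def rreg_apply inv_mult_group)

lemma conv_rreg:
  assumes "f \<in> ell2 G" "g \<in> ell2 G" "t \<in> carrier G" "u \<in> carrier G"
  shows "conv f (rreg G t g) u = conv f g (u \<otimes> t)"
  using assms by (simp add: conv_def conj_J_rreg lreg_lreg conj_J_ell2)

lemma conj_J_inner': "f \<in> ell2 G \<Longrightarrow> g \<in> ell2 G \<Longrightarrow> ell2_inner G (conj_J G f) g = ell2_inner G (conj_J G g) f"
  using conj_J_inner[of f "conj_J G g"] by (simp add: conj_J_conj_J conj_J_ell2)

lemma rcomm_apply_conv:
  assumes T: "T \<in> rcomm G" and f: "f \<in> ell2 G" shows "T f = conv (hat G T) f"
proof
  fix u show "T f u = conv (hat G T) f u"
  proof (cases "u \<in> carrier G")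
    case True
    have TB: "T \<in> bounded_ops G" using T commutant_bop by blast
    note h = hat_ell2[OF TB]
    have "T f u = ell2_inner G (T f) (delta u)" using TB f True by (simp add: ell2_inner_delta bounded_op_ell2)
    also have "\<dots> = ell2_inner G f (adj G T (delta u))" using TB f True by (simp add: adj_inner delta_ell2)
    also have "adj G T (delta u) = rreg G (inv u) (conj_J G (hat G T))"
      using rcomm_delta[OF rcomm_adj[OF _ T] True] hat_adj[OF T] by simp
    also have "\<dots> = conj_J G (conj_J G \<dots>)" using True h by (simp add: conj_J_conj_J rreg_ell2 conj_J_ell2)
    also have "conj_J G (rreg G (inv u) (conj_J G (hat G T))) = lreg G (inv u) (hat G T)"
      using True h by (simp add: conj_J_rreg conj_J_ell2 conj_J_conj_J)
    also have "ell2_inner G f (conj_J G (lreg G (inv u) (hat G T)))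
       = ell2_inner G (lreg G (inv u) (hat G T)) (conj_J G f)"
      using True h f conj_J_inner'[of f "lreg G (inv u) (hat G T)"]
      by (metis conj_J_inner' ell2_inner_cnj inv_closed lreg_ell2)
    also have "\<dots> = conv (hat G T) f u"
      using True h f lreg_inner[of u "lreg G (inv u) (hat G T)" "conj_J G f"]
      by (simp add: conv_def lreg_inv_lreg lreg_ell2 conj_J_ell2)
    finally show ?thesis .
  next
    case False
    then show ?thesis using ell2_zero_off[OF bounded_op_ell2[OF commutant_bop[OF T] f]] by (simp add: conv_def)
  qed
qed

text \<open>Counterpart of \<open>rcomm_apply_conv\<close>: left and right multiplication by an
  operator become convolution by its vector on either side. This is the language in which a mere
  vector such as \<open>E (delta g)\<close> can commute with operators.\<close>

lemma right_act_conv: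
  assumes T: "T \<in> rcomm G" and f: "f \<in> ell2 G" shows "right_act G T f = conv f (hat G T)"
proof
  fix u show "right_act G T f u = conv f (hat G T) u"
  proof (cases "u \<in> carrier G")
    case True
    have TB: "T \<in> bounded_ops G" using T commutant_bop by blast
    note h = hat_ell2[OF TB]
    have "right_act G T f u = cnj (ell2_inner G (adj G T (conj_J G f)) (delta (inv u)))"
      using TB f True by (simp add: right_act_def conj_J_def[of G "adj G T _"] ell2_inner_delta bounded_op_ell2 adj_bop conj_J_ell2)
    also have "\<dots> = cnj (ell2_inner G (conj_J G f) (T (delta (inv u))))"
      using TB f True by (simp add: adj_inner' delta_ell2 conj_J_ell2)
    also have "T (delta (inv u)) = rreg G u (hat G T)" using rcomm_delta[OF T, of "inv u"] True by simp
    also have "ell2_inner G (conj_J G f) (rreg G u (hat G T)) = ell2_inner G (conj_J G (rreg G u (hat G T))) f"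
      using True h f by (simp add: conj_J_inner' rreg_ell2)
    also have "cnj \<dots> = conv f (hat G T) u"
      using True h by (simp add: conv_def ell2_inner_cnj conj_J_rreg)
    finally show ?thesis .
  qed (simp add: conv_def right_act_def conj_J_def)
qed

lemma right_act_ell2: "T \<in> bounded_ops G \<Longrightarrow> f \<in> ell2 G \<Longrightarrow> right_act G T f \<in> ell2 G"
  unfolding right_act_def by (intro conj_J_ell2 bounded_op_ell2[OF adj_bop])

lemma right_act_add: "T \<in> bounded_ops G \<Longrightarrow> f \<in> ell2 G \<Longrightarrow> g \<in> ell2 G \<Longrightarrow>
    right_act G T (f + g) = right_act G T f + right_act G T g"
  unfolding right_act_def conj_J_add
  by (simp only: bounded_op_add[OF adj_bop conj_J_ell2 conj_J_ell2] conj_J_add)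

lemma right_act_diff:
  assumes "T \<in> bounded_ops G" "f \<in> ell2 G" "g \<in> ell2 G"
  shows "right_act G T (f - g) = right_act G T f - right_act G T g"
  using right_act_add[of T "f - g" g] assms by (simp add: ell2_diff algebra_simps)

lemma right_act_lreg:
  assumes T: "T \<in> rcomm G" and s: "s \<in> carrier G" and f: "f \<in> ell2 G"
  shows "right_act G T (lreg G s f) = lreg G s (right_act G T f)"
proof -
  have TB: "T \<in> bounded_ops G" using T commutant_bop by blast
  have J: "conj_J G (lreg G s h) = rreg G s (conj_J G h)" if "h \<in> ell2 G" for h
    using conj_J_rreg[OF s, of "conj_J G h"] that s by (metis conj_J_conj_J conj_J_ell2 rreg_ell2)
  have "conj_J G (adj G T (rreg G s (conj_J G f))) = conj_J G (rreg G s (adj G T (conj_J G f)))"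
    using commutantD[OF rcomm_adj[OF _ T], of "rreg G s"] s by simp
  also have "\<dots> = lreg G s (conj_J G (adj G T (conj_J G f)))"
    by (rule conj_J_rreg[OF s bounded_op_ell2[OF adj_bop[OF TB] conj_J_ell2[OF f]]])
  finally show ?thesis unfolding right_act_def J[OF f] .
qed

lemma component_amp2: "component 0 (embed 0 f + embed 1 g) = f" "component 1 (embed 0 f + embed 1 g) = g"
  by (simp_all only: component_add component_emb) auto

lemma amp2_ell2: "f \<in> ell2 G \<Longrightarrow> g \<in> ell2 G \<Longrightarrow> embed 0 f + embed 1 g \<in> ell2 (amp G 2)"
  by (intro ell2_add embed_ell2(1)) auto

text \<open>The closed operator \<open>x \<mapsto> \<eta> * x\<close> is densely defined, so projecting onto its graph yields a
  bounded \<open>T\<close> with dense range for which \<open>\<eta> * T\<close> is bounded.\<close>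

lemma bounded_right_multiple:
  assumes \<eta>: "\<eta> \<in> ell2 G"
  obtains T X where "T \<in> rcomm G" "X \<in> rcomm G" "adj G T = T" "\<And>x. x \<in> ell2 G \<Longrightarrow> T x = 0 \<Longrightarrow> x = 0"
    "\<And>x. x \<in> ell2 G \<Longrightarrow> X x = conv \<eta> (T x)"
proof -
  let ?H = "amp G 2"
  \<comment> \<open>The graph of left convolution by \<open>\<eta>\<close> on its maximal domain,
    the \<open>x\<close> whose product with \<open>\<eta>\<close> is again square-summable.\<close>
  define W where "W = {F \<in> ell2 ?H. component 1 F = conv \<eta> (component 0 F)}"
  have c: "component i F \<in> ell2 G" if "F \<in> ell2 ?H" for i F using component_ell2(1)[OF that] .
  have W: "closed_subspace ?H W" unfolding closed_subspace_def
  proof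
    show "lin_subspace ?H W" unfolding lin_subspace_def
    proof (intro conjI ballI allI)
      show "W \<subseteq> ell2 ?H" by (auto simp: W_def)
      have "conv \<eta> 0 = 0"
        using conv_vscale_right[OF \<eta> ell2_zero, of 0] by (simp add: vscale_def zero_fun_def)
      then show "0 \<in> W" by (simp add: W_def component_zero)
      show "x + y \<in> W" if "x \<in> W" "y \<in> W" for x y
        using that \<eta> c by (simp only: W_def mem_Collect_eq component_add conv_add_right ell2_add)
      show "vscale z x \<in> W" if "x \<in> W" for x z
        using that \<eta> c by (simp only: W_def mem_Collect_eq component_vscale conv_vscale_right ell2_vscale)
    qed
    show "cl ?H W \<subseteq> W"
    proof
      fix F assume F: "F \<in> cl ?H W"
      have Fe: "F \<in> ell2 ?H" using F cl_ell2 by blast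
      \<comment> \<open>Closedness of the graph is checked one point \<open>u\<close> at a time,
        because there both sides depend continuously on \<open>F\<close>; in norm, convolution by
        \<open>\<eta>\<close> need not be continuous.\<close>
      have "component 1 F u = conv \<eta> (component 0 F) u" for u
      proof -
        have "cmod (component 1 F u - conv \<eta> (component 0 F) u) \<le> e" if e: "e > 0" for e
        proof -
          have n: "1 + ell2_norm G \<eta> > 0" using ell2_norm_nonneg[of G \<eta>] by linarith
          obtain K where K: "K \<in> W" "ell2_norm ?H (F - K) < e / (1 + ell2_norm G \<eta>)"
            using clD[OF F divide_pos_pos[OF e n]] by blast
          have Ke: "K \<in> ell2 ?H" "component 1 K = conv \<eta> (component 0 K)" using K by (auto simp: W_def)
          have d: "F - K \<in> ell2 ?H" using Fe Ke by blast
          have "component 1 F u - conv \<eta> (component 0 F) u = component 1 (F - K) u - conv \<eta> (component 0 (F - K)) u"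
            unfolding component_diff conv_diff_right[OF \<eta> c[OF Fe] c[OF Ke(1)]] using Ke(2) by simp
          also have "cmod \<dots> \<le> ell2_norm ?H (F - K) + ell2_norm G \<eta> * ell2_norm ?H (F - K)"
          proof -
            have "cmod (component 1 (F - K) u) \<le> ell2_norm ?H (F - K)"
              using ell2_point_le[OF c[OF d]] component_ell2(2)[OF d] order_trans by blast
            moreover have "cmod (conv \<eta> (component 0 (F - K)) u) \<le> ell2_norm G \<eta> * ell2_norm ?H (F - K)"
              using conv_bound[OF \<eta> c[OF d]] component_ell2(2)[OF d] ell2_norm_nonneg[of G \<eta>]
              by (meson mult_left_mono order_trans)
            ultimately show ?thesis by (meson add_mono norm_triangle_ineq4 order_trans)
          qed
          also have "\<dots> \<le> e" using K(2) n by (simp add: field_simps less_imp_le)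
          finally show ?thesis .
        qed
        then have "cmod (component 1 F u - conv \<eta> (component 0 F) u) \<le> 0" by (rule field_le_epsilon) simp
        then show ?thesis by simp
      qed
      then show "F \<in> W" using Fe by (auto simp: W_def)
    qed
  qed
  have inv: "diag G 2 (rreg G t) F \<in> W" if t: "t \<in> carrier G" and F: "F \<in> W" for t F
  proof -
    have Fe: "F \<in> ell2 ?H" "component 1 F = conv \<eta> (component 0 F)" using F by (auto simp: W_def)
    have "rreg G t (component 1 F) u = conv \<eta> (rreg G t (component 0 F)) u" for u
    proof (cases "u \<in> carrier G")
      case True
      then show ?thesis using t Fe(2) c[OF Fe(1)] \<eta> by (simp add: rreg_apply conv_rreg flip: Fe(2))
    next
      case False
      then show ?thesis using ell2_zero_off[OF rreg_ell2[OF t c[OF Fe(1), of 1]]] by (simp add: conv_def)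
    qed
    then have "rreg G t (component 1 F) = conv \<eta> (rreg G t (component 0 F))" by blast
    then show ?thesis using t Fe by (auto simp: W_def component_diag bounded_op_ell2 diag_bop)
  qed
  obtain T Y where TY: "T \<in> rcomm G" "Y \<in> rcomm G" "adj G T = T"
    "\<And>x. x \<in> ell2 G \<Longrightarrow> embed 0 (T x) + embed 1 (Y x) \<in> W"
    "\<And>x F. x \<in> ell2 G \<Longrightarrow> T x = 0 \<Longrightarrow> F \<in> W \<Longrightarrow> ell2_inner G x (component 0 F) = 0"
    using acomm_projection[OF W inv] by blast
  show thesis
  proof (rule that[OF TY(1-3)])
    fix x assume x: "x \<in> ell2 G"
    show "Y x = conv \<eta> (T x)" using TY(4)[OF x] by (simp only: W_def mem_Collect_eq component_amp2)
    assume T0: "T x = 0"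
    show "x = 0"
    proof (rule ell2_eqI[OF x ell2_zero])
      fix t assume t: "t \<in> carrier G"
      \<comment> \<open>Each basis vector belongs to the domain, as its product with
        \<open>\<eta>\<close> is a translate of \<open>\<eta>\<close>. The domain is thus dense, and
        a vector killed by \<open>T\<close> is orthogonal to all of it.\<close>
      have "conv \<eta> (delta t) = rreg G (inv t) \<eta>"
      proof
        fix u show "conv \<eta> (delta t) u = rreg G (inv t) \<eta> u"
        proof (cases "u \<in> carrier G")
          case True
          have "conj_J G (delta t) = delta (inv t)"
            using t by (auto simp: conj_J_def delta_def fun_eq_iff)
          then show ?thesis using t True \<eta>
            by (simp add: conv_def lreg_delta ell2_inner_delta rreg_apply)
        next
          case False
          then show ?thesis using ell2_zero_off[OF rreg_ell2[OF inv_closed[OF t] \<eta>]] by (simp add: conv_def)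
        qed
      qed
      then have "embed 0 (delta t) + embed 1 (rreg G (inv t) \<eta>) \<in> W"
        using t \<eta> amp2_ell2 unfolding W_def mem_Collect_eq component_amp2
        by (metis delta_ell2 inv_closed rreg_ell2)
      from TY(5)[OF x T0 this] show "x t = 0 t"
        using x t by (simp only: component_amp2 ell2_inner_delta) simp
    qed
  qed
qed

text \<open>A substitute for multiplying by the inverse of \<open>s\<close>: the pairs
  \<open>(p, q)\<close> with \<open>X p = s q\<close> form the kernel of the row
  \<open>(X, -s)\<close>, and the projection onto this kernel provides a common right multiple of
  \<open>X\<close> and \<open>s\<close>.\<close>

lemma ore_condition:
  assumes X: "X \<in> rcomm G" and s: "s \<in> rcomm G" and inj: "\<And>x. x \<in> ell2 G \<Longrightarrow> s x = 0 \<Longrightarrow> x = 0"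
  obtains T Y where "T \<in> rcomm G" "Y \<in> rcomm G" "adj G T = T" "\<And>x. x \<in> ell2 G \<Longrightarrow> T x = 0 \<Longrightarrow> x = 0"
    "\<And>x. x \<in> ell2 G \<Longrightarrow> X (T x) = s (Y x)"
proof -
  let ?H = "amp G 2"
  have B: "X \<in> bounded_ops G" "s \<in> bounded_ops G" using X s commutant_bop by blast+
  define R where "R = entry_op G 2 0 0 X - entry_op G 2 0 1 s"
  have R: "R \<in> acomm 2" unfolding R_def using X s by (intro acomm_diff acomm_entry_op) auto
  have RB: "R \<in> bounded_ops ?H" using R commutant_bop by blast
  have Rap: "R F = embed 0 (X (component 0 F) - s (component 1 F))" if "F \<in> ell2 ?H" for F
    using that by (simp only: R_def minus_apply entry_op_def if_True embed_diff)
  define W where "W = {F \<in> ell2 ?H. R F = 0}"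
  have W: "closed_subspace ?H W" unfolding W_def by (rule kernel_closed_subspace[OF RB])
  have inv: "diag G 2 (rreg G t) F \<in> W" if t: "t \<in> carrier G" and F: "F \<in> W" for t F
  proof -
    have D: "diag G 2 (rreg G t) \<in> bounded_ops ?H" using t by blast
    have "R (diag G 2 (rreg G t) F) = diag G 2 (rreg G t) (R F)" using t by (intro commutantD[OF R]) blast
    then show ?thesis using F D bounded_op_zero[OF D] by (auto simp: W_def)
  qed
  obtain T Y where TY: "T \<in> rcomm G" "Y \<in> rcomm G" "adj G T = T"
    "\<And>x. x \<in> ell2 G \<Longrightarrow> embed 0 (T x) + embed 1 (Y x) \<in> W"
    "\<And>x F. x \<in> ell2 G \<Longrightarrow> T x = 0 \<Longrightarrow> F \<in> W \<Longrightarrow> ell2_inner G x (component 0 F) = 0"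
    using acomm_projection[OF W inv] by blast
  have TB: "T \<in> bounded_ops G" using TY(1) commutant_bop by blast
  \<comment> \<open>\<open>R'(x, y) = (X x - s y, T x)\<close> is injective, so its adjoint is; but the adjoint maps
    \<open>(0, w)\<close> to \<open>(T w, 0)\<close>.\<close>
  define R' where "R' = R + entry_op G 2 1 0 T"
  have R': "R' \<in> acomm 2" unfolding R'_def using R TY(1) by (intro acomm_add acomm_entry_op) auto
  have R'B: "R' \<in> bounded_ops ?H" using R' commutant_bop by blast
  have R'ap: "R' F = embed 0 (X (component 0 F) - s (component 1 F)) + embed 1 (T (component 0 F))" if "F \<in> ell2 ?H" for F
    unfolding R'_def plus_fun_apply Rap[OF that] entry_op_def using that by simp
  have R'inj: "F = 0" if F: "F \<in> ell2 ?H" "R' F = 0" for F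
  proof -
    note c = component_ell2(1)[OF F(1)]
    have 1: "X (component 0 F) - s (component 1 F) = 0" and 2: "T (component 0 F) = 0"
      using component_amp2[of "X (component 0 F) - s (component 1 F)" "T (component 0 F)"] unfolding R'ap[OF F(1), symmetric] F(2) component_zero by auto
    have "F \<in> W" using F(1) 1 by (simp add: W_def Rap embed_zero)
    \<comment> \<open>\<open>F\<close> itself lies in \<open>W\<close>, so its first component,
      being killed by \<open>T\<close>, is orthogonal to itself.\<close>
    from TY(5)[OF c 2 this] have "ell2_norm G (component 0 F) = 0" using ell2_inner_self[OF c, of 0] by simp
    then have c0: "component 0 F = 0" using ell2_norm_zero_iff[OF c] by simp
    then have "s (component 1 F) = 0" using 1 bounded_op_zero[OF B(1)] by simp
    then have c1: "component 1 F = 0" using inj[OF c] by blast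
    show ?thesis
    proof (rule amp_eqI[OF F(1) ell2_zero])
      fix i :: nat assume "i < 2"
      then have "i = 0 \<or> i = 1" by auto
      then show "component i F = component i 0" using c0 c1 by (auto simp only: component_zero)
    qed
  qed
  show thesis
  proof (rule that[OF TY(1-3)])
    fix x assume x: "x \<in> ell2 G"
    have e: "embed 0 (T x) + embed 1 (Y x) \<in> ell2 ?H" "R (embed 0 (T x) + embed 1 (Y x)) = 0"
      using TY(4)[OF x] by (auto simp only: W_def)
    have "embed 0 (X (T x) - s (Y x)) = 0" using e(2) unfolding Rap[OF e(1)] component_amp2 .
    then have "component 0 (embed 0 (X (T x) - s (Y x))) = 0" by (simp only: component_zero)
    then show "X (T x) = s (Y x)" by (simp add: component_emb)
    assume T0: "T x = 0"
    have ex: "embed 1 x \<in> ell2 ?H" using x by (intro embed_ell2(1)) auto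
    have "adj ?H R' (embed 1 x) = 0"
    proof (rule ell2_inner_eqI[OF bounded_op_ell2[OF adj_bop[OF R'B] ex] ell2_zero])
      fix F assume F: "F \<in> ell2 ?H"
      have "ell2_inner ?H (adj ?H R' (embed 1 x)) F = ell2_inner ?H (embed 1 x) (R' F)"
        by (rule adj_inner'[OF R'B ex F])
      also have "\<dots> = ell2_inner G x (component 1 (R' F))" using x by (intro inner_emb) auto
      also have "\<dots> = ell2_inner G x (T (component 0 F))" unfolding R'ap[OF F] component_amp2 ..
      also have "\<dots> = ell2_inner G (T x) (component 0 F)"
        using adj_inner[OF TB x component_ell2(1)[OF F]] TY(3) by simp
      finally show "ell2_inner ?H (adj ?H R' (embed 1 x)) F = ell2_inner ?H 0 F" by (simp add: T0)
    qed
    from injective_adj[OF R' R'inj ex this] have "embed 1 x = 0" .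
    then have "component 1 (embed 1 x) = 0" by (simp only: component_zero)
    then show "x = 0" by (simp add: component_emb)
  qed
qed

text \<open>Two denominators in succession: \<open>S\<close> makes the product with
  \<open>\<eta>\<close> a bounded operator \<open>X\<close>, and \<open>T\<close> moves
  \<open>X\<close> into the range of \<open>s\<close>. Both are self-adjoint and injective, hence
  the adjoint of \<open>S \<circ> T\<close> is injective, and \<open>\<xi>\<close> is the vector of
  \<open>Y\<close>.\<close>

lemma right_multiple_in_range:
  assumes \<eta>: "\<eta> \<in> ell2 G" and s: "s \<in> rcomm G" and inj: "\<And>x. x \<in> ell2 G \<Longrightarrow> s x = 0 \<Longrightarrow> x = 0"
  obtains T \<xi> where "T \<in> rcomm G" "\<And>x. x \<in> ell2 G \<Longrightarrow> adj G T x = 0 \<Longrightarrow> x = 0"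
    "\<xi> \<in> ell2 G" "right_act G T \<eta> = s \<xi>"
proof -
  obtain S X where S: "S \<in> rcomm G" "X \<in> rcomm G" "adj G S = S" "\<And>x. x \<in> ell2 G \<Longrightarrow> S x = 0 \<Longrightarrow> x = 0"
    "\<And>x. x \<in> ell2 G \<Longrightarrow> X x = conv \<eta> (S x)"
    using bounded_right_multiple[OF \<eta>] by blast
  show thesis
  proof (rule ore_condition[OF S(2) s inj])
    fix T Y
    assume T: "T \<in> rcomm G" "Y \<in> rcomm G" "adj G T = T" "\<And>x. x \<in> ell2 G \<Longrightarrow> T x = 0 \<Longrightarrow> x = 0"
      "\<And>x. x \<in> ell2 G \<Longrightarrow> X (T x) = s (Y x)"
    have B: "S \<in> bounded_ops G" "T \<in> bounded_ops G" "Y \<in> bounded_ops G" using S(1) T(1,2) commutant_bop by blast+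
    have ST: "S \<circ> T \<in> rcomm G" using S(1) T(1) by (intro rcomm_comp)
    show thesis
    proof (rule that[OF ST])
      show "hat G Y \<in> ell2 G" by (rule hat_ell2[OF B(3)])
      have d: "delta \<one> \<in> ell2 G" by auto
      show "right_act G (S \<circ> T) \<eta> = s (hat G Y)"
        unfolding right_act_conv[OF ST \<eta>] o_apply using S(5)[OF hat_ell2[OF B(2)]] T(5)[OF d] by simp
      fix x assume x: "x \<in> ell2 G" "adj G (S \<circ> T) x = 0"
      then have "T (S x) = 0" using adj_comp[OF B(1,2)] S(3) T(3) by simp
      then have "S x = 0" using T(4)[OF bounded_op_ell2[OF B(1) x(1)]] by blast
      then show "x = 0" by (rule S(4)[OF x(1)])
    qed
  qed
qed

end

section \<open>Cocycles vanishing at an element\<close>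

lemma Z1_coset: "N +>\<^bsub>Z1 G\<^esub> b = (\<lambda>x. x + b) ` N"
  unfolding a_r_coset_def' by (auto simp: Z1_def)

context group
begin

section \<open>Inner cocycles and the cocycle supplied by a positive Betti number\<close>

lemma inner_cocycles_add:
  assumes "\<beta> \<in> inner_cocycles G" "\<gamma> \<in> inner_cocycles G" shows "\<beta> + \<gamma> \<in> inner_cocycles G"
proof -
  obtain f where f: "f \<in> ell2 G" "\<beta> = (\<lambda>g. if g \<in> carrier G then lreg G g f - f else 0)"
    using assms(1) by (auto simp only: inner_cocycles_def mem_Collect_eq)
  obtain h where h: "h \<in> ell2 G" "\<gamma> = (\<lambda>g. if g \<in> carrier G then lreg G g h - h else 0)"
    using assms(2) by (auto simp only: inner_cocycles_def mem_Collect_eq)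
  have "\<beta> + \<gamma> = (\<lambda>g. if g \<in> carrier G then lreg G g (f + h) - (f + h) else 0)"
  proof
    fix g show "(\<beta> + \<gamma>) g = (if g \<in> carrier G then lreg G g (f + h) - (f + h) else 0)"
      using bounded_op_add[OF lreg_bop f(1) h(1), of g] by (simp add: f h fun_eq_iff)
  qed
  then show ?thesis using ell2_add[OF f(1) h(1)] unfolding inner_cocycles_def by blast
qed

lemma inner_cocycles_right_act:
  assumes T: "T \<in> rcomm G" and "\<beta> \<in> inner_cocycles G"
  shows "(\<lambda>g. right_act G T (\<beta> g)) \<in> inner_cocycles G"
proof -
  have TB: "T \<in> bounded_ops G" using T commutant_bop by blast
  obtain f where f: "f \<in> ell2 G" "\<beta> = (\<lambda>g. if g \<in> carrier G then lreg G g f - f else 0)"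
    using assms(2) by (auto simp only: inner_cocycles_def mem_Collect_eq)
  have r0: "right_act G T 0 = 0" using right_act_diff[OF TB f(1) f(1)] by simp
  have "right_act G T (\<beta> g) = (if g \<in> carrier G then lreg G g (right_act G T f) - right_act G T f else 0)" for g
    unfolding f(2) using right_act_diff[OF TB lreg_ell2[OF _ f(1)] f(1), of g] right_act_lreg[OF T _ f(1), of g] r0
    by (simp only: split: if_splits) simp
  then show ?thesis using right_act_ell2[OF TB f(1)] unfolding inner_cocycles_def by blast
qed

lemma inner_cocycles_zero: "0 \<in> inner_cocycles G"
proof -
  have "lreg G g 0 - 0 = 0" if "g \<in> carrier G" for g using bounded_op_zero[OF lreg_bop[OF that]] by simp
  then have "(0 :: 'a \<Rightarrow> 'a vec) = (\<lambda>g. if g \<in> carrier G then lreg G g 0 - 0 else 0)" by (auto simp: fun_eq_iff)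
  then show ?thesis unfolding inner_cocycles_def using ell2_zero by blast
qed

lemma inner_cocycles_minus:
  assumes "\<beta> \<in> inner_cocycles G" shows "- \<beta> \<in> inner_cocycles G"
proof -
  obtain f where f: "f \<in> ell2 G" "\<beta> = (\<lambda>g. if g \<in> carrier G then lreg G g f - f else 0)"
    using assms by (auto simp only: inner_cocycles_def mem_Collect_eq)
  have "- \<beta> = (\<lambda>g. if g \<in> carrier G then lreg G g (vscale (-1) f) - vscale (-1) f else 0)"
  proof
    fix g show "(- \<beta>) g = (if g \<in> carrier G then lreg G g (vscale (-1) f) - vscale (-1) f else 0)"
      using bounded_op_scale[OF lreg_bop f(1), of g "-1"] by (simp add: f fun_eq_iff)
  qed
  then show ?thesis using ell2_vscale[OF f(1), of "-1"] unfolding inner_cocycles_def by blast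
qed

lemma inner_coset_self:
  assumes "\<beta> \<in> inner_cocycles G" shows "inner_cocycles G +>\<^bsub>Z1 G\<^esub> \<beta> = inner_cocycles G"
proof -
  have "x \<in> (\<lambda>x. x + \<beta>) ` inner_cocycles G" if "x \<in> inner_cocycles G" for x
    using inner_cocycles_add[OF that inner_cocycles_minus[OF assms]] by (intro image_eqI[of _ _ "x + - \<beta>"]) auto
  then show ?thesis unfolding Z1_coset using inner_cocycles_add[OF _ assms] by blast
qed

text \<open>A positive supremum provides an idempotent matrix with a nonzero diagonal entry
  \<open>A i i\<close>, and \<open>b\<close> represents the image of its \<open>i\<close>-th column
  in cohomology. If \<open>b\<close> became inner after multiplication by \<open>T\<close>,
  injectivity of \<open>\<phi>\<close> would give \<open>A i i \<circ> T = 0\<close>, which dense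
  range of \<open>T\<close> excludes.\<close>

lemma betti_pos_cocycle:
  assumes "L2_betti1 G > 0"
  obtains b where "b \<in> cocycles G"
    "\<And>T. T \<in> rcomm G \<Longrightarrow> (\<And>x. x \<in> ell2 G \<Longrightarrow> adj G T x = 0 \<Longrightarrow> x = 0) \<Longrightarrow>
       (\<lambda>g. right_act G T (b g)) \<notin> inner_cocycles G"
proof -
  let ?B = "inner_cocycles G"
  obtain n A P \<phi> where nA: "idem_mat G n A" "submodule P (LG_ring G) (H1 G)" "iso_onto_submodule G n A (H1 G) P \<phi>"
    and pos: "Re (\<Sum>i<n. vn_trace G (A i i)) > 0"
    using assms unfolding L2_betti1_def luck_dim_def less_Sup_iff by (auto simp only: mem_Collect_eq ereal_less)
  have AB: "A i j \<in> bounded_ops G" if "i < n" "j < n" for i j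
    using nA(1) that commutant_bop unfolding idem_mat_def LG_eq by blast
  let ?I = "mat_image G n A"
  have "\<exists>i<n. A i i \<noteq> 0"
  proof (rule ccontr)
    assume "\<not> (\<exists>i<n. A i i \<noteq> 0)"
    then have "vn_trace G (A i i) = 0" if "i < n" for i using that by (simp add: vn_trace_def)
    then show False using pos by simp
  qed
  then obtain i where i: "i < n" "A i i \<noteq> 0" by blast
  \<comment> \<open>The \<open>i\<close>-th standard column, which \<open>A\<close> sends to its own
    \<open>i\<close>-th column; the entry of that column at \<open>i\<close> is the nonzero
    \<open>A i i\<close>.\<close>
  define e where "e k = (if k = i then id_op G else 0)" for k
  have e: "e \<in> columns G n" using i(1) by (auto simp: columns_def e_def LG_eq rcomm_id rcomm_zero)
  define v where "v = mat_app n A e"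
  have v: "v \<in> ?I" unfolding v_def mat_image_def using e by blast
  have A0: "A k j \<circ> 0 = 0" if "k < n" "j < n" for k j
    using bounded_op_zero[OF AB[OF that]] by (auto simp: fun_eq_iff)
  have vi: "v i = A i i"
  proof -
    have "v i = (\<Sum>j<n. if j = i then A i i else 0)"
      unfolding v_def mat_app_def using i(1)
      by (simp only: if_True) (intro sum.cong refl, auto simp: e_def A0 id_op_comp AB)
    then show ?thesis using i(1) by simp
  qed
  have zI: "0 \<in> ?I"
  proof -
    have "mat_app n A 0 = 0"
    proof
      fix k
      have z: "(0 :: nat \<Rightarrow> 'a oper) j = 0" for j by (rule zero_fun_apply)
      have s0: "(\<Sum>j<n. A k j \<circ> 0) = 0" if "k < n" by (rule sum.neutral) (use A0[OF that] in blast)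
      have "(if k < n then \<Sum>j<n. A k j \<circ> 0 else 0) = 0" by (cases "k < n") (simp_all only: s0 if_True if_False)
      then show "mat_app n A 0 k = 0 k" unfolding mat_app_def z .
    qed
    moreover have "0 \<in> columns G n" by (auto simp: columns_def LG_eq rcomm_zero)
    ultimately show ?thesis unfolding mat_image_def by (metis imageI)
  qed
  have IT: "(\<lambda>k. w k \<circ> T) \<in> ?I" if w: "w \<in> ?I" and T: "T \<in> rcomm G" for w T
  proof -
    obtain c where c: "c \<in> columns G n" "w = mat_app n A c" using w by (auto simp: mat_image_def)
    have "(\<lambda>k. w k \<circ> T) = mat_app n A (\<lambda>k. c k \<circ> T)"
      unfolding c(2) mat_app_def by (rule ext, rule ext) (simp add: sum_oper_apply)
    moreover have "(\<lambda>k. c k \<circ> T) \<in> columns G n"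
      using c(1) T by (auto simp: columns_def LG_eq rcomm_comp fun_eq_iff)
    ultimately show ?thesis unfolding mat_image_def by blast
  qed
  have bij: "bij_betw \<phi> ?I P" and add: "\<And>x y. x \<in> ?I \<Longrightarrow> y \<in> ?I \<Longrightarrow> \<phi> (x + y) = \<phi> x \<oplus>\<^bsub>H1 G\<^esub> \<phi> y"
    and sm: "\<And>x T. x \<in> ?I \<Longrightarrow> T \<in> rcomm G \<Longrightarrow> \<phi> (\<lambda>i. x i \<circ> T) = T \<odot>\<^bsub>H1 G\<^esub> \<phi> x"
    using nA(3) unfolding iso_onto_submodule_def LG_eq by blast+
  have "P \<subseteq> carrier (H1 G)"
    using subgroup.subset[OF submodule.axioms(1)[OF nA(2)]] by simp
  then have Pc: "\<exists>b\<in>cocycles G. x = ?B +>\<^bsub>Z1 G\<^esub> b" if "x \<in> P" for x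
    using that by (auto simp: H1_def quot_module_def A_RCOSETS_def' Z1_def)
  have inP: "\<phi> x \<in> P" if "x \<in> ?I" for x using bij that by (auto simp: bij_betw_def)
  \<comment> \<open>Derived from additivity alone: the coset \<open>\<phi> 0\<close> equals its own
    double, so \<open>b + b\<close> lies in the coset of \<open>b\<close> and the representative
    \<open>b\<close> is inner.\<close>
  have phi0: "\<phi> 0 = ?B"
  proof -
    obtain b where b: "b \<in> cocycles G" "\<phi> 0 = ?B +>\<^bsub>Z1 G\<^esub> b" using Pc[OF inP[OF zI]] by blast
    have bm: "b \<in> \<phi> 0" unfolding b(2) Z1_coset using inner_cocycles_zero by (intro image_eqI[of _ _ 0]) auto
    have "\<phi> 0 = \<phi> 0 <+>\<^bsub>Z1 G\<^esub> \<phi> 0" using add[OF zI zI] by (simp add: H1_def quot_module_def)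
    moreover have "b \<oplus>\<^bsub>Z1 G\<^esub> b \<in> \<phi> 0 <+>\<^bsub>Z1 G\<^esub> \<phi> 0"
      unfolding set_add_def' using bm by blast
    moreover have "b \<oplus>\<^bsub>Z1 G\<^esub> b = b + b" by (simp only: Z1_def ring.simps)
    ultimately have "b + b \<in> (\<lambda>x. x + b) ` ?B" using b(2) Z1_coset by metis
    then obtain \<beta> where "\<beta> \<in> ?B" "b + b = \<beta> + b" by blast
    then have "b \<in> ?B" by (metis add_right_cancel)
    then show ?thesis using b(2) inner_coset_self by simp
  qed
  obtain b where b: "b \<in> cocycles G" "\<phi> v = ?B +>\<^bsub>Z1 G\<^esub> b" using Pc[OF inP[OF v]] by blast
  show thesis
  proof (rule that[OF b(1)])
    fix T assume T: "T \<in> rcomm G" and inj: "\<And>x. x \<in> ell2 G \<Longrightarrow> adj G T x = 0 \<Longrightarrow> x = 0"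
    have TB: "T \<in> bounded_ops G" using T commutant_bop by blast
    show "(\<lambda>g. right_act G T (b g)) \<notin> ?B"
    proof
      assume bT: "(\<lambda>g. right_act G T (b g)) \<in> ?B"
      \<comment> \<open>Scalar multiplication of a coset is a union over all its representatives.
        Each of them differs from \<open>b\<close> by an inner cocycle, so every member of the union
        is the trivial coset.\<close>
      have "\<phi> (\<lambda>k. v k \<circ> T) = (\<Union>x\<in>\<phi> v. ?B +>\<^bsub>Z1 G\<^esub> (\<lambda>g. right_act G T (x g)))"
        using sm[OF v T] by (simp add: H1_def quot_module_def Z1_def)
      also have "\<dots> = (\<Union>x\<in>\<phi> v. ?B)"
      proof (rule SUP_cong[OF refl])
        fix x assume "x \<in> \<phi> v"
        then obtain \<beta> where \<beta>: "\<beta> \<in> ?B" "x = \<beta> + b" unfolding b(2) Z1_coset by blast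
        have off: "\<beta> g \<in> ell2 G \<and> b g \<in> ell2 G" for g
          using \<beta>(1) b(1) by (cases "g \<in> carrier G") (auto simp: inner_cocycles_def cocycles_def intro!: ell2_diff)
        have "(\<lambda>g. right_act G T (x g)) = (\<lambda>g. right_act G T (\<beta> g)) + (\<lambda>g. right_act G T (b g))"
          unfolding \<beta>(2) using off right_act_add[OF TB] by (simp only: plus_fun_def[where 'a='a and 'b="'a vec"])
        then have "(\<lambda>g. right_act G T (x g)) \<in> ?B"
          using inner_cocycles_add[OF inner_cocycles_right_act[OF T \<beta>(1)] bT] by simp
        then show "?B +>\<^bsub>Z1 G\<^esub> (\<lambda>g. right_act G T (x g)) = ?B" by (rule inner_coset_self)
      qed
      also have "\<dots> = ?B" using inner_cocycles_zero unfolding b(2) Z1_coset by blast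
      finally have "\<phi> (\<lambda>k. v k \<circ> T) = \<phi> 0" using phi0 by simp
      then have "(\<lambda>k. v k \<circ> T) = 0"
        using bij IT[OF v T] zI unfolding bij_betw_def inj_on_def by blast
      then have "v i \<circ> T = 0" by (metis zero_fun_apply)
      then have AT: "A i i \<circ> T = 0" by (simp only: vi)
      have Ai: "A i i \<in> bounded_ops G" using AB i by blast
      \<comment> \<open>Taking adjoints brings the injective factor \<open>adj G T\<close> to the
        left, where it can be cancelled.\<close>
      have "adj G T \<circ> adj G (A i i) = 0"
        using adj_comp[OF Ai TB] AT adj_sum[of "{}" "\<lambda>x. 0" G] by simp
      then have "adj G (A i i) f = 0" if "f \<in> ell2 G" for f
        using inj[OF bounded_op_ell2[OF adj_bop[OF Ai] that]] by (metis comp_apply zero_fun_apply)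
      then have "adj G (A i i) = 0" by (intro bounded_op_apply_inI[OF adj_bop[OF Ai] zero_bop]) auto
      then have "A i i = adj G 0" using adj_adj[OF Ai] by simp
      then show False using i(2) adj_sum[of "{}" "\<lambda>x. 0" G] by simp
    qed
  qed
qed

lemma cocycle_add: "c \<in> cocycles G \<Longrightarrow> g \<in> carrier G \<Longrightarrow> h \<in> carrier G \<Longrightarrow> c (g \<otimes> h) = c g + lreg G g (c h)"
  and cocycle_ell2: "c \<in> cocycles G \<Longrightarrow> g \<in> carrier G \<Longrightarrow> c g \<in> ell2 G"
  by (auto simp: cocycles_def)

lemma cocycle_one: assumes c: "c \<in> cocycles G" shows "c \<one> = 0"
  using cocycle_add[OF c one_closed one_closed] lreg_one_apply[OF cocycle_ell2[OF c one_closed]] by simp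

lemma cocycle_vanishing_at:
  assumes betti: "L2_betti1 G > 0" and g: "g \<in> carrier G"
    and inj: "\<And>f. f \<in> ell2 G \<Longrightarrow> lreg G g f = f \<Longrightarrow> f = 0"
  obtains c h where "c \<in> cocycles G" "c g = 0" "h \<in> carrier G" "c h \<noteq> 0"
proof -
  obtain b where b: "b \<in> cocycles G"
    "\<And>T. T \<in> rcomm G \<Longrightarrow> (\<And>x. x \<in> ell2 G \<Longrightarrow> adj G T x = 0 \<Longrightarrow> x = 0) \<Longrightarrow>
       (\<lambda>g. right_act G T (b g)) \<notin> inner_cocycles G"
    using betti_pos_cocycle[OF betti] by metis
  let ?s = "lreg G g - id_op G"
  have s: "?s \<in> rcomm G" using g by (intro rcomm_diff lreg_rcomm rcomm_id)
  have sap: "?s f = lreg G g f - f" if "f \<in> ell2 G" for f unfolding minus_apply id_op_apply[OF that] ..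
  have sinj: "f = 0" if "f \<in> ell2 G" "?s f = 0" for f
    using inj[OF that(1)] that(2) unfolding sap[OF that(1)] by simp
  show thesis
  proof (rule right_multiple_in_range[OF cocycle_ell2[OF b(1) g] s sinj])
    fix T \<xi> assume T: "T \<in> rcomm G" "\<And>x. x \<in> ell2 G \<Longrightarrow> adj G T x = 0 \<Longrightarrow> x = 0"
      and \<xi>: "\<xi> \<in> ell2 G" "right_act G T (b g) = ?s \<xi>"
    have TB: "T \<in> bounded_ops G" using T(1) commutant_bop by blast
    define \<beta> where "\<beta> g = (if g \<in> carrier G then lreg G g \<xi> - \<xi> else 0)" for g
    define c where "c g = right_act G T (b g) - \<beta> g" for g
    have \<beta>: "\<beta> \<in> inner_cocycles G" using \<xi>(1) unfolding inner_cocycles_def \<beta>_def by blast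
    have r0: "right_act G T 0 = 0" using right_act_diff[OF TB \<xi>(1) \<xi>(1)] by simp
    have cc: "c \<in> cocycles G" unfolding cocycles_def
    proof (intro CollectI conjI allI impI ballI)
      show "c g = 0" if "g \<notin> carrier G" for g
      proof -
        have "b g = 0" using b(1) that by (simp add: cocycles_def)
        then show ?thesis using that r0 by (simp add: c_def \<beta>_def)
      qed
      show "c g \<in> ell2 G" if "g \<in> carrier G" for g
        using that \<xi>(1) right_act_ell2[OF TB cocycle_ell2[OF b(1) that]] unfolding c_def \<beta>_def
        by (simp only: if_True) (intro ell2_diff lreg_ell2)
      fix x y assume x: "x \<in> carrier G" and y: "y \<in> carrier G"
      note bx = cocycle_ell2[OF b(1) x] and by' = cocycle_ell2[OF b(1) y]
      note e = right_act_ell2[OF TB by'] lreg_ell2[OF y \<xi>(1)]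
      have 1: "right_act G T (b (x \<otimes> y)) = right_act G T (b x) + lreg G x (right_act G T (b y))"
        unfolding cocycle_add[OF b(1) x y] right_act_add[OF TB bx lreg_ell2[OF x by']] right_act_lreg[OF T(1) x by'] ..
      have 2: "lreg G x (right_act G T (b y) - (lreg G y \<xi> - \<xi>))
          = lreg G x (right_act G T (b y)) - (lreg G (x \<otimes> y) \<xi> - lreg G x \<xi>)"
        unfolding bounded_op_diff[OF lreg_bop[OF x] e(1) ell2_diff[OF e(2) \<xi>(1)]]
          bounded_op_diff[OF lreg_bop[OF x] e(2) \<xi>(1)] lreg_lreg[OF x y \<xi>(1)] ..
      show "c (x \<otimes> y) = c x + lreg G x (c y)"
        unfolding c_def \<beta>_def using x y by (simp only: m_closed if_True 1 2) (simp add: fun_eq_iff)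
    qed
    have cg: "c g = 0" using \<xi>(2) g unfolding c_def \<beta>_def sap[OF \<xi>(1)] by simp
    \<comment> \<open>Were \<open>c\<close> zero everywhere, the multiple of \<open>b\<close> by
      \<open>T\<close> would coincide with the inner cocycle \<open>\<beta>\<close>, against the
      choice of \<open>b\<close>.\<close>
    have "\<exists>h\<in>carrier G. c h \<noteq> 0"
    proof (rule ccontr)
      assume "\<not> (\<exists>h\<in>carrier G. c h \<noteq> 0)"
      then have "c h = 0" for h using cc by (cases "h \<in> carrier G") (auto simp: cocycles_def)
      then have "(\<lambda>g. right_act G T (b g)) = \<beta>" unfolding c_def by (intro ext) (metis eq_iff_diff_eq_0)
      then show False using b(2)[OF T(1) T(2)] \<beta> by simp
    qed
    then show thesis using that[OF cc cg] by blast
  qed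
qed

end

section \<open>Invariant subalgebras\<close>

context group
begin

section \<open>The integral group ring acting without kernel\<close>

lemma group_ring_act_superset:
  assumes "finite F" "{s. a s \<noteq> 0} \<subseteq> F"
  shows "group_ring_act G a f = (\<Sum>s\<in>F. vscale (of_int (a s)) (lreg G s f))"
proof -
  have "group_ring_act G a f = (\<Sum>s | a s \<noteq> 0. vscale (of_int (a s)) (lreg G s f))"
    by (simp only: group_ring_act_def sum_oper_apply oscale_apply)
  also have "\<dots> = (\<Sum>s\<in>F. vscale (of_int (a s)) (lreg G s f))"
    by (rule sum.mono_neutral_left) (use assms in \<open>auto simp: vscale_def\<close>)
  finally show ?thesis .
qed

lemma int_group_ring_add: "a \<in> int_group_ring G \<Longrightarrow> b \<in> int_group_ring G \<Longrightarrow> a + b \<in> int_group_ring G"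
proof -
  assume ab: "a \<in> int_group_ring G" "b \<in> int_group_ring G"
  have "{s. (a + b) s \<noteq> 0} \<subseteq> {s. a s \<noteq> 0} \<union> {s. b s \<noteq> 0}" by auto
  then show ?thesis using ab unfolding int_group_ring_def mem_Collect_eq by (meson finite_UnI finite_subset le_sup_iff order_trans)
qed

lemma int_group_ring_uminus: "a \<in> int_group_ring G \<Longrightarrow> - a \<in> int_group_ring G"
  by (simp add: int_group_ring_def)

lemma group_ring_act_add:
  assumes "a \<in> int_group_ring G" "b \<in> int_group_ring G"
  shows "group_ring_act G (a + b) f = group_ring_act G a f + group_ring_act G b f"
proof -
  let ?F = "{s. a s \<noteq> 0} \<union> {s. b s \<noteq> 0}"
  have F: "finite ?F" using assms by (simp add: int_group_ring_def)
  have "group_ring_act G (a + b) f = (\<Sum>s\<in>?F. vscale (of_int ((a + b) s)) (lreg G s f))"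
    by (rule group_ring_act_superset[OF F]) auto
  also have "\<dots> = (\<Sum>s\<in>?F. vscale (of_int (a s)) (lreg G s f) + vscale (of_int (b s)) (lreg G s f))"
    by (intro sum.cong refl) (simp add: fun_eq_iff algebra_simps)
  also have "\<dots> = (\<Sum>s\<in>?F. vscale (of_int (a s)) (lreg G s f)) + (\<Sum>s\<in>?F. vscale (of_int (b s)) (lreg G s f))"
    by (rule sum.distrib)
  also have "\<dots> = group_ring_act G a f + group_ring_act G b f"
    by (subst (1 2) group_ring_act_superset[OF F]) auto
  finally show ?thesis .
qed

lemma group_ring_act_uminus:
  assumes "a \<in> int_group_ring G"
  shows "group_ring_act G (- a) f = - group_ring_act G a f"
proof -
  have "- a + a = 0" by simp
  have "group_ring_act G (- a) f + group_ring_act G a f = group_ring_act G 0 f"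
    using group_ring_act_add[OF int_group_ring_uminus[OF assms] assms, of f] unfolding \<open>- a + a = 0\<close> by simp
  also have "\<dots> = 0" using group_ring_act_superset[of "{}" 0 f] by (simp only: sum.empty) simp
  finally show ?thesis by (simp only: eq_neg_iff_add_eq_0)
qed

definition group_ring_single :: "'a \<Rightarrow> 'a \<Rightarrow> int" where
  "group_ring_single t = (\<lambda>s. if s = t then 1 else 0)"

lemma group_ring_single_ring: "t \<in> carrier G \<Longrightarrow> group_ring_single t \<in> int_group_ring G"
  by (auto simp: int_group_ring_def group_ring_single_def)

lemma group_ring_act_single: "group_ring_act G (group_ring_single t) f = lreg G t f"
proof -
  have "group_ring_act G (group_ring_single t) f = (\<Sum>s\<in>{t}. vscale (of_int (group_ring_single t s)) (lreg G s f))"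
    by (rule group_ring_act_superset) (auto simp: group_ring_single_def)
  then show ?thesis by (simp add: group_ring_single_def vscale_def)
qed

end

locale no_zero_divisors_group = group +
  assumes group_ring_inj: "\<And>a. a \<in> int_group_ring G \<Longrightarrow> a \<noteq> 0 \<Longrightarrow> inj_on (group_ring_act G a) (ell2 G)"
begin

lemma group_ring_act_eq_0:
  assumes "a \<in> int_group_ring G" "a \<noteq> 0" "f \<in> ell2 G" "group_ring_act G a f = 0"
  shows "f = 0"
proof -
  have "lreg G s 0 = 0" if "a s \<noteq> 0" for s
    using bounded_op_zero[OF lreg_bop, of s] assms(1) that by (auto simp: int_group_ring_def)
  then have "group_ring_act G a 0 = 0"
    using assms(1) group_ring_act_superset[of "{s. a s \<noteq> 0}" a 0]
    by (simp add: int_group_ring_def vscale_zero)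
  then show ?thesis
    using inj_onD[OF group_ring_inj[OF assms(1,2)] _ assms(3) ell2_zero] assms(4) by simp
qed

lemma lreg_eq_imp_zero:
  assumes "x \<in> carrier G" "y \<in> carrier G" "x \<noteq> y" "f \<in> ell2 G" "lreg G x f = lreg G y f"
  shows "f = 0"
proof (rule group_ring_act_eq_0[of "group_ring_single x + - group_ring_single y"])
  have "(group_ring_single x + - group_ring_single y) x \<noteq> 0" using assms(3) by (simp add: group_ring_single_def)
  then show "group_ring_single x + - group_ring_single y \<noteq> 0" by (metis zero_fun_apply)
  show "group_ring_single x + - group_ring_single y \<in> int_group_ring G"
    using assms by (intro int_group_ring_add int_group_ring_uminus group_ring_single_ring)
  show "group_ring_act G (group_ring_single x + - group_ring_single y) f = 0"
    using assms by (simp only: group_ring_act_add group_ring_act_uminus group_ring_act_single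
        int_group_ring_uminus group_ring_single_ring) simp
qed (use assms in auto)

text \<open>The element \<open>a + v - p - 1\<close> is nonzero although its terms may overlap: its
  coefficient at the identity vanishes only for \<open>v = \<one>\<close>, and then the coefficient
  at \<open>a\<close> is 1.\<close>

lemma four_term_imp_zero:
  assumes "a \<in> carrier G" "p \<in> carrier G" "v \<in> carrier G" "a \<noteq> \<one>" "p \<noteq> \<one>" "a \<noteq> p" "f \<in> ell2 G"
    and eq: "lreg G a f + lreg G v f = lreg G p f + f"
  shows "f = 0"
proof (rule group_ring_act_eq_0[of "(group_ring_single a + group_ring_single v) + - (group_ring_single p + group_ring_single \<one>)"])
  let ?r = "(group_ring_single a + group_ring_single v) + - (group_ring_single p + group_ring_single \<one>)"
  have "?r \<one> \<noteq> 0 \<or> ?r a \<noteq> 0" using assms by (auto simp: group_ring_single_def)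
  then show "?r \<noteq> 0" by (metis zero_fun_apply)
  show "?r \<in> int_group_ring G"
    using assms by (intro int_group_ring_add int_group_ring_uminus group_ring_single_ring) auto
  have "group_ring_act G ?r f = (lreg G a f + lreg G v f) + - (lreg G p f + lreg G \<one> f)"
    using assms by (simp only: group_ring_act_add group_ring_act_uminus group_ring_act_single
        int_group_ring_uminus int_group_ring_add group_ring_single_ring one_closed)
  also have "\<dots> = 0" unfolding eq lreg_one_apply[OF assms(7)] by simp
  finally show "group_ring_act G ?r f = 0" .
qed (use assms in auto)

end

locale invariant_subalgebra = group +
  fixes M :: "'a oper set"
  assumes M: "von_neumann_subalgebra G M" and inv: "group_invariant G M"
begin

lemma M_rcomm: "T \<in> M \<Longrightarrow> T \<in> rcomm G"
  using M by (auto simp: von_neumann_subalgebra_def LG_eq)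

lemma M_bop: "T \<in> M \<Longrightarrow> T \<in> bounded_ops G"
  using M_rcomm commutant_bop by blast

lemma M_id: "id_op G \<in> M"
  and M_comp: "S \<in> M \<Longrightarrow> T \<in> M \<Longrightarrow> S \<circ> T \<in> M"
  and M_adj: "T \<in> M \<Longrightarrow> adj G T \<in> M"
  using M by (auto simp: von_neumann_subalgebra_def von_neumann_algebra_def)

lemma M_conj: "g \<in> carrier G \<Longrightarrow> T \<in> M \<Longrightarrow> lreg G g \<circ> T \<circ> lreg G (inv g) \<in> M"
  using inv unfolding group_invariant_def by (metis adj_lreg imageI)

end

section \<open>Right multiplication and commutation of vectors\<close>

context group
begin

text \<open>Stated for arbitrary subalgebras, since it serves both the given \<open>M\<close> and
  the algebras compared with it in \<open>M_eq_L_sub\<close>.\<close>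

lemma hat_lin_subspace:
  assumes M: "von_neumann_subalgebra G M" shows "lin_subspace G ((\<lambda>T. hat G T) ` M)"
proof -
  have B: "T \<in> bounded_ops G" if "T \<in> M" for T
    using M that commutant_bop unfolding von_neumann_subalgebra_def LG_eq by blast
  have A: "id_op G \<in> M" "\<And>S T. S \<in> M \<Longrightarrow> T \<in> M \<Longrightarrow> S + T \<in> M" "\<And>c T. T \<in> M \<Longrightarrow> oscale c T \<in> M"
    using M by (auto simp: von_neumann_subalgebra_def von_neumann_algebra_def)
  show ?thesis unfolding lin_subspace_def
  proof (intro conjI ballI allI)
    show "(\<lambda>T. hat G T) ` M \<subseteq> ell2 G" using B hat_ell2 by blast
    have "hat G (oscale 0 (id_op G)) = 0" by (simp add: oscale_apply vscale_zero)
    then show "0 \<in> (\<lambda>T. hat G T) ` M" using A(3)[OF A(1), of 0] by (metis imageI)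
    fix x assume "x \<in> (\<lambda>T. hat G T) ` M"
    then obtain S where S: "S \<in> M" "x = hat G S" by blast
    show "vscale c x \<in> (\<lambda>T. hat G T) ` M" for c
      unfolding S(2) oscale_apply[symmetric] using A(3)[OF S(1)] by (rule imageI)
    fix y assume "y \<in> (\<lambda>T. hat G T) ` M"
    then obtain T where T: "T \<in> M" "y = hat G T" by blast
    have "hat G (S + T) \<in> (\<lambda>T. hat G T) ` M" using A(2)[OF S(1) T(1)] by (rule imageI)
    then show "x + y \<in> (\<lambda>T. hat G T) ` M" unfolding S(2) T(2) plus_fun_apply .
  qed
qed

text \<open>\<open>right_act\<close> sees only values on the carrier and may be nonzero at functions
  off the Hilbert space; the cut-off makes it an element of \<open>bounded_ops G\<close>.\<close>

definition right_op :: "'a oper \<Rightarrow> 'a oper" where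
  "right_op T f = (if f \<in> ell2 G then right_act G T f else 0)"

lemma right_op_bop:
  assumes T: "T \<in> bounded_ops G" shows "right_op T \<in> bounded_ops G"
proof -
  obtain C where C: "C > 0" "\<And>f. f \<in> ell2 G \<Longrightarrow> ell2_norm G (adj G T f) \<le> C * ell2_norm G f"
    using bounded_op_bound[OF adj_bop[OF T]] by blast
  show ?thesis
  proof (rule bopI[where C=C])
    fix f assume f: "f \<in> ell2 G"
    show "right_op T f \<in> ell2 G" using right_act_ell2[OF T f] f by (simp add: right_op_def)
    have "right_act G T (vscale c f) = vscale c (right_act G T f)" for c
      unfolding right_act_def conj_J_vscale bounded_op_scale[OF adj_bop[OF T] conj_J_ell2[OF f]] by simp
    then show "right_op T (vscale c f) = vscale c (right_op T f)" for c
      using f ell2_vscale[OF f] by (simp only: right_op_def if_True)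
    show "ell2_norm G (right_op T f) \<le> C * ell2_norm G f"
      using C(2)[OF conj_J_ell2[OF f]] f by (simp add: right_op_def right_act_def conj_J_norm)
    fix g assume g: "g \<in> ell2 G"
    show "right_op T (f + g) = right_op T f + right_op T g"
      using f g ell2_add[OF f g] right_act_add[OF T f g] by (simp only: right_op_def if_True)
  qed (simp add: right_op_def)
qed

lemma right_op_adj:
  assumes T: "T \<in> bounded_ops G" and f: "f \<in> ell2 G" and g: "g \<in> ell2 G"
  shows "ell2_inner G (right_op T f) g = ell2_inner G f (right_op (adj G T) g)"
proof -
  have e: "adj G T (conj_J G f) \<in> ell2 G" "T (conj_J G g) \<in> ell2 G" using T f g by blast+
  have "ell2_inner G (right_op T f) g = ell2_inner G (conj_J G g) (adj G T (conj_J G f))"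
    using f g e by (simp add: right_op_def right_act_def conj_J_inner')
  also have "\<dots> = ell2_inner G (T (conj_J G g)) (conj_J G f)"
    using adj_inner[OF T conj_J_ell2[OF g] conj_J_ell2[OF f]] by simp
  also have "\<dots> = ell2_inner G f (conj_J G (T (conj_J G g)))"
    using conj_J_inner'[OF f e(2)] by (metis ell2_inner_cnj)
  also have "\<dots> = ell2_inner G f (right_op (adj G T) g)"
    using g by (simp add: right_op_def right_act_def adj_adj[OF T])
  finally show ?thesis .
qed

text \<open>Commutation is direct for left translations, passes to their span, and then to
  \<open>LG G\<close> because commuting with a fixed bounded operator survives weak limits.\<close>

lemma right_op_commute:
  assumes x: "x \<in> rcomm G" and S: "S \<in> rcomm G" and f: "f \<in> ell2 G"
  shows "S (right_op x f) = right_op x (S f)"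
proof -
  have xB: "x \<in> bounded_ops G" using x commutant_bop by blast
  have U: "{right_op x} \<subseteq> bounded_ops G" using right_op_bop[OF xB] by simp
  have "lreg G s \<in> commutant G {right_op x}" if s: "s \<in> carrier G" for s
  proof (rule commutantI[OF U lreg_bop[OF s]])
    fix U f assume "U \<in> {right_op x}" and f: "f \<in> ell2 G"
    then show "lreg G s (U f) = U (lreg G s f)"
      using right_act_lreg[OF x s f] lreg_ell2[OF s f] by (simp add: right_op_def)
  qed
  then have "lreg_span G \<subseteq> commutant G {right_op x}"
    by (auto simp: lreg_span_def subset_iff intro!: commutant_sum[OF U] commutant_oscale[OF U])
  then show ?thesis
    by (intro wot_commute[OF lreg_span_bop right_op_bop[OF xB] _ S[folded LG_eq, unfolded LG_def] f])
       (auto intro: commutantD)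
qed

text \<open>Each value of a convolution is norm continuous in either factor, so commutation extends
  from \<open>S\<close> to its closure even where the products are no longer
  square-summable.\<close>

lemma conv_cl_eq:
  assumes z: "z \<in> ell2 G" and S: "S \<subseteq> ell2 G" and eq: "\<And>s. s \<in> S \<Longrightarrow> conv z s = conv s z" and k: "k \<in> cl G S"
  shows "conv z k u = conv k z u"
proof -
  have ke: "k \<in> ell2 G" using k cl_ell2 by blast
  have "cmod (conv z k u - conv k z u) \<le> e" if e: "e > 0" for e
  proof -
    have n: "2 * ell2_norm G z + 1 > 0" using ell2_norm_nonneg[of G z] by linarith
    obtain s where s: "s \<in> S" "ell2_norm G (k - s) < e / (2 * ell2_norm G z + 1)"
      using clD[OF k divide_pos_pos[OF e n]] by blast
    have se: "s \<in> ell2 G" using s S by blast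
    have "conv z k u - conv k z u = conv z (k - s) u - conv (k - s) z u"
      unfolding conv_diff_right[OF z ke se] conv_diff_left[OF ke se z] eq[OF s(1)] by simp
    then have "cmod (conv z k u - conv k z u) \<le> cmod (conv z (k - s) u) + cmod (conv (k - s) z u)"
      using norm_triangle_ineq4 by metis
    also have "\<dots> \<le> ell2_norm G z * ell2_norm G (k - s) + ell2_norm G (k - s) * ell2_norm G z"
      by (rule add_mono[OF conv_bound[OF z ell2_diff[OF ke se]] conv_bound[OF ell2_diff[OF ke se] z]])
    also have "\<dots> \<le> (2 * ell2_norm G z + 1) * ell2_norm G (k - s)"
      using ell2_norm_nonneg[of G "k - s"] by (simp add: algebra_simps)
    also have "\<dots> \<le> e" using s(2) n by (simp add: pos_less_divide_eq mult.commute less_imp_le)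
    finally show ?thesis .
  qed
  then have "cmod (conv z k u - conv k z u) \<le> 0" by (rule field_le_epsilon) simp
  then show ?thesis by simp
qed

end

section \<open>The conditional expectation on vectors\<close>

context invariant_subalgebra
begin

definition K :: "'a vec set" where "K = cl G ((\<lambda>T. hat G T) ` M)"

definition E :: "'a oper" where "E = proj G K"

lemma hat_M_ell2: "(\<lambda>T. hat G T) ` M \<subseteq> ell2 G"
  using M_bop hat_ell2 by blast

lemma K_closed_subspace: "closed_subspace G K"
  unfolding K_def by (rule closed_subspace_cl[OF hat_lin_subspace[OF M]])

lemma K_ell2: "k \<in> K \<Longrightarrow> k \<in> ell2 G"
  by (rule closed_subspace_ell2[OF K_closed_subspace])

lemma hat_in_K: "T \<in> M \<Longrightarrow> hat G T \<in> K"
  unfolding K_def using cl_subset[OF hat_M_ell2] by blast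

lemma E_bop: "E \<in> bounded_ops G"
  unfolding E_def by (rule proj_bop[OF K_closed_subspace])

lemma K_invariant:
  assumes "U \<in> bounded_ops G" "\<forall>T\<in>M. \<exists>S\<in>M. U (hat G T) = hat G S" "k \<in> K"
  shows "U k \<in> K"
  unfolding K_def
proof (rule bounded_op_cl_invariant[OF assms(1) hat_M_ell2 _ hat_M_ell2])
  show "k \<in> cl G ((\<lambda>T. hat G T) ` M)" using assms(3) by (simp add: K_def)
  fix f assume "f \<in> (\<lambda>T. hat G T) ` M"
  then show "U f \<in> cl G ((\<lambda>T. hat G T) ` M)" using assms(2) hat_in_K by (force simp: K_def)
qed

text \<open>The common source of every equivariance of \<open>E\<close>: an operator preserving the
  vectors of \<open>M\<close> together with its adjoint commutes with the projection. It is applied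
  to left and right multiplication by \<open>M\<close> and to conjugation by group elements.\<close>

lemma E_commute:
  assumes U: "U \<in> bounded_ops G" "U' \<in> bounded_ops G"
    "\<And>f g. f \<in> ell2 G \<Longrightarrow> g \<in> ell2 G \<Longrightarrow> ell2_inner G (U f) g = ell2_inner G f (U' g)"
    and inv: "\<forall>T\<in>M. \<exists>S\<in>M. U (hat G T) = hat G S" "\<forall>T\<in>M. \<exists>S\<in>M. U' (hat G T) = hat G S"
    and f: "f \<in> ell2 G"
  shows "E (U f) = U (E f)"
  unfolding E_def by (rule proj_commute[OF K_closed_subspace U K_invariant[OF U(1) inv(1)] K_invariant[OF U(2) inv(2)] f])

lemma E_left:
  assumes x: "x \<in> M" and f: "f \<in> ell2 G" shows "E (x f) = x (E f)"
proof (rule E_commute[OF M_bop[OF x] adj_bop[OF M_bop[OF x]] adj_inner[OF M_bop[OF x]] _ _ f]; (rule ballI)?)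
  show "\<exists>S\<in>M. x (hat G T) = hat G S" if "T \<in> M" for T
    using M_comp[OF x that] by (intro bexI[of _ "x \<circ> T"]) auto
  show "\<exists>S\<in>M. adj G x (hat G T) = hat G S" if "T \<in> M" for T
    using M_comp[OF M_adj[OF x] that] by (intro bexI[of _ "adj G x \<circ> T"]) auto
qed

text \<open>Right multiplication by \<open>x\<close> takes \<open>delta \<one>\<close> to the vector
  of \<open>x\<close> and commutes with \<open>T\<close>; so on vectors of operators it is the
  product \<open>T \<circ> x\<close>.\<close>

lemma right_op_hat: assumes x: "x \<in> rcomm G" and T: "T \<in> rcomm G" shows "right_op x (hat G T) = T (hat G x)"
proof -
  have xB: "x \<in> bounded_ops G" using x commutant_bop by blast
  have d: "delta \<one> \<in> ell2 G" by auto
  have J: "conj_J G (delta \<one>) = delta \<one>"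
    by (auto simp: conj_J_def delta_def fun_eq_iff)
  have "right_op x (delta \<one>) = conj_J G (hat G (adj G x))"
    using d by (simp add: right_op_def right_act_def J)
  also have "\<dots> = hat G x" unfolding hat_adj[OF x] by (rule conj_J_conj_J[OF hat_ell2[OF xB]])
  finally show ?thesis using right_op_commute[OF x T d] by simp
qed

lemma E_right:
  assumes x: "x \<in> M" and f: "f \<in> ell2 G" shows "E (right_op x f) = right_op x (E f)"
proof (rule E_commute[OF right_op_bop[OF M_bop[OF x]] right_op_bop[OF adj_bop[OF M_bop[OF x]]] right_op_adj[OF M_bop[OF x]] _ _ f]; (rule ballI)?)
  show "\<exists>S\<in>M. right_op x (hat G T) = hat G S" if "T \<in> M" for T
    using M_comp[OF that x] right_op_hat[OF M_rcomm[OF x] M_rcomm[OF that]] by (intro bexI[of _ "T \<circ> x"]) auto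
  show "\<exists>S\<in>M. right_op (adj G x) (hat G T) = hat G S" if "T \<in> M" for T
    using M_comp[OF that M_adj[OF x]] right_op_hat[OF M_rcomm[OF M_adj[OF x]] M_rcomm[OF that]]
    by (intro bexI[of _ "T \<circ> adj G x"]) auto
qed

definition conj_op :: "'a \<Rightarrow> 'a oper" where "conj_op h = lreg G h \<circ> rreg G h"

lemma conj_op_bop: "h \<in> carrier G \<Longrightarrow> conj_op h \<in> bounded_ops G"
  unfolding conj_op_def by (intro comp_bop) auto

lemma conj_op_apply: "h \<in> carrier G \<Longrightarrow> f \<in> ell2 G \<Longrightarrow> x \<in> carrier G \<Longrightarrow> conj_op h f x = f (inv h \<otimes> x \<otimes> h)"
  by (simp add: conj_op_def lreg_apply rreg_apply rreg_ell2)

lemma conj_op_delta: "h \<in> carrier G \<Longrightarrow> g \<in> carrier G \<Longrightarrow> conj_op h (delta g) = delta (h \<otimes> g \<otimes> inv h)"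
  by (simp add: conj_op_def rreg_delta lreg_delta m_assoc)

text \<open>On the vector of an operator, \<open>conj_op h\<close> realises the conjugation by
  \<open>lreg G h\<close>, under which \<open>M\<close> is invariant.\<close>

lemma conj_op_hat:
  assumes h: "h \<in> carrier G" and T: "T \<in> M"
  shows "\<exists>S\<in>M. conj_op h (hat G T) = hat G S"
proof (rule bexI[OF _ M_conj[OF h T]])
  have "rreg G h (hat G T) = T (delta (inv h))" using rcomm_delta[OF M_rcomm[OF T], of "inv h"] h by simp
  then show "conj_op h (hat G T) = hat G (lreg G h \<circ> T \<circ> lreg G (inv h))"
    using h by (simp add: conj_op_def lreg_delta)
qed

lemma E_cj:
  assumes h: "h \<in> carrier G" and f: "f \<in> ell2 G" shows "E (conj_op h f) = conj_op h (E f)"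
proof (rule E_commute[OF conj_op_bop[OF h] conj_op_bop[OF inv_closed[OF h]] _ _ _ f])
  show "\<forall>T\<in>M. \<exists>S\<in>M. conj_op h (hat G T) = hat G S" using conj_op_hat[OF h] by blast
  show "\<forall>T\<in>M. \<exists>S\<in>M. conj_op (inv h) (hat G T) = hat G S" using conj_op_hat[OF inv_closed[OF h]] by blast
next
  fix f g assume f: "f \<in> ell2 G" and g: "g \<in> ell2 G"
  have "adj G (conj_op h) = rreg G (inv h) \<circ> lreg G (inv h)"
    unfolding conj_op_def using h by (simp add: adj_comp adj_lreg adj_rreg)
  then have "adj G (conj_op h) g = conj_op (inv h) g" using h g by (simp add: conj_op_def lreg_rreg)
  then show "ell2_inner G (conj_op h f) g = ell2_inner G f (conj_op (inv h) g)"
    using adj_inner[OF conj_op_bop[OF h] f g] by simp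
qed

lemma E_delta_ell2: "g \<in> carrier G \<Longrightarrow> E (delta g) \<in> ell2 G"
  using E_bop by auto

lemma E_delta_conj:
  "h \<in> carrier G \<Longrightarrow> g \<in> carrier G \<Longrightarrow> x \<in> carrier G \<Longrightarrow> E (delta (h \<otimes> g \<otimes> inv h)) x = E (delta g) (inv h \<otimes> x \<otimes> h)"
  using E_cj[of h "delta g"] conj_op_apply[OF _ E_delta_ell2, of h g x] by (simp add: conj_op_delta delta_ell2)

text \<open>Writing \<open>\<sigma>\<close> for conjugation by \<open>g\<close>, the relation \<open>g x = \<sigma>(x) g\<close> is carried by the bimodule map \<open>E\<close>
  to \<open>E(g) x = \<sigma>(x) E(g)\<close>; hence \<open>g\<inverse> E(g)\<close> commutes with \<open>M\<close>.\<close>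

lemma conv_E_commute:
  assumes g: "g \<in> carrier G" and k: "k \<in> K"
  shows "conv (lreg G (inv g) (E (delta g))) k u = conv k (lreg G (inv g) (E (delta g))) u"
proof (rule conv_cl_eq[OF _ hat_M_ell2 _ k[unfolded K_def]])
  let ?z = "lreg G (inv g) (E (delta g))"
  note xi = E_delta_ell2[OF g]
  show z: "?z \<in> ell2 G" using g xi by (intro lreg_ell2) auto
  fix s assume "s \<in> (\<lambda>T. hat G T) ` M"
  then obtain x where x: "x \<in> M" "s = hat G x" by blast
  note xr = M_rcomm[OF x(1)] and xB = M_bop[OF x(1)]
  let ?y = "lreg G g \<circ> x \<circ> lreg G (inv g)"
  have y: "?y \<in> M" by (rule M_conj[OF g x(1)])
  \<comment> \<open>The vector \<open>delta g\<close> multiplied by \<open>x\<close> on the right is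
    also \<open>?y\<close> applied to \<open>delta g\<close>. Both \<open>x\<close> and
    \<open>?y\<close> belong to \<open>M\<close>, so \<open>E\<close> can be pulled through either
    expression.\<close>
  have "right_op x (delta g) = lreg G g (right_op x (delta \<one>))"
    using right_op_commute[OF xr lreg_rcomm[OF g], of "delta \<one>"] g by (simp add: lreg_delta delta_ell2)
  also have "right_op x (delta \<one>) = hat G x" using right_op_hat[OF xr rcomm_id] hat_ell2[OF xB]
    by (simp add: id_op_apply delta_ell2)
  also have "lreg G g (hat G x) = ?y (delta g)" using g by (simp add: lreg_delta)
  finally have "right_op x (E (delta g)) = ?y (E (delta g))"
    using E_right[OF x(1) delta_ell2[OF g]] E_left[OF y delta_ell2[OF g]] by simp
  then have "lreg G (inv g) (right_op x (E (delta g))) = x ?z"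
    using g xi xB by (simp add: lreg_inv_lreg bounded_op_ell2 lreg_ell2)
  then have "right_op x ?z = x ?z"
    using right_op_commute[OF xr lreg_rcomm[OF inv_closed[OF g]] xi] by simp
  then have "conv ?z (hat G x) = conv (hat G x) ?z"
    using right_act_conv[OF xr z] rcomm_apply_conv[OF xr z] z by (simp add: right_op_def)
  then show "conv ?z s = conv s ?z" by (simp add: x(2))
qed

end

section \<open>Rigidity\<close>

locale isr_setting = invariant_subalgebra + no_zero_divisors_group +
  assumes torsion_free: "torsion_free G" and betti: "L2_betti1 G > 0"
begin

text \<open>A point \<open>t\<close> of the support commutes with some nontrivial power
  \<open>u\<close> of \<open>g\<close>, and \<open>c\<close> vanishes on powers of \<open>g\<close>.
  Comparing \<open>c\<close> at \<open>t \<otimes> u\<close> and \<open>u \<otimes> t\<close> shows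
  that \<open>u\<close> fixes \<open>c t\<close>, which is then 0.\<close>

lemma E_delta_support:
  assumes g: "g \<in> carrier G" "g \<noteq> \<one>" and c: "c \<in> cocycles G" "c g = 0"
    and t: "t \<in> carrier G" "E (delta g) t \<noteq> 0"
  shows "c t = 0"
proof -
  let ?\<xi> = "E (delta g)"
  note \<xi> = E_delta_ell2[OF g(1)]
  define p where "p n = inv (g [^] n) \<otimes> t \<otimes> g [^] (n::nat)" for n
  have pc: "p n \<in> carrier G" for n using g t by (simp add: p_def)
  have p\<xi>: "?\<xi> (p n) = ?\<xi> t" for n
  proof -
    have "g [^] n \<otimes> g = g \<otimes> g [^] n" using g(1) by (metis nat_pow_Suc nat_pow_Suc2)
    then have "g [^] n \<otimes> g \<otimes> inv (g [^] n) = g" using g(1) by (simp add: m_assoc)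
    then show ?thesis using E_delta_conj[of "g [^] n" g t] g t by (simp add: p_def)
  qed
  \<comment> \<open>\<open>E(g)\<close> is constant on the conjugation orbits of \<open>g\<close>, so these are finite on its support.\<close>
  have "\<not> inj p"
  proof
    assume "inj p"
    have pos: "(cmod (?\<xi> t))\<^sup>2 > 0" using t by simp
    obtain N :: nat where N: "(ell2_norm G ?\<xi>)\<^sup>2 < N * (cmod (?\<xi> t))\<^sup>2"
      using reals_Archimedean3[OF pos] by blast
    have "N * (cmod (?\<xi> t))\<^sup>2 = (\<Sum>x\<in>p ` {..<N}. (cmod (?\<xi> x))\<^sup>2)"
      using \<open>inj p\<close> by (subst sum.reindex) (auto simp: p\<xi> intro: inj_on_subset)
    also have "\<dots> \<le> (ell2_norm G ?\<xi>)\<^sup>2"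
      by (rule ell2_finite_sum_le[OF \<xi>]) (use pc in auto)
    finally show False using N by simp
  qed
  then obtain i j where ij: "p i = p j" "i < j" unfolding inj_on_def by (metis linorder_neqE_nat)
  \<comment> \<open>Equality of the conjugates by \<open>g [^] i\<close> and \<open>g [^] j\<close>
    means that \<open>t\<close> commutes with this quotient; it is nontrivial because the exponent
    is positive and the group torsion-free.\<close>
  define u where "u = g [^] (j - i)"
  have uc: "u \<in> carrier G" using g by (simp add: u_def)
  have gj: "g [^] j = u \<otimes> g [^] i" using nat_pow_mult[OF g(1), of "j - i" i] ij(2) by (simp add: u_def)
  have tu: "t \<otimes> u = u \<otimes> t"
  proof -
    let ?h = "g [^] i"
    have h: "?h \<in> carrier G" using g by simp
    have "inv ?h \<otimes> t \<otimes> ?h = inv (u \<otimes> ?h) \<otimes> t \<otimes> (u \<otimes> ?h)" using ij(1) by (simp add: p_def gj)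
    also have "\<dots> = inv ?h \<otimes> (inv u \<otimes> t \<otimes> u) \<otimes> ?h" using uc h t by (simp add: inv_mult_group m_assoc)
    finally have "t = inv u \<otimes> t \<otimes> u" using h t uc by simp
    then have "u \<otimes> t = u \<otimes> (inv u \<otimes> t \<otimes> u)" by simp
    also have "\<dots> = t \<otimes> u" using uc t by (simp add: m_assoc[symmetric])
    finally show ?thesis by simp
  qed
  have u1: "u \<noteq> \<one>" using torsion_free g ij(2) unfolding torsion_free_def u_def by (metis zero_less_diff)
  have cpow: "c (g [^] (n::nat)) = 0" for n
  proof (induction n)
    case (Suc n)
    then show ?case using cocycle_add[OF c(1), of "g [^] n" g] g c bounded_op_zero[OF lreg_bop[of "g [^] n"]] by simp
  qed (simp add: cocycle_one[OF c(1)])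
  have cu: "c u = 0" unfolding u_def by (rule cpow)
  have ct: "c t \<in> ell2 G" by (rule cocycle_ell2[OF c(1) t(1)])
  have "c t = c (t \<otimes> u)" using cocycle_add[OF c(1) t(1) uc] cu bounded_op_zero[OF lreg_bop[OF t(1)]] by simp
  also have "\<dots> = lreg G u (c t)" unfolding tu using cocycle_add[OF c(1) uc t(1)] cu by simp
  finally have "lreg G u (c t) = lreg G \<one> (c t)" using lreg_one_apply[OF ct] by simp
  then show ?thesis using lreg_eq_imp_zero[OF uc one_closed u1 ct] by simp
qed

lemma conv_single:
  assumes "f \<in> ell2 G" "g \<in> ell2 G" "a \<in> carrier G" "u \<in> carrier G"
    "\<And>v. v \<in> carrier G \<Longrightarrow> f v \<noteq> 0 \<Longrightarrow> g (inv v \<otimes> u) \<noteq> 0 \<Longrightarrow> v = a"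
  shows "conv f g u = f a * g (inv a \<otimes> u)"
proof -
  have "conv f g u = (\<Sum>\<^sub>\<infinity>v\<in>{a}. f v * g (inv v \<otimes> u))"
    unfolding conv_sum[OF assms(1,2,4)] by (rule infsum_cong_neutral) (use assms in auto)
  then show ?thesis by simp
qed

text \<open>The commuting elements \<open>g\<inverse> E(g)\<close> and \<open>h E(g) h\<inverse>\<close> live on \<open>Z\<close> and \<open>h Z h\<inverse>\<close>, where \<open>Z\<close> is the
  zero set of the cocycle \<open>c\<close>. Evaluating \<open>c\<close> on \<open>a b = b' a'\<close> with \<open>a, a' \<in> Z\<close> and
  \<open>b, b' \<in> h Z h\<inverse>\<close> gives \<open>(a - a b - 1 + b') c(h) = 0\<close>, which is impossible for \<open>a, b \<noteq> 1\<close>.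
  So the coefficient at \<open>a b\<close> shows that one of the two elements is a scalar.\<close>

lemma E_delta_cases:
  assumes g: "g \<in> carrier G" "g \<noteq> \<one>"
  shows "E (delta g) = 0 \<or> delta g \<in> K"
proof -
  obtain c h where c: "c \<in> cocycles G" "c g = 0" and h: "h \<in> carrier G" "c h \<noteq> 0"
  proof (rule cocycle_vanishing_at[OF betti g(1)])
    show "f = 0" if "f \<in> ell2 G" "lreg G g f = f" for f
      using lreg_eq_imp_zero[OF g(1) one_closed g(2) that(1)] that lreg_one_apply[OF that(1)] by simp
  qed blast
  let ?\<xi> = "E (delta g)" and ?w = "h \<otimes> g \<otimes> inv h"
  define \<zeta> where "\<zeta> = lreg G (inv g) ?\<xi>"
  define y where "y = E (delta ?w)"
  note \<xi> = E_delta_ell2[OF g(1)]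
  have \<zeta>: "\<zeta> \<in> ell2 G" unfolding \<zeta>_def using g \<xi> by (intro lreg_ell2) auto
  have wc: "?w \<in> carrier G" using g h by simp
  have y: "y \<in> ell2 G" unfolding y_def by (rule E_delta_ell2[OF wc])
  have yK: "y \<in> K" unfolding y_def E_def by (rule proj_in[OF K_closed_subspace delta_ell2[OF wc]])
  have ch: "c h \<in> ell2 G" by (rule cocycle_ell2[OF c(1) h(1)])
  have z: "lreg G x 0 = 0" if "x \<in> carrier G" for x by (rule bounded_op_zero[OF lreg_bop[OF that]])
  have \<zeta>ap: "\<zeta> a = ?\<xi> (g \<otimes> a)" if "a \<in> carrier G" for a
    using that g \<xi> by (simp add: \<zeta>_def lreg_apply)
  have yap: "y b = ?\<xi> (inv h \<otimes> b \<otimes> h)" if "b \<in> carrier G" for b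
    unfolding y_def by (rule E_delta_conj[OF h(1) g(1) that])
  \<comment> \<open>Multiplying by \<open>inv g\<close> does not leave the zero set, since
    \<open>c\<close> vanishes at \<open>g\<close> and at \<open>g \<otimes> a\<close>.\<close>
  have cZ: "c a = 0" if a: "a \<in> carrier G" "\<zeta> a \<noteq> 0" for a
  proof -
    have "c (g \<otimes> a) = 0" using E_delta_support[OF g c, of "g \<otimes> a"] a g by (simp add: \<zeta>ap)
    then have "lreg G g (c a) = 0" using cocycle_add[OF c(1) g(1) a(1)] c(2) by simp
    then show ?thesis using lreg_inv_lreg(1)[OF g(1) cocycle_ell2[OF c(1) a(1)]] z[of "inv g"] g by simp
  qed
  \<comment> \<open>\<open>b \<otimes> h = h \<otimes> k\<close> with \<open>c k = 0\<close>, so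
    \<open>c\<close> takes the same value at \<open>b \<otimes> h\<close> as at \<open>h\<close>;
    the left side is that value expanded.\<close>
  have cY: "c b + lreg G b (c h) = c h" if b: "b \<in> carrier G" "y b \<noteq> 0" for b
  proof -
    define k where "k = inv h \<otimes> b \<otimes> h"
    have k: "k \<in> carrier G" "b \<otimes> h = h \<otimes> k" using b h by (auto simp: k_def m_assoc[symmetric])
    have "c k = 0" using E_delta_support[OF g c k(1)] b by (simp add: yap k_def)
    then have "c (h \<otimes> k) = c h" using cocycle_add[OF c(1) h(1) k(1)] z[OF h(1)] by simp
    then show ?thesis using cocycle_add[OF c(1) b(1) h(1)] k(2) by simp
  qed
  have prod0: "\<zeta> a * y b = 0" if a: "a \<in> carrier G" "a \<noteq> \<one>" and b: "b \<in> carrier G" "b \<noteq> \<one>" for a b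
  proof (rule ccontr)
    assume "\<zeta> a * y b \<noteq> 0"
    then have ab: "\<zeta> a \<noteq> 0" "y b \<noteq> 0" by auto
    note ca = cZ[OF a(1) ab(1)] and cb = cY[OF b(1) ab(2)]
    let ?p = "a \<otimes> b"
    have p: "?p \<in> carrier G" using a b by simp
    have cbe: "c b \<in> ell2 G" by (rule cocycle_ell2[OF c(1) b(1)])
    have cp: "c ?p = lreg G a (c b)" using cocycle_add[OF c(1) a(1) b(1)] ca by simp
    \<comment> \<open>The left side depends only on the product \<open>?p\<close>, so
      \<open>?p\<close> determines \<open>lreg G a (c h)\<close>, and with it \<open>a\<close>,
      because distinct translates of a nonzero vector differ.\<close>
    have cp': "c ?p + lreg G ?p (c h) = lreg G a (c h)"
    proof -
      have "lreg G a (c b + lreg G b (c h)) = lreg G a (c b) + lreg G ?p (c h)"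
        using bounded_op_add[OF lreg_bop[OF a(1)] cbe lreg_ell2[OF b(1) ch]] lreg_lreg[OF a(1) b(1) ch] by simp
      then show ?thesis unfolding cb cp by simp
    qed
    have p1: "?p \<noteq> \<one>"
    proof
      assume "?p = \<one>"
      then have "lreg G \<one> (c h) = lreg G a (c h)" using cp' cocycle_one[OF c(1)] by simp
      then show False using lreg_eq_imp_zero[OF one_closed a(1) _ ch] a h by simp
    qed
    \<comment> \<open>Every factorisation that contributes satisfies the same identity as
      \<open>a\<close>, so the convolution sum has a single term.\<close>
    have "conv \<zeta> y ?p = \<zeta> a * y (inv a \<otimes> ?p)"
    proof (rule conv_single[OF \<zeta> y a(1) p])
      fix v assume v: "v \<in> carrier G" "\<zeta> v \<noteq> 0" "y (inv v \<otimes> ?p) \<noteq> 0"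
      let ?x = "inv v \<otimes> ?p"
      have x: "?x \<in> carrier G" "v \<otimes> ?x = ?p" using v p by (auto simp: m_assoc[symmetric])
      have cx: "c ?x \<in> ell2 G" by (rule cocycle_ell2[OF c(1) x(1)])
      have "lreg G v (c h) = lreg G v (c ?x + lreg G ?x (c h))" using cY[OF x(1) v(3)] by simp
      also have "\<dots> = lreg G v (c ?x) + lreg G ?p (c h)"
        using bounded_op_add[OF lreg_bop[OF v(1)] cx lreg_ell2[OF x(1) ch]] lreg_lreg[OF v(1) x(1) ch] x(2) by simp
      also have "lreg G v (c ?x) = c ?p" using cocycle_add[OF c(1) v(1) x(1)] cZ[OF v(1,2)] x(2) by simp
      also have "c ?p + lreg G ?p (c h) = lreg G a (c h)" by (rule cp')
      finally show "v = a" using lreg_eq_imp_zero[OF v(1) a(1) _ ch] h by blast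
    qed
    also have "inv a \<otimes> ?p = b" using a b by (simp add: m_assoc[symmetric])
    finally have 1: "conv \<zeta> y ?p = \<zeta> a * y b" .
    \<comment> \<open>In the reversed order the last factor lies in the zero set and
      \<open>c ?p = c v\<close>. Eliminating \<open>c v\<close> with \<open>cY\<close> leaves a
      four-term relation among translates of \<open>c h\<close>, so this convolution sum is
      empty.\<close>
    have none: "y v = 0 \<or> \<zeta> (inv v \<otimes> ?p) = 0" if v: "v \<in> carrier G" for v
    proof (rule ccontr)
      assume "\<not> (y v = 0 \<or> \<zeta> (inv v \<otimes> ?p) = 0)"
      then have nz: "y v \<noteq> 0" "\<zeta> (inv v \<otimes> ?p) \<noteq> 0" by auto
      let ?x = "inv v \<otimes> ?p"
      have x: "?x \<in> carrier G" "v \<otimes> ?x = ?p" using v p by (auto simp: m_assoc[symmetric])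
      have "c ?p = c v" using cocycle_add[OF c(1) v x(1)] cZ[OF x(1) nz(2)] z[OF v] x(2) by simp
      then have "c v + lreg G ?p (c h) = lreg G a (c h)" using cp' by simp
      then have "lreg G a (c h) + lreg G v (c h) = lreg G ?p (c h) + (c v + lreg G v (c h))"
        by (metis add.assoc add.commute)
      then have "lreg G a (c h) + lreg G v (c h) = lreg G ?p (c h) + c h" using cY[OF v nz(1)] by simp
      then show False using four_term_imp_zero[OF a(1) p v a(2) p1 _ ch] a b h by (simp add: l_cancel_one)
    qed
    then have "conv y \<zeta> ?p = 0" unfolding conv_sum[OF y \<zeta> p] by (intro infsum_0) auto
    moreover have "conv \<zeta> y ?p = conv y \<zeta> ?p" unfolding \<zeta>_def by (rule conv_E_commute[OF g(1) yK])
    ultimately show False using 1 ab by simp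
  qed
  have one_K: "delta \<one> \<in> K" using hat_in_K[OF M_id] by (simp add: id_op_apply delta_ell2)
  consider "\<forall>a\<in>carrier G. a \<noteq> \<one> \<longrightarrow> \<zeta> a = 0" | "\<forall>b\<in>carrier G. b \<noteq> \<one> \<longrightarrow> y b = 0"
    using prod0 by (metis mult_eq_0_iff)
  then show ?thesis
  proof cases
    case 1
    \<comment> \<open>Here \<open>\<zeta>\<close> is supported at the identity, and hence
      \<open>?\<xi>\<close> at \<open>g\<close>. If the coefficient is nonzero, dividing by it puts
      \<open>delta g\<close> into \<open>K\<close>.\<close>
    have "?\<xi> = vscale (?\<xi> g) (delta g)"
    proof (rule ell2_eqI[OF \<xi> ell2_vscale[OF delta_ell2[OF g(1)]]])
      fix x assume x: "x \<in> carrier G"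
      show "?\<xi> x = vscale (?\<xi> g) (delta g) x"
      proof (cases "x = g")
        case False
        have "inv g \<otimes> x \<noteq> \<one>" using False g x by (metis inv_closed inv_equality inv_inv)
        then have "?\<xi> (g \<otimes> (inv g \<otimes> x)) = 0" using 1 g x \<zeta>ap by simp
        then show ?thesis using False g x by (simp add: m_assoc[symmetric] delta_def)
      qed (simp add: delta_def)
    qed
    moreover have "?\<xi> \<in> K" unfolding E_def by (rule proj_in[OF K_closed_subspace delta_ell2[OF g(1)]])
    ultimately have "?\<xi> g = 0 \<or> vscale (inverse (?\<xi> g)) (vscale (?\<xi> g) (delta g)) \<in> K"
      using K_closed_subspace by (metis closed_subspace_def lin_subspace_def)
    moreover have "vscale (inverse (?\<xi> g)) (vscale (?\<xi> g) (delta g)) = delta g" if "?\<xi> g \<noteq> 0"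
      using that by (simp add: fun_eq_iff)
    ultimately show ?thesis using \<open>?\<xi> = vscale (?\<xi> g) (delta g)\<close> vscale_zero(2) by metis
  next
    case 2
    \<comment> \<open>The conjugate of \<open>?\<xi>\<close> is supported at the identity, so
      \<open>?\<xi>\<close> is too. Its coefficient there is 0: \<open>E\<close> is symmetric and
      fixes \<open>delta \<one>\<close>, which is orthogonal to \<open>delta g\<close>.\<close>
    have "?\<xi> x = 0" if x: "x \<in> carrier G" for x
    proof (cases "x = \<one>")
      case True
      have "?\<xi> \<one> = ell2_inner G ?\<xi> (delta \<one>)" using \<xi> by (simp add: ell2_inner_delta)
      also have "\<dots> = ell2_inner G (delta g) (E (delta \<one>))"
        unfolding E_def by (rule proj_sym[OF K_closed_subspace]) (use g in auto)
      also have "E (delta \<one>) = delta \<one>" unfolding E_def by (rule proj_id[OF K_closed_subspace one_K])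
      also have "ell2_inner G (delta g) (delta \<one>) = 0"
        unfolding ell2_inner_delta(1)[OF delta_ell2[OF g(1)] one_closed] using g by (simp add: delta_def)
      finally show ?thesis using True by simp
    next
      case False
      let ?b = "h \<otimes> x \<otimes> inv h"
      have b: "?b \<in> carrier G" "inv h \<otimes> ?b \<otimes> h = x" using h x by (auto simp: m_assoc) (simp add: m_assoc[symmetric])
      have "?b \<noteq> \<one>"
      proof
        assume "?b = \<one>"
        then have "x = inv h \<otimes> \<one> \<otimes> h" using b(2) by simp
        then show False using False h by simp
      qed
      then show ?thesis using 2 b yap[OF b(1)] by simp
    qed
    then have "?\<xi> = 0" by (intro ell2_eqI[OF \<xi> ell2_zero]) simp
    then show ?thesis by simp
  qed
qed

section \<open>The normal subgroup generating \<open>M\<close>\<close>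

definition \<Lambda> :: "'a set" where "\<Lambda> = {g \<in> carrier G. delta g \<in> K}"

text \<open>With the vector condition turned into an operator condition, the subgroup laws of
  \<open>\<Lambda>\<close> come from the algebra operations on \<open>M\<close>, and normality from
  its invariance.\<close>

lemma lreg_in_M: "g \<in> carrier G \<Longrightarrow> lreg G g \<in> M \<longleftrightarrow> g \<in> \<Lambda>"
proof
  assume g: "g \<in> carrier G"
  show "g \<in> \<Lambda>" if "lreg G g \<in> M" using hat_in_K[OF that] g by (simp add: \<Lambda>_def lreg_delta)
  assume "g \<in> \<Lambda>"
  then show "lreg G g \<in> M"
    by (intro vn_subalgebra_memI[OF M]) (use g in \<open>auto simp: \<Lambda>_def K_def LG_eq lreg_rcomm lreg_delta\<close>)
qed

lemma \<Lambda>_carrier: "g \<in> \<Lambda> \<Longrightarrow> g \<in> carrier G"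
  by (simp add: \<Lambda>_def)

lemma \<Lambda>_normal: "\<Lambda> \<lhd> G"
  unfolding normal_inv_iff
proof (intro conjI ballI)
  show "subgroup \<Lambda> G"
  proof (rule subgroupI)
    show "\<Lambda> \<subseteq> carrier G" using \<Lambda>_carrier by blast
    show "\<Lambda> \<noteq> {}" using M_id lreg_in_M[OF one_closed] by (auto simp: lreg_one)
    fix a assume a: "a \<in> \<Lambda>"
    note ac = \<Lambda>_carrier[OF a]
    show "inv a \<in> \<Lambda>" using M_adj[of "lreg G a"] a ac lreg_in_M[of "inv a"] lreg_in_M[of a] by (simp add: adj_lreg)
    fix b assume b: "b \<in> \<Lambda>"
    note bc = \<Lambda>_carrier[OF b]
    have "lreg G a \<circ> lreg G b \<in> M" using a b ac bc lreg_in_M by (intro M_comp) auto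
    then show "a \<otimes> b \<in> \<Lambda>" using ac bc lreg_in_M[of "a \<otimes> b"] by (simp add: lreg_comp)
  qed
  fix x h assume x: "x \<in> carrier G" and h: "h \<in> \<Lambda>"
  note hc = \<Lambda>_carrier[OF h]
  have "lreg G x \<circ> lreg G h \<circ> lreg G (inv x) \<in> M" using h hc lreg_in_M by (intro M_conj[OF x]) auto
  then show "x \<otimes> h \<otimes> inv x \<in> \<Lambda>" using x hc lreg_in_M[of "x \<otimes> h \<otimes> inv x"] by (simp add: lreg_comp)
qed

text \<open>The coefficient of \<open>k\<close> at \<open>t\<close> is its inner product with
  \<open>E (delta t)\<close>, because \<open>E\<close> is symmetric and fixes \<open>k\<close>;
  outside \<open>\<Lambda>\<close> the dichotomy leaves only \<open>E (delta t) = 0\<close>.\<close>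

lemma K_support:
  assumes k: "k \<in> K" and t: "t \<in> carrier G" "t \<notin> \<Lambda>" shows "k t = 0"
proof -
  \<comment> \<open>The dichotomy concerns nontrivial elements only; the identity is no exception,
    as the unit of \<open>M\<close> puts it into \<open>\<Lambda>\<close>.\<close>
  have "delta \<one> \<in> K" using hat_in_K[OF M_id] by (simp add: id_op_apply delta_ell2)
  then have "t \<noteq> \<one>" using t by (auto simp: \<Lambda>_def)
  then have E0: "E (delta t) = 0" using E_delta_cases[OF t(1)] t by (auto simp: \<Lambda>_def)
  have "k t = ell2_inner G (E k) (delta t)"
    using K_ell2[OF k] t by (simp add: E_def proj_id[OF K_closed_subspace k] ell2_inner_delta)
  also have "\<dots> = ell2_inner G k (E (delta t))"
    unfolding E_def by (rule proj_sym[OF K_closed_subspace K_ell2[OF k] delta_ell2[OF t(1)]])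
  finally show ?thesis by (simp add: E0)
qed

text \<open>\<open>L_sub\<close> is an intersection, so one inclusion is minimality. For the other,
  each competitor \<open>N\<close> is shown to contain \<open>M\<close>: truncations of the vector
  of \<open>T\<close> involve only points of \<open>\<Lambda>\<close>, hence are vectors of
  \<open>N\<close>, and convergence at \<open>delta \<one>\<close> suffices for membership.\<close>

lemma M_eq_L_sub: "M = L_sub G \<Lambda>"
proof
  show "L_sub G \<Lambda> \<subseteq> M"
    unfolding L_sub_def using M lreg_in_M \<Lambda>_carrier by (intro Inter_lower) auto
  show "M \<subseteq> L_sub G \<Lambda>" unfolding L_sub_def
  proof (rule Inter_greatest, rule subsetI)
    fix N T assume "N \<in> {M. von_neumann_subalgebra G M \<and> lreg G ` \<Lambda> \<subseteq> M}" and T: "T \<in> M"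
    then have N: "von_neumann_subalgebra G N" "lreg G ` \<Lambda> \<subseteq> N" by auto
    let ?S = "(\<lambda>S. hat G S) ` N" and ?f = "hat G T"
    note S = hat_lin_subspace[OF N(1)]
    have f: "?f \<in> ell2 G" by (rule hat_ell2[OF M_bop[OF T]])
    have "\<exists>s\<in>?S. ell2_norm G (?f - s) < e" if e: "e > 0" for e
    proof -
      obtain F where F: "finite F" "F \<subseteq> carrier G" "ell2_norm G (?f - (\<Sum>x\<in>F. vscale (?f x) (delta x))) < e"
        using ell2_finite_approx[OF f e] by blast
      have summand: "vscale (?f x) (delta x) \<in> ?S" if x: "x \<in> F" for x
      proof (cases "x \<in> \<Lambda>")
        case True
        then have "lreg G x \<in> N" "hat G (lreg G x) = delta x" using N(2) \<Lambda>_carrier by (auto simp: lreg_delta)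
        then have "delta x \<in> ?S" by (metis imageI)
        then show ?thesis using S by (simp only: lin_subspace_def)
      next
        case False
        then have "?f x = 0" using K_support[OF hat_in_K[OF T]] x F by blast
        then show ?thesis using S by (simp only: lin_subspace_def vscale_zero)
      qed
      have "(\<Sum>x\<in>I. vscale (?f x) (delta x)) \<in> ?S" if "finite I" "I \<subseteq> F" for I
        using that
      proof (induction I rule: finite_induct)
        case empty then show ?case using S by (simp only: lin_subspace_def sum.empty)
      next
        case (insert x I)
        have S_add: "u + w \<in> ?S" if "u \<in> ?S" "w \<in> ?S" for u w
          using S that by (simp only: lin_subspace_def)
        show ?case unfolding sum.insert[OF insert(1,2)]
          by (rule S_add) (use insert summand in blast)+
      qed
      from this[OF F(1)] show ?thesis using F(3) by (rule bexI[where P="\<lambda>s. ell2_norm G (?f - s) < e", rotated]) simp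
    qed
    then have "?f \<in> cl G ?S" using f by (simp add: cl_def)
    then show "T \<in> N" using M_rcomm[OF T] by (intro vn_subalgebra_memI[OF N(1)]) (auto simp: LG_eq)
  qed
qed

end

theorem theorem1p3:
  fixes \<Gamma> :: "('g, 'm) monoid_scheme"
  assumes "group \<Gamma>"
    and "countable (carrier \<Gamma>)"
    and "torsion_free \<Gamma>"
    and "L2_betti1 \<Gamma> > 0"
    and "\<And>a. a \<in> int_group_ring \<Gamma> \<Longrightarrow> a \<noteq> 0 \<Longrightarrow> inj_on (group_ring_act \<Gamma> a) (ell2 \<Gamma>)"
  shows "ISR \<Gamma>"
  unfolding ISR_def
proof (intro allI impI)
  fix M assume M: "von_neumann_subalgebra \<Gamma> M \<and> group_invariant \<Gamma> M"
  interpret group \<Gamma> by fact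
  interpret isr_setting \<Gamma> M
    using M assms by unfold_locales auto
  show "\<exists>H. H \<lhd> \<Gamma> \<and> M = L_sub \<Gamma> H" using \<Lambda>_normal M_eq_L_sub by blast
qed

end
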